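(* Let $M$ be a closed Riemannian $n$-manifold with fixed metric $g$, and let $u$ be a positive solution on $M\times(0,T)$ of the heat equation $(\Delta-\frac{\partial}{\partial t})u=0$ with $\int_M u\,dx=1$. Let $\tau=\tau(t)>0$ satisfy $\frac{d\tau}{dt}=1$, let $f=-\ln u-\frac n2\ln(4\pi\tau)$, and for a real constant $a$ define $$W(f,\tau,a):=\int_M\left(\frac{a^2\tau}{2\pi}|\nabla f|^2+f-n+\frac n2\ln\frac{2\pi}{a^2}\right)\frac{e^{-f}}{(4\pi\tau)^{n/2}}\,dx .$$ Then $$\frac{\partial W(f,\tau,a)}{\partial t}=-\frac{a^2\tau}{\pi}\int_M u\left|f_{ij}-\frac{g_{ij}}{2\tau}\right|^2dx-\frac{a^2\tau}{\pi}\int_M u\,R_{ij}f_if_j\,dx+\left(1-\frac{a^2}{2\pi}\right)\int_M u\left(\frac{|\nabla u|^2}{u^2}-\frac{\Delta u}{u}-\frac{n}{2\tau}\right)dx .$$ Moreover, if $0\le a^2\le 2\pi$, $\tau=t$ and $M$ has non-negative Ricci curvature, then $W$ is monotone non-increasing in time $t$, that is, $$\frac{\partial W(f,t,a)}{\partial t}\le 0 .$$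
   Context: $f_i$ and $f_{ij}$ denote the components of the gradient and the Hessian of $f$, $R_{ij}$ the components of the Ricci tensor of $g$, with summation over repeated indices; $|f_{ij}-\frac{g_{ij}}{2\tau}|$ is the norm of the 2-tensor $\mathrm{Hess}(f)-\frac{g}{2\tau}$. $\Delta$, $\nabla$, $|\cdot|$ and $dx$ (volume element) are taken with respect to the fixed metric $g$. Here $0<T\le\infty$. For $a=0$ the additive constant $\frac n2\ln\frac{2\pi}{a^2}$ in the definition of $W$ is undefined and is to be omitted. *)

theory Defs
  imports "HOL-Analysis.Analysis"
begin

text \<open>
  The derivative is taken at \<open>x\<close>, not within \<open>S\<close>: on open sets of finite-dimensional spaces, this is
  the usual notion of \<open>C\<^sup>k\<close>.
\<close>

primrec Ck_on :: "nat \<Rightarrow> 'a::real_normed_vector set \<Rightarrow> ('a \<Rightarrow> 'b::real_normed_vector) \<Rightarrow> bool" where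
  "Ck_on 0 S f \<longleftrightarrow> continuous_on S f"
| "Ck_on (Suc k) S f \<longleftrightarrow>
     (\<forall>x\<in>S. f differentiable (at x)) \<and> (\<forall>v. Ck_on k S (\<lambda>x. frechet_derivative f (at x) v))"

definition smooth_on :: "'a::real_normed_vector set \<Rightarrow> ('a \<Rightarrow> 'b::real_normed_vector) \<Rightarrow> bool" where
  "smooth_on S f \<longleftrightarrow> (\<forall>k. Ck_on k S f)"

text \<open>
  A chart is a pair \<open>(U, \<phi>)\<close> of its domain and its coordinate map; only the values of \<open>\<phi>\<close> on \<open>U\<close>
  matter. Tensor fields are given by their components with respect to each chart of the atlas,
  as functions of the point of the manifold.
\<close>

type_synonym ('m, 'n) chart = "'m set \<times> ('m \<Rightarrow> real ^ 'n)"

type_synonym ('m, 'n) metric = "('m, 'n) chart \<Rightarrow> 'm \<Rightarrow> real ^ 'n ^ 'n"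

definition chart_inv :: "('m, 'n) chart \<Rightarrow> real ^ 'n \<Rightarrow> 'm" where
  "chart_inv c = inv_into (fst c) (snd c)"

definition transition :: "('m, 'n) chart \<Rightarrow> ('m, 'n) chart \<Rightarrow> real ^ 'n \<Rightarrow> real ^ 'n" where
  "transition c d = snd d \<circ> chart_inv c"

text \<open>
  Closed means compact without boundary: the charts are onto open subsets of \<open>real ^ 'n\<close>. Second
  countability follows from compactness. Connectedness is not required. The atlas need not be
  maximal.
\<close>

locale closed_riemannian_manifold =
  fixes M :: "'m::t2_space set"
    and A :: "('m, 'n::finite) chart set"
    and g :: "('m, 'n) metric"
  assumes compact: "compact M"
    and covers: "M = (\<Union>c\<in>A. fst c)"
    and chart_domain: "c \<in> A \<Longrightarrow> openin (top_of_set M) (fst c)"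
    and chart_range: "c \<in> A \<Longrightarrow> open (snd c ` fst c)"
    and chart_homeo: "c \<in> A \<Longrightarrow> homeomorphism (fst c) (snd c ` fst c) (snd c) (chart_inv c)"
    and chart_compat:
      "c \<in> A \<Longrightarrow> d \<in> A \<Longrightarrow> smooth_on (snd c ` (fst c \<inter> fst d)) (transition c d)"
    and metric_smooth:
      "c \<in> A \<Longrightarrow> smooth_on (snd c ` fst c) (\<lambda>x. g c (chart_inv c x) $ i $ j)"
    and metric_sym: "c \<in> A \<Longrightarrow> p \<in> fst c \<Longrightarrow> transpose (g c p) = g c p"
    and metric_pos: "c \<in> A \<Longrightarrow> p \<in> fst c \<Longrightarrow> v \<noteq> 0 \<Longrightarrow> v \<bullet> (g c p *v v) > 0"
    and metric_tensor:
      "c \<in> A \<Longrightarrow> d \<in> A \<Longrightarrow> p \<in> fst c \<inter> fst d \<Longrightarrow>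
        J = matrix (frechet_derivative (transition c d) (at (snd c p))) \<Longrightarrow>
        g c p = transpose J ** g d p ** J"

definition partial :: "('m, 'n::finite) chart \<Rightarrow> 'n \<Rightarrow> ('m \<Rightarrow> real) \<Rightarrow> 'm \<Rightarrow> real" where
  "partial c i F p = frechet_derivative (F \<circ> chart_inv c) (at (snd c p)) (axis i 1)"

definition ginv :: "('m, 'n::finite) metric \<Rightarrow> ('m, 'n) chart \<Rightarrow> 'm \<Rightarrow> real ^ 'n ^ 'n" where
  "ginv g c p = matrix_inv (g c p)"

text \<open>\<open>christoffel g c k i j\<close> is \<open>\<Gamma>\<^sup>k\<^sub>i\<^sub>j\<close>.\<close>

definition christoffel ::
  "('m, 'n::finite) metric \<Rightarrow> ('m, 'n) chart \<Rightarrow> 'n \<Rightarrow> 'n \<Rightarrow> 'n \<Rightarrow> 'm \<Rightarrow> real" where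
  "christoffel g c k i j p = (1/2) * (\<Sum>l\<in>UNIV. ginv g c p $ k $ l *
     (partial c i (\<lambda>q. g c q $ j $ l) p + partial c j (\<lambda>q. g c q $ i $ l) p
      - partial c l (\<lambda>q. g c q $ i $ j) p))"

definition hessian ::
  "('m, 'n::finite) metric \<Rightarrow> ('m, 'n) chart \<Rightarrow> ('m \<Rightarrow> real) \<Rightarrow> 'm \<Rightarrow> real ^ 'n ^ 'n" where
  "hessian g c F p = (\<chi> i j. partial c i (partial c j F) p
     - (\<Sum>k\<in>UNIV. christoffel g c k i j p * partial c k F p))"

text \<open>
  \<open>riemann g c l k i j\<close> is the \<open>\<partial>\<^sub>l\<close>-component of \<open>R(\<partial>\<^sub>i, \<partial>\<^sub>j) \<partial>\<^sub>k\<close>, where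
  \<open>R(X, Y) = [\<nabla>\<^sub>X, \<nabla>\<^sub>Y] - \<nabla>\<^sub>[\<^sub>X\<^sub>,\<^sub>Y\<^sub>]\<close>; the Ricci tensor is its trace over \<open>l = i\<close>, which is
  positive on round spheres.
\<close>

definition riemann ::
  "('m, 'n::finite) metric \<Rightarrow> ('m, 'n) chart \<Rightarrow> 'n \<Rightarrow> 'n \<Rightarrow> 'n \<Rightarrow> 'n \<Rightarrow> 'm \<Rightarrow> real" where
  "riemann g c l k i j p =
     partial c i (christoffel g c l j k) p - partial c j (christoffel g c l i k) p
     + (\<Sum>m\<in>UNIV. christoffel g c l i m p * christoffel g c m j k p
                - christoffel g c l j m p * christoffel g c m i k p)"

definition ricci :: "('m, 'n::finite) metric \<Rightarrow> ('m, 'n) chart \<Rightarrow> 'm \<Rightarrow> real ^ 'n ^ 'n" where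
  "ricci g c p = (\<chi> j k. \<Sum>i\<in>UNIV. riemann g c i k i j p)"

definition nonneg_ricci ::
  "('m, 'n::finite) chart set \<Rightarrow> ('m, 'n) metric \<Rightarrow> bool" where
  "nonneg_ricci A g \<longleftrightarrow> (\<forall>c\<in>A. \<forall>p\<in>fst c. \<forall>v. v \<bullet> (ricci g c p *v v) \<ge> 0)"

text \<open>
  Scalars built from tensors by full contraction do not depend on the chart; they are evaluated in
  an arbitrarily chosen chart around the point. Indices are raised with \<open>ginv\<close>.
\<close>

definition chart_at :: "('m, 'n) chart set \<Rightarrow> 'm \<Rightarrow> ('m, 'n) chart" where
  "chart_at A p = (SOME c. c \<in> A \<and> p \<in> fst c)"

definition gradient ::
  "('m, 'n::finite) metric \<Rightarrow> ('m, 'n) chart \<Rightarrow> ('m \<Rightarrow> real) \<Rightarrow> 'm \<Rightarrow> real ^ 'n" where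
  "gradient g c F p = ginv g c p *v (\<chi> i. partial c i F p)"

definition grad_norm_sq ::
  "('m, 'n::finite) chart set \<Rightarrow> ('m, 'n) metric \<Rightarrow> ('m \<Rightarrow> real) \<Rightarrow> 'm \<Rightarrow> real" where
  "grad_norm_sq A g F p = (let c = chart_at A p in
     gradient g c F p \<bullet> (g c p *v gradient g c F p))"

definition laplacian ::
  "('m, 'n::finite) chart set \<Rightarrow> ('m, 'n) metric \<Rightarrow> ('m \<Rightarrow> real) \<Rightarrow> 'm \<Rightarrow> real" where
  "laplacian A g F p = (let c = chart_at A p in
     \<Sum>i\<in>UNIV. \<Sum>j\<in>UNIV. ginv g c p $ i $ j * hessian g c F p $ i $ j)"

definition tensor2_norm ::
  "('m, 'n::finite) metric \<Rightarrow> ('m, 'n) chart \<Rightarrow> real ^ 'n ^ 'n \<Rightarrow> 'm \<Rightarrow> real" where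
  "tensor2_norm g c B p = sqrt (\<Sum>i\<in>UNIV. \<Sum>j\<in>UNIV. \<Sum>k\<in>UNIV. \<Sum>l\<in>UNIV.
     ginv g c p $ i $ k * ginv g c p $ j $ l * B $ i $ j * B $ k $ l)"

definition hess_minus_metric_norm ::
  "('m, 'n::finite) chart set \<Rightarrow> ('m, 'n) metric \<Rightarrow> ('m \<Rightarrow> real) \<Rightarrow> real \<Rightarrow> 'm \<Rightarrow> real" where
  "hess_minus_metric_norm A g F s p = (let c = chart_at A p in
     tensor2_norm g c (hessian g c F p - s *\<^sub>R g c p) p)"

definition ricci_grad ::
  "('m, 'n::finite) chart set \<Rightarrow> ('m, 'n) metric \<Rightarrow> ('m \<Rightarrow> real) \<Rightarrow> 'm \<Rightarrow> real" where
  "ricci_grad A g F p = (let c = chart_at A p in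
     gradient g c F p \<bullet> (ricci g c p *v gradient g c F p))"

text \<open>The Borel measure on \<open>M\<close> which is \<open>sqrt (det g) dx\<close> in every chart of the atlas.\<close>

definition riemannian_volume ::
  "'m::t2_space set \<Rightarrow> ('m, 'n::finite) chart set \<Rightarrow> ('m, 'n) metric \<Rightarrow> 'm measure" where
  "riemannian_volume M A g = (THE \<mu>. sets \<mu> = sets (restrict_space borel M) \<and>
     (\<forall>c\<in>A. \<forall>E\<in>sets (restrict_space borel M). E \<subseteq> fst c \<longrightarrow>
        emeasure \<mu> E =
          (\<integral>\<^sup>+x\<in>snd c ` E. ennreal (sqrt (det (g c (chart_inv c x)))) \<partial>lborel)))"

definition smooth_spacetime ::
  "('m, 'n::finite) chart set \<Rightarrow> real set \<Rightarrow> (real \<Rightarrow> 'm \<Rightarrow> real) \<Rightarrow> bool" where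
  "smooth_spacetime A I u \<longleftrightarrow>
     (\<forall>c\<in>A. smooth_on ((snd c ` fst c) \<times> I) (\<lambda>(x, t). u t (chart_inv c x)))"

text \<open>The additive constant \<open>n/2 ln (2\<pi>/a\<^sup>2)\<close> is undefined for \<open>a = 0\<close> and is then omitted.\<close>

definition W_entropy ::
  "'m::t2_space set \<Rightarrow> ('m, 'n::finite) chart set \<Rightarrow> ('m, 'n) metric \<Rightarrow>
   ('m \<Rightarrow> real) \<Rightarrow> real \<Rightarrow> real \<Rightarrow> real" where
  "W_entropy M A g f \<tau> a = (let n = real CARD('n) in
     (LINT p|riemannian_volume M A g.
       (a\<^sup>2 * \<tau> / (2 * pi) * grad_norm_sq A g f p + f p - n
         + (if a = 0 then 0 else n / 2 * ln (2 * pi / a\<^sup>2)))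
       * (exp (- f p) / (4 * pi * \<tau>) powr (n / 2))))"

end

theory Submission
  imports Defs "HOL-Real_Asymp.Real_Asymp"
begin

text \<open>
  Write \<open>w = ln u\<close>, \<open>F = \<integral> \<bar>\<nabla>u\<bar>\<^sup>2 / u\<close> for the Fisher information and \<open>N = - \<integral> u ln u\<close> for the Shannon entropy. Since
  \<open>exp (- f) / (4 \<pi> \<tau>)\<^sup>n\<^sup>/\<^sup>2 = u\<close> has mass one,
  \<open>W = (a\<^sup>2 \<tau> / 2\<pi>) F + N - (n/2) ln (4 \<pi> \<tau>) + const\<close> (lemma \<open>W_entropy_eq\<close>), and everything reduces to the
  derivatives of \<open>N\<close> and \<open>F\<close>. The heat equation and integration by parts give \<open>N' = F\<close> and
  \<open>F' = - 2 \<integral> \<Delta>u \<Delta>w - \<integral> u \<Delta>\<bar>\<nabla>w\<bar>\<^sup>2\<close>. On the other hand, Bochner's formula, integrated against \<open>u\<close>, shows for every real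
  \<open>s\<close> that
  \<open>F' = - 2 (\<integral> u (\<bar>Hess f - s g\<bar>\<^sup>2 + Ric (\<nabla>f, \<nabla>f)) + 2 s F - s\<^sup>2 n)\<close>
  (lemma \<open>integral_bochner\<close>). The choice \<open>s = 1 / (2 \<tau>)\<close> is the asserted formula for \<open>W'\<close>, because the last integral
  of that formula is \<open>F - n / (2 \<tau>)\<close>.

  For the monotonicity it remains to see that \<open>F \<le> n / (2 t)\<close> if the Ricci curvature is nonnegative. The choice
  \<open>s = F / n\<close> in the same identity gives \<open>F' \<le> - (2/n) F\<^sup>2\<close>, and a solution of this Riccati inequality on \<open>(0, t]\<close> is
  bounded by \<open>n / (2 t)\<close>, whatever its behaviour at time \<open>0\<close> (lemma \<open>riccati_bound\<close>).

  The geometry behind this is done in coordinates. Bochner's formula (\<open>bochner\<close>) is obtained by writing the Laplacian as the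
  divergence of the gradient and commuting covariant derivatives of the gradient. The scalars that occur are
  evaluated in an arbitrarily chosen chart at each point, so their invariance under changes of charts is needed
  for them to be smooth and hence integrable; for the Hessian it follows from an expression by
  iterated inner products of gradients (\<open>hessian_on_gradients\<close>), for the Ricci term from Bochner's formula itself.
  The volume measure exists and is unique by the change of variables theorem, and Green's formula (\<open>green\<close>) follows
  from the divergence form of the Laplacian in charts by a partition of unity.
\<close>

section \<open>Smooth functions\<close>

lemma Ck_on_cong:
  assumes "open S" "\<And>x. x \<in> S \<Longrightarrow> f x = g x"
  shows "Ck_on k S f \<longleftrightarrow> Ck_on k S g"
  using assms(2)
proof (induction k arbitrary: f g)
  case 0
  then show ?case by (simp cong: continuous_on_cong)
next
  case (Suc k)
  have d: "f differentiable (at x) \<longleftrightarrow> g differentiable (at x)" if "x \<in> S" for x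
    using that assms(1) Suc.prems
      has_derivative_transform_within_open[of f _ x UNIV S g] has_derivative_transform_within_open[of g _ x UNIV S f]
    unfolding differentiable_def by metis
  have D: "frechet_derivative f (at x) v = frechet_derivative g (at x) v"
    if "x \<in> S" "f differentiable (at x)" for x v
    using frechet_derivative_transform_within_open[OF that(2) assms(1) that(1), of g] Suc.prems by simp
  have "Ck_on k S (\<lambda>x. frechet_derivative f (at x) v) \<longleftrightarrow> Ck_on k S (\<lambda>x. frechet_derivative g (at x) v)"
    if "\<forall>x\<in>S. f differentiable (at x)" for v
    using D that by (intro Suc.IH) auto
  then show ?case using d by auto
qed

lemma Ck_on_local:
  assumes "\<And>x. x \<in> S \<Longrightarrow> \<exists>T. open T \<and> x \<in> T \<and> Ck_on k T f"
  shows "Ck_on k S f"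
  using assms
proof (induction k arbitrary: f)
  case 0
  have "continuous (at x within S) f" if x: "x \<in> S" for x
  proof -
    obtain T where "open T" "x \<in> T" "continuous_on T f" using 0[OF x] by auto
    then have "continuous (at x) f" by (simp add: continuous_on_eq_continuous_at)
    then show ?thesis by (rule continuous_at_imp_continuous_at_within)
  qed
  then show ?case by (simp add: continuous_on_eq_continuous_within)
next
  case (Suc k)
  have "Ck_on k S (\<lambda>x. frechet_derivative f (at x) v)" for v
    by (rule Suc.IH) (use Suc.prems in fastforce)
  then show ?case using Suc.prems by fastforce
qed

lemma Ck_on_subset: "Ck_on k S f \<Longrightarrow> T \<subseteq> S \<Longrightarrow> Ck_on k T f"
  by (induction k arbitrary: f) (auto intro: continuous_on_subset)

lemma Ck_on_Suc_imp: "Ck_on (Suc k) S f \<Longrightarrow> Ck_on k S f"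
  by (induction k arbitrary: f)
     (auto intro!: continuous_at_imp_continuous_on differentiable_imp_continuous_within)

lemma frechet_derivative_eqI:
  "(f has_derivative f') (at x) \<Longrightarrow> frechet_derivative f (at x) v = f' v"
  by (metis frechet_derivative_at)

lemma Ck_on_SucI:
  assumes "open S"
    and "\<And>x. x \<in> S \<Longrightarrow> (f has_derivative f' x) (at x)"
    and "\<And>v. Ck_on k S (\<lambda>x. f' x v)"
  shows "Ck_on (Suc k) S f"
proof -
  have "Ck_on k S (\<lambda>x. frechet_derivative f (at x) v)" for v
    using assms(3)[of v] Ck_on_cong[OF assms(1), of "\<lambda>x. frechet_derivative f (at x) v" "\<lambda>x. f' x v"]
      frechet_derivative_eqI[OF assms(2)] by blast
  then show ?thesis using assms(2) by (auto simp: differentiable_def)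
qed

lemma Ck_on_SucD':
  "Ck_on (Suc k) S f \<Longrightarrow> Ck_on k S (\<lambda>x. frechet_derivative f (at x) v)"
  by simp

lemma Ck_on_SucD:
  assumes "Ck_on (Suc k) S f" "x \<in> S"
  shows "(f has_derivative frechet_derivative f (at x)) (at x)"
  using assms by (auto simp: frechet_derivative_works[symmetric])

lemma Ck_on_const [simp]: "Ck_on k S (\<lambda>x. c)"
  by (induction k arbitrary: c) auto

lemma Ck_on_add:
  assumes "open S" "Ck_on k S f" "Ck_on k S g"
  shows "Ck_on k S (\<lambda>x. f x + g x)"
  using assms(2,3)
proof (induction k arbitrary: f g)
  case 0 then show ?case by (auto intro: continuous_intros)
next
  case (Suc k)
  show ?case
    by (rule Ck_on_SucI[OF assms(1), where
          f' = "\<lambda>x v. frechet_derivative f (at x) v + frechet_derivative g (at x) v"])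
       (intro has_derivative_add Ck_on_SucD[OF Suc.prems(1)] Ck_on_SucD[OF Suc.prems(2)] Suc.IH
          Ck_on_SucD'[OF Suc.prems(1)] Ck_on_SucD'[OF Suc.prems(2)]; assumption)+
qed

lemma Ck_on_bounded_linear:
  assumes "open S" "Ck_on k S f" "bounded_linear L"
  shows "Ck_on k S (\<lambda>x. L (f x))"
  using assms(2)
proof (induction k arbitrary: f)
  case 0 then show ?case using assms(3) 
    by (auto intro: bounded_linear.continuous_on)
next
  case (Suc k)
  show ?case
    by (rule Ck_on_SucI[OF assms(1), where f' = "\<lambda>x v. L (frechet_derivative f (at x) v)"])
       (intro bounded_linear.has_derivative[OF assms(3)] Ck_on_SucD[OF Suc.prems] Suc.IH
          Ck_on_SucD'[OF Suc.prems]; assumption)+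
qed

lemma Ck_on_linear:
  assumes "open S" "bounded_linear L"
  shows "Ck_on k S L"
proof (cases k)
  case 0 then show ?thesis using assms 
    by (auto intro: linear_continuous_on)
next
  case (Suc j)
  show ?thesis unfolding Suc
    by (rule Ck_on_SucI[OF assms(1), where f' = "\<lambda>x. L"])
       (auto intro: bounded_linear_imp_has_derivative[OF assms(2)])
qed

lemma Ck_on_mult:
  fixes f g :: "'a::real_normed_vector \<Rightarrow> real"
  assumes "open S" "Ck_on k S f" "Ck_on k S g"
  shows "Ck_on k S (\<lambda>x. f x * g x)"
  using assms(2,3)
proof (induction k arbitrary: f g)
  case 0 then show ?case by (auto intro: continuous_intros)
next
  case (Suc k)
  have "Ck_on k S f" "Ck_on k S g" using Suc.prems Ck_on_Suc_imp by blast+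
  moreover have "Ck_on k S (\<lambda>x. frechet_derivative f (at x) v)" 
     "Ck_on k S (\<lambda>x. frechet_derivative g (at x) v)" for v using Suc.prems by auto
  ultimately have *: "Ck_on k S (\<lambda>x. f x * frechet_derivative g (at x) v + frechet_derivative f (at x) v * g x)" for v
    by (intro Ck_on_add Suc.IH assms(1)) auto
  show ?case
    by (rule Ck_on_SucI[OF assms(1) has_derivative_mult[OF Ck_on_SucD[OF Suc.prems(1)] Ck_on_SucD[OF Suc.prems(2)]] *])
qed

lemma Ck_on_sum:
  assumes "open S" "\<And>i. i \<in> I \<Longrightarrow> Ck_on k S (f i)"
  shows "Ck_on k S (\<lambda>x. \<Sum>i\<in>I. f i x)"
  using assms(2)
  by (induction I rule: infinite_finite_induct) (auto intro: Ck_on_add assms(1))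

text \<open>By induction on the order of differentiability, through the chain rule
  \<open>D(f \<circ> g)(x) v = (\<Sum>b. (Dg(x) v \<bullet> b) * Df(g x) b)\<close>.\<close>

lemma Ck_on_compose:
  fixes g :: "'a::real_normed_vector \<Rightarrow> 'b::euclidean_space" and f :: "'b \<Rightarrow> real"
  assumes "open S" "open T" "g ` S \<subseteq> T" "Ck_on k S g" "Ck_on k T f"
  shows "Ck_on k S (\<lambda>x. f (g x))"
  using assms(4,5)
proof (induction k arbitrary: f)
  case 0 then show ?case using assms(3)
    by (auto intro: continuous_on_compose2)
next
  case (Suc k)
  have g: "(g has_derivative frechet_derivative g (at x)) (at x)" if "x \<in> S" for x
    by (rule Ck_on_SucD[OF Suc.prems(1) that])
  have f: "(f has_derivative frechet_derivative f (at x)) (at x)" if "x \<in> T" for x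
    by (rule Ck_on_SucD[OF Suc.prems(2) that])
  have h: "((\<lambda>x. f (g x)) has_derivative (\<lambda>v. frechet_derivative f (at (g x)) (frechet_derivative g (at x) v))) (at x)"
    if "x \<in> S" for x
    using has_derivative_compose[OF g[OF that] f] that assms(3) by (auto simp: o_def)
  have e: "frechet_derivative f (at (g x)) w = (\<Sum>b\<in>Basis. (w \<bullet> b) * frechet_derivative f (at (g x)) b)"
    if "x \<in> S" for x w
  proof -
    have l: "linear (frechet_derivative f (at (g x)))"
      using f that assms(3) by (meson bounded_linear.linear has_derivative_bounded_linear image_subset_iff)
    have "frechet_derivative f (at (g x)) w = frechet_derivative f (at (g x)) (\<Sum>b\<in>Basis. (w \<bullet> b) *\<^sub>R b)"
      by (simp add: euclidean_representation)
    also have "\<dots> = (\<Sum>b\<in>Basis. (w \<bullet> b) * frechet_derivative f (at (g x)) b)"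
      by (simp add: linear_sum[OF l] linear_scale[OF l])
    finally show ?thesis .
  qed
  have h': "((\<lambda>x. f (g x)) has_derivative
      (\<lambda>v. \<Sum>b\<in>Basis. (frechet_derivative g (at x) v \<bullet> b) * frechet_derivative f (at (g x)) b)) (at x)"
    if "x \<in> S" for x by (subst e[OF that, symmetric], rule h[OF that])
  have k: "Ck_on k S g" using Suc.prems Ck_on_Suc_imp by blast
  have "Ck_on k S (\<lambda>x. \<Sum>b\<in>Basis. (frechet_derivative g (at x) v \<bullet> b) * frechet_derivative f (at (g x)) b)" for v
    by (rule Ck_on_sum[OF assms(1)], rule Ck_on_mult[OF assms(1)])
       (rule Ck_on_bounded_linear[OF assms(1) Ck_on_SucD'[OF Suc.prems(1)] bounded_linear_inner_left]
          Suc.IH[OF k Ck_on_SucD'[OF Suc.prems(2)]])+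
  then show ?case by (intro Ck_on_SucI[OF assms(1) h'])
qed

lemma Ck_on_inverse:
  fixes f :: "'a::real_normed_vector \<Rightarrow> real"
  assumes "open S" "Ck_on k S f" "\<And>x. x \<in> S \<Longrightarrow> f x \<noteq> 0"
  shows "Ck_on k S (\<lambda>x. inverse (f x))"
  using assms(2)
proof (induction k)
  case 0 then show ?case using assms(3) by (auto intro!: continuous_intros)
next
  case (Suc k)
  have IH: "Ck_on k S (\<lambda>x. inverse (f x))" using Suc Ck_on_Suc_imp by blast
  have *: "Ck_on k S (\<lambda>x. (-1) * (inverse (f x) * frechet_derivative f (at x) v * inverse (f x)))" for v
    using Suc.prems by (intro Ck_on_mult assms(1) IH Ck_on_const) auto
  have "((\<lambda>x. inverse (f x)) has_derivative
      (\<lambda>v. (-1) * (inverse (f x) * frechet_derivative f (at x) v * inverse (f x)))) (at x)" if "x \<in> S" for x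
    using Deriv.has_derivative_inverse[OF assms(3)[OF that] Ck_on_SucD[OF Suc.prems that]] by simp
  then show ?case
    by (rule Ck_on_SucI[OF assms(1) _ *])
qed

lemma smooth_on_imp_Ck_on: "smooth_on S f \<Longrightarrow> Ck_on k S f"
  by (simp add: smooth_on_def)

lemma smooth_on_cong:
  "open S \<Longrightarrow> (\<And>x. x \<in> S \<Longrightarrow> f x = g x) \<Longrightarrow> smooth_on S f \<longleftrightarrow> smooth_on S g"
  unfolding smooth_on_def using Ck_on_cong by blast

lemma smooth_on_local:
  assumes "\<And>x. x \<in> S \<Longrightarrow> \<exists>T. open T \<and> x \<in> T \<and> smooth_on T f"
  shows "smooth_on S f"
  unfolding smooth_on_def by (metis assms Ck_on_local smooth_on_def)

lemma smooth_on_subset: "smooth_on S f \<Longrightarrow> T \<subseteq> S \<Longrightarrow> smooth_on T f"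
  unfolding smooth_on_def using Ck_on_subset by blast

lemma smooth_on_imp_continuous_on: "smooth_on S f \<Longrightarrow> continuous_on S f"
  using smooth_on_imp_Ck_on[of S f 0] by simp

lemma smooth_on_has_derivative:
  "smooth_on S f \<Longrightarrow> x \<in> S \<Longrightarrow> (f has_derivative frechet_derivative f (at x)) (at x)"
  using Ck_on_SucD smooth_on_imp_Ck_on by blast

lemma smooth_on_frechet_derivative:
  "smooth_on S f \<Longrightarrow> smooth_on S (\<lambda>x. frechet_derivative f (at x) v)"
  by (metis Ck_on.simps(2) smooth_on_def)

lemma smooth_on_const [simp]: "smooth_on S (\<lambda>x. c)"
  by (simp add: smooth_on_def)

lemma smooth_on_add: "open S \<Longrightarrow> smooth_on S f \<Longrightarrow> smooth_on S g \<Longrightarrow> smooth_on S (\<lambda>x. f x + g x)"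
  by (simp add: smooth_on_def Ck_on_add)

lemma smooth_on_mult:
  fixes f g :: "'a::real_normed_vector \<Rightarrow> real"
  shows "open S \<Longrightarrow> smooth_on S f \<Longrightarrow> smooth_on S g \<Longrightarrow> smooth_on S (\<lambda>x. f x * g x)"
  by (simp add: smooth_on_def Ck_on_mult)

lemma smooth_on_bounded_linear:
  "open S \<Longrightarrow> smooth_on S f \<Longrightarrow> bounded_linear L \<Longrightarrow> smooth_on S (\<lambda>x. L (f x))"
  by (simp add: smooth_on_def Ck_on_bounded_linear)

lemma smooth_on_linear: "open S \<Longrightarrow> bounded_linear L \<Longrightarrow> smooth_on S L"
  by (simp add: smooth_on_def Ck_on_linear)

lemma smooth_on_minus: "open S \<Longrightarrow> smooth_on S f \<Longrightarrow> smooth_on S (\<lambda>x. - f x)"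
  by (rule smooth_on_bounded_linear[where L = uminus]) (auto intro: bounded_linear_minus[OF bounded_linear_ident])

lemma smooth_on_diff:
  "open S \<Longrightarrow> smooth_on S f \<Longrightarrow> smooth_on S g \<Longrightarrow> smooth_on S (\<lambda>x. f x - g x)"
  using smooth_on_add[of S f "\<lambda>x. - g x"] smooth_on_minus by fastforce

lemma smooth_on_sum:
  "open S \<Longrightarrow> (\<And>i. i \<in> I \<Longrightarrow> smooth_on S (f i)) \<Longrightarrow> smooth_on S (\<lambda>x. \<Sum>i\<in>I. f i x)"
  by (simp add: smooth_on_def Ck_on_sum)

lemma smooth_on_prod:
  fixes f :: "'i \<Rightarrow> 'a::real_normed_vector \<Rightarrow> real"
  shows "open S \<Longrightarrow> (\<And>i. i \<in> I \<Longrightarrow> smooth_on S (f i)) \<Longrightarrow> smooth_on S (\<lambda>x. \<Prod>i\<in>I. f i x)"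
  by (induction I rule: infinite_finite_induct) (auto intro: smooth_on_mult)

lemma smooth_on_inverse:
  fixes f :: "'a::real_normed_vector \<Rightarrow> real"
  shows "open S \<Longrightarrow> smooth_on S f \<Longrightarrow> (\<And>x. x \<in> S \<Longrightarrow> f x \<noteq> 0) \<Longrightarrow> smooth_on S (\<lambda>x. inverse (f x))"
  by (simp add: smooth_on_def Ck_on_inverse)

lemma smooth_on_divide:
  fixes f g :: "'a::real_normed_vector \<Rightarrow> real"
  assumes "open S" "smooth_on S f" "smooth_on S g" "\<And>x. x \<in> S \<Longrightarrow> g x \<noteq> 0"
  shows "smooth_on S (\<lambda>x. f x / g x)"
  unfolding divide_inverse by (intro smooth_on_mult smooth_on_inverse assms)

lemma smooth_on_compose:
  fixes g :: "'a::real_normed_vector \<Rightarrow> 'b::euclidean_space" and f :: "'b \<Rightarrow> real"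
  assumes "open S" "open T" "g ` S \<subseteq> T" "smooth_on S g" "smooth_on T f"
  shows "smooth_on S (\<lambda>x. f (g x))"
  using assms by (simp add: smooth_on_def Ck_on_compose)

text \<open>The derivatives of the logarithm and of the square root are reciprocals of smooth functions, of the
  argument and of the value respectively, which gives one more order of differentiability.\<close>

lemma smooth_on_ln: "smooth_on {0<..} (ln :: real \<Rightarrow> real)"
proof -
  have "Ck_on k {0<..} (ln :: real \<Rightarrow> real)" for k
  proof (cases k)
    case 0 then show ?thesis by (auto intro!: continuous_intros)
  next
    case (Suc j)
    have "Ck_on j {0<..} (\<lambda>x::real. inverse x * v)" for v
      by (rule Ck_on_mult[OF open_greaterThan
            Ck_on_inverse[OF open_greaterThan Ck_on_linear[OF open_greaterThan bounded_linear_ident]] Ck_on_const]) auto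
    moreover have "(ln has_derivative (\<lambda>v. inverse x * v)) (at x)" if "x \<in> {0<..}" for x :: real
      using DERIV_ln[of x] that by (simp add: has_field_derivative_def)
    ultimately show ?thesis unfolding Suc
      by (intro Ck_on_SucI[where f' = "\<lambda>x v. inverse x * v"]) auto
  qed
  then show ?thesis by (simp add: smooth_on_def)
qed

lemma smooth_on_sqrt: "smooth_on {0<..} (sqrt :: real \<Rightarrow> real)"
proof -
  have "Ck_on k {0<..} (sqrt :: real \<Rightarrow> real)" for k
  proof (induction k)
    case 0 then show ?case by (auto intro!: continuous_intros)
  next
    case (Suc k)
    have "Ck_on k {0<..} (\<lambda>x::real. (inverse (sqrt x) / 2) * v)" for v
      using Ck_on_mult[OF open_greaterThan Ck_on_inverse[OF open_greaterThan Suc] Ck_on_const, of "v / 2"] by simp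
    moreover have "(sqrt has_derivative (\<lambda>v. (inverse (sqrt x) / 2) * v)) (at x)" if "x \<in> {0<..}" for x :: real
      by (rule DERIV_real_sqrt[unfolded has_field_derivative_def]) (use that in simp)
    ultimately show ?case 
      by (intro Ck_on_SucI[where f' = "\<lambda>x v. (inverse (sqrt x) / 2) * v"]) auto
  qed
  then show ?thesis by (simp add: smooth_on_def)
qed

lemma smooth_on_has_real_derivative_line:
  fixes \<phi> :: "'a::real_normed_vector \<Rightarrow> real"
  assumes "smooth_on S \<phi>" "x + r *\<^sub>R v \<in> S"
  shows "((\<lambda>r. \<phi> (x + r *\<^sub>R v)) has_real_derivative frechet_derivative \<phi> (at (x + r *\<^sub>R v)) v) (at r)"
proof -
  have d: "(\<phi> has_derivative frechet_derivative \<phi> (at (x + r *\<^sub>R v))) (at (x + r *\<^sub>R v))"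
    using assms smooth_on_has_derivative by blast
  have "((\<lambda>r. x + r *\<^sub>R v) has_derivative (\<lambda>r. r *\<^sub>R v)) (at r)"
    by (auto intro!: derivative_eq_intros)
  from has_derivative_compose[OF this d]
  have "((\<lambda>r. \<phi> (x + r *\<^sub>R v)) has_derivative (\<lambda>s. frechet_derivative \<phi> (at (x + r *\<^sub>R v)) (s *\<^sub>R v))) (at r)" .
  then show ?thesis
    using bounded_linear.linear[OF has_derivative_bounded_linear[OF d]]
    by (simp add: has_field_derivative_def linear_scale mult.commute[of _ "frechet_derivative \<phi> (at (x + r *\<^sub>R v)) v"])
qed

text \<open>Two applications of the mean value theorem, first along \<open>v\<close> and then along \<open>w\<close>, turn the second
  difference into \<open>s\<^sup>2\<close> times the iterated derivative at a point near \<open>x\<close>.\<close>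

lemma second_difference_approx:
  fixes \<phi> :: "'a::real_normed_vector \<Rightarrow> real"
  assumes "open S" "smooth_on S \<phi>" "x \<in> S" "e > 0"
  shows "\<exists>d>0. \<forall>s. 0 < s \<and> s < d \<longrightarrow>
    \<bar>\<phi> (x + s *\<^sub>R v + s *\<^sub>R w) - \<phi> (x + s *\<^sub>R v) - \<phi> (x + s *\<^sub>R w) + \<phi> x
      - s\<^sup>2 * frechet_derivative (\<lambda>y. frechet_derivative \<phi> (at y) v) (at x) w\<bar> \<le> e * s\<^sup>2"
proof -
  define \<psi> where "\<psi> = (\<lambda>y. frechet_derivative \<phi> (at y) v)"
  define L where "L = (\<lambda>y. frechet_derivative \<psi> (at y) w)"
  have \<psi>: "smooth_on S \<psi>" unfolding \<psi>_def by (rule smooth_on_frechet_derivative[OF assms(2)])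
  have "continuous_on S L" unfolding L_def
    by (intro smooth_on_imp_continuous_on smooth_on_frechet_derivative \<psi>)
  then obtain d1 where d1: "d1 > 0" "\<And>y. y \<in> S \<Longrightarrow> dist y x < d1 \<Longrightarrow> dist (L y) (L x) < e"
    using assms(3,4) unfolding continuous_on_iff by metis
  obtain d2 where d2: "d2 > 0" "ball x d2 \<subseteq> S" using assms(1,3) open_contains_ball by blast
  define d where "d = min d1 d2 / (norm v + norm w + 1)"
  have pos: "norm v + norm w + 1 > 0" by (simp add: add_nonneg_pos)
  have "d > 0" using d1 d2 pos by (simp add: d_def)
  have near: "x + a *\<^sub>R v + b *\<^sub>R w \<in> S \<and> \<bar>L (x + a *\<^sub>R v + b *\<^sub>R w) - L x\<bar> < e"
    if "0 \<le> a" "a \<le> s" "0 \<le> b" "b \<le> s" "s < d" for a b s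
  proof -
    have "norm (a *\<^sub>R v + b *\<^sub>R w) \<le> \<bar>a\<bar> * norm v + \<bar>b\<bar> * norm w"
      using norm_triangle_ineq[of "a *\<^sub>R v" "b *\<^sub>R w"] by simp
    also have "\<dots> \<le> s * norm v + s * norm w" using that by (intro add_mono mult_right_mono) auto
    also have "\<dots> \<le> s * (norm v + norm w + 1)" using that by (simp add: algebra_simps)
    also have "\<dots> < d * (norm v + norm w + 1)" using that pos by simp
    also have "\<dots> = min d1 d2" using pos by (simp add: d_def)
    finally have "dist (x + a *\<^sub>R v + b *\<^sub>R w) x < min d1 d2" by (simp add: dist_norm add.assoc)
    then show ?thesis using d1(2) d2(2) by (auto simp: dist_commute dist_real_def subset_iff)
  qed
  show ?thesis
  proof (intro exI[of _ d] conjI allI impI \<open>d > 0\<close>, elim conjE)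
    fix s :: real assume s: "0 < s" "s < d"
    have dh: "((\<lambda>r. \<phi> (x + r *\<^sub>R v + s *\<^sub>R w) - \<phi> (x + r *\<^sub>R v)) has_real_derivative
        \<psi> (x + r *\<^sub>R v + s *\<^sub>R w) - \<psi> (x + r *\<^sub>R v)) (at r)" if "0 \<le> r" "r \<le> s" for r
      using smooth_on_has_real_derivative_line[OF assms(2), of "x + s *\<^sub>R w" r v]
        smooth_on_has_real_derivative_line[OF assms(2), of x r v] near[of r s s] near[of r s 0] that s
      unfolding \<psi>_def by (intro DERIV_diff) (auto simp: add_ac)
    obtain r1 where r1: "0 < r1" "r1 < s" 
      "(\<phi> (x + s *\<^sub>R v + s *\<^sub>R w) - \<phi> (x + s *\<^sub>R v)) - (\<phi> (x + 0 *\<^sub>R v + s *\<^sub>R w) - \<phi> (x + 0 *\<^sub>R v))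
       = (s - 0) * (\<psi> (x + r1 *\<^sub>R v + s *\<^sub>R w) - \<psi> (x + r1 *\<^sub>R v))"
      using MVT2[OF s(1) dh] by auto
    have dp: "((\<lambda>r. \<psi> (x + r1 *\<^sub>R v + r *\<^sub>R w)) has_real_derivative L (x + r1 *\<^sub>R v + r *\<^sub>R w)) (at r)"
      if "0 \<le> r" "r \<le> s" for r
      unfolding L_def using near[of r1 s r] that s r1 
      by (intro smooth_on_has_real_derivative_line[OF \<psi>]) auto
    obtain r2 where r2: "0 < r2" "r2 < s" 
      "\<psi> (x + r1 *\<^sub>R v + s *\<^sub>R w) - \<psi> (x + r1 *\<^sub>R v + 0 *\<^sub>R w) = (s - 0) * L (x + r1 *\<^sub>R v + r2 *\<^sub>R w)"
      using MVT2[OF s(1) dp] by auto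
    have "\<phi> (x + s *\<^sub>R v + s *\<^sub>R w) - \<phi> (x + s *\<^sub>R v) - \<phi> (x + s *\<^sub>R w) + \<phi> x - s\<^sup>2 * L x
       = s\<^sup>2 * (L (x + r1 *\<^sub>R v + r2 *\<^sub>R w) - L x)"
      using r1(3) r2(3) by (simp add: power2_eq_square algebra_simps)
    moreover have "\<bar>L (x + r1 *\<^sub>R v + r2 *\<^sub>R w) - L x\<bar> \<le> e" using near[of r1 s r2] r1 r2 s by auto
    ultimately have "\<bar>\<phi> (x + s *\<^sub>R v + s *\<^sub>R w) - \<phi> (x + s *\<^sub>R v) - \<phi> (x + s *\<^sub>R w) + \<phi> x - s\<^sup>2 * L x\<bar> \<le> e * s\<^sup>2"
      by (simp add: abs_mult mult.commute[of e] mult_left_mono)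
    then show "\<bar>\<phi> (x + s *\<^sub>R v + s *\<^sub>R w) - \<phi> (x + s *\<^sub>R v) - \<phi> (x + s *\<^sub>R w) + \<phi> x
      - s\<^sup>2 * frechet_derivative (\<lambda>y. frechet_derivative \<phi> (at y) v) (at x) w\<bar> \<le> e * s\<^sup>2"
      by (simp add: L_def \<psi>_def)
  qed
qed

text \<open>Schwarz: both iterated derivatives are the limit of the same symmetric second difference.\<close>

lemma frechet_derivative_commute:
  fixes \<phi> :: "'a::real_normed_vector \<Rightarrow> real"
  assumes "open S" "smooth_on S \<phi>" "x \<in> S"
  shows "frechet_derivative (\<lambda>y. frechet_derivative \<phi> (at y) v) (at x) w
       = frechet_derivative (\<lambda>y. frechet_derivative \<phi> (at y) w) (at x) v"
    (is "?a = ?b")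
proof (rule ccontr)
  assume "?a \<noteq> ?b"
  define e where "e = \<bar>?a - ?b\<bar> / 4"
  have e: "e > 0" using \<open>?a \<noteq> ?b\<close> by (simp add: e_def)
  obtain d1 where d1: "d1 > 0" "\<And>s. 0 < s \<Longrightarrow> s < d1 \<Longrightarrow> 
    \<bar>\<phi> (x + s *\<^sub>R v + s *\<^sub>R w) - \<phi> (x + s *\<^sub>R v) - \<phi> (x + s *\<^sub>R w) + \<phi> x - s\<^sup>2 * ?a\<bar> \<le> e * s\<^sup>2"
    using second_difference_approx[OF assms e] by blast
  obtain d2 where d2: "d2 > 0" "\<And>s. 0 < s \<Longrightarrow> s < d2 \<Longrightarrow> 
    \<bar>\<phi> (x + s *\<^sub>R w + s *\<^sub>R v) - \<phi> (x + s *\<^sub>R w) - \<phi> (x + s *\<^sub>R v) + \<phi> x - s\<^sup>2 * ?b\<bar> \<le> e * s\<^sup>2"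
    using second_difference_approx[OF assms e] by blast
  define s where "s = min d1 d2 / 2"
  have s: "0 < s" "s < d1" "s < d2" using d1 d2 by (auto simp: s_def)
  have "x + s *\<^sub>R w + s *\<^sub>R v = x + s *\<^sub>R v + s *\<^sub>R w" by simp
  then have "\<bar>s\<^sup>2 * ?a - s\<^sup>2 * ?b\<bar> \<le> 2 * (e * s\<^sup>2)"
    using d1(2)[OF s(1,2)] d2(2)[OF s(1,3)] by (simp only: abs_le_iff) linarith
  then have "s\<^sup>2 * \<bar>?a - ?b\<bar> \<le> s\<^sup>2 * (2 * e)"
    by (simp add: abs_mult right_diff_distrib[symmetric] mult_ac)
  then have "\<bar>?a - ?b\<bar> \<le> 2 * e" using s(1) by simp
  then show False using e by (simp add: e_def)
qed

text \<open>The classical smooth function that is flat at \<open>0\<close>. The whole family is smooth at once, because the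
  derivative of a member is a combination of members.\<close>

definition flat_exp :: "nat \<Rightarrow> real \<Rightarrow> real" where
  "flat_exp m s = (if s \<le> 0 then 0 else exp (- 1 / s) / s ^ m)"

lemma flat_exp_tendsto_0: "flat_exp m \<midarrow>0\<rightarrow> 0"
proof -
  have "((\<lambda>s. exp (- 1 / s) / s ^ m) \<longlongrightarrow> 0) (at_right (0::real))"
    by real_asymp
  then have "(flat_exp m \<longlongrightarrow> 0) (at_right 0)"
    by (rule Lim_transform_eventually) (auto simp: flat_exp_def eventually_at_filter)
  moreover have "(flat_exp m \<longlongrightarrow> 0) (at_left 0)"
    by (rule Lim_transform_eventually[OF tendsto_const]) (auto simp: flat_exp_def eventually_at_filter)
  ultimately show ?thesis by (simp add: filterlim_split_at)
qed

lemma flat_exp_has_derivative: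
  "(flat_exp m has_real_derivative flat_exp (m + 2) s - m * flat_exp (Suc m) s) (at s)"
proof -
  consider "s < 0" | "s = 0" | "s > 0" by linarith
  then show ?thesis
  proof cases
    case 1
    have "(flat_exp m has_real_derivative 0) (at s)"
      by (rule has_field_derivative_transform_within_open[of "\<lambda>_. 0" _ _ "{..<0}"]) (use 1 in \<open>auto simp: flat_exp_def\<close>)
    then show ?thesis using 1 by (simp add: flat_exp_def)
  next
    case 2
    have "(\<lambda>h. (flat_exp m (0 + h) - flat_exp m 0) / h) \<midarrow>0\<rightarrow> 0"
      by (rule Lim_transform_eventually[OF flat_exp_tendsto_0[of "Suc m"]])
         (auto simp: flat_exp_def eventually_at_filter)
    then show ?thesis unfolding DERIV_def 2 by (simp add: flat_exp_def)
  next
    case 3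
    have "((\<lambda>s. exp (- 1 / s) / s ^ m) has_real_derivative flat_exp (m + 2) s - m * flat_exp (Suc m) s) (at s)"
    proof (rule DERIV_cong)
      show "((\<lambda>s. exp (- 1 / s) / s ^ m) has_real_derivative
          (exp (- 1 / s) * (1 / s\<^sup>2) * s ^ m - exp (- 1 / s) * (real m * s ^ (m - Suc 0))) / (s ^ m * s ^ m)) (at s)"
        using 3 by (auto intro!: derivative_eq_intros simp: power2_eq_square)
      have "real m * s ^ (m - Suc 0) = real m * s ^ m / s" using 3 by (cases m) auto
      then show "(exp (- 1 / s) * (1 / s\<^sup>2) * s ^ m - exp (- 1 / s) * (real m * s ^ (m - Suc 0))) / (s ^ m * s ^ m)
         = flat_exp (m + 2) s - m * flat_exp (Suc m) s"
        using 3 by (simp add: flat_exp_def diff_divide_distrib power2_eq_square)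
    qed
    then show ?thesis
      by (rule has_field_derivative_transform_within_open[of _ _ _ "{0<..}"]) (use 3 in \<open>auto simp: flat_exp_def\<close>)
  qed
qed

lemma smooth_on_flat_exp: "smooth_on UNIV (flat_exp m)"
proof -
  have "Ck_on k UNIV (flat_exp m)" for k
  proof (induction k arbitrary: m)
    case 0 
    have "isCont (flat_exp m) s" for s using flat_exp_has_derivative by (rule DERIV_isCont)
    then show ?case by (simp add: continuous_at_imp_continuous_on)
  next
    case (Suc k)
    have "Ck_on k UNIV (\<lambda>s. (flat_exp (m + 2) s + (- real m) * flat_exp (Suc m) s) * v)" for v
      by (intro Ck_on_mult[OF open_UNIV] Ck_on_add[OF open_UNIV] Suc Ck_on_const)
    then show ?case
      by (intro Ck_on_SucI[where f' = "\<lambda>s v. (flat_exp (m + 2) s + (- real m) * flat_exp (Suc m) s) * v"])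
         (use flat_exp_has_derivative[of m] in \<open>auto simp: has_field_derivative_def\<close>)
  qed
  then show ?thesis by (simp add: smooth_on_def)
qed

section \<open>Determinants and positive semidefinite matrices\<close>

lemma matrix_inv_inverse:
  fixes A :: "real^'n^'n"
  assumes "det A \<noteq> 0"
  shows "A ** matrix_inv A = mat 1" "matrix_inv A ** A = mat 1"
proof -
  have "\<exists>B. A ** B = mat 1 \<and> B ** A = mat 1"
    using assms by (simp add: invertible_det_nz[symmetric] invertible_def)
  then have "A ** matrix_inv A = mat 1 \<and> matrix_inv A ** A = mat 1"
    unfolding matrix_inv_def by (rule someI_ex)
  then show "A ** matrix_inv A = mat 1" "matrix_inv A ** A = mat 1" by auto
qed

lemma matrix_inv_unique:
  fixes A :: "real^'n^'n"
  assumes "A ** B = mat 1"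
  shows "matrix_inv A = B"
proof -
  have "det A \<noteq> 0" using assms det_mul[of A B] by auto
  from matrix_inv_inverse(2)[OF this] show ?thesis
    by (metis assms matrix_mul_assoc matrix_mul_lid matrix_mul_rid)
qed

lemma matrix_inv_sym:
  fixes A :: "real^'n^'n"
  assumes "det A \<noteq> 0" "transpose A = A"
  shows "transpose (matrix_inv A) = matrix_inv A"
proof -
  have "A ** transpose (matrix_inv A) = transpose (matrix_inv A ** A)"
    by (simp add: matrix_transpose_mul assms(2))
  also have "\<dots> = mat 1" by (simp add: matrix_inv_inverse(2)[OF assms(1)] transpose_mat)
  finally show ?thesis by (metis matrix_inv_unique)
qed

lemma matrix_mult_component:
  "(A ** B) $ i $ j = (\<Sum>k\<in>UNIV. A $ i $ k * B $ k $ j)"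
  by (simp add: matrix_matrix_mult_def)

lemma smooth_on_det:
  fixes A :: "'a::real_normed_vector \<Rightarrow> real^'n^'n"
  assumes "open S" "\<And>i j. smooth_on S (\<lambda>x. A x $ i $ j)"
  shows "smooth_on S (\<lambda>x. det (A x))"
  unfolding det_def
  by (intro smooth_on_sum smooth_on_mult smooth_on_const smooth_on_prod assms)

text \<open>By Cramer's rule the entries of the inverse are quotients of determinants.\<close>

lemma smooth_on_matrix_inv:
  fixes A :: "'a::real_normed_vector \<Rightarrow> real^'n^'n"
  assumes "open S" "\<And>i j. smooth_on S (\<lambda>x. A x $ i $ j)" "\<And>x. x \<in> S \<Longrightarrow> det (A x) \<noteq> 0"
  shows "smooth_on S (\<lambda>x. matrix_inv (A x) $ i $ j)"
proof -
  have eq: "matrix_inv (A x) $ i $ j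
      = det (\<chi> k l. if l = i then axis j 1 $ k else A x $ k $ l) / det (A x)" if "x \<in> S" for x
  proof -
    have "A x *v (matrix_inv (A x) *v axis j 1) = axis j 1"
      by (simp add: matrix_vector_mul_assoc matrix_inv_inverse(1)[OF assms(3)[OF that]])
    then have "matrix_inv (A x) *v axis j 1
       = (\<chi> i. det (\<chi> k l. if l = i then axis j 1 $ k else A x $ k $ l) / det (A x))"
      using cramer[OF assms(3)[OF that]] by blast
    then have "(matrix_inv (A x) *v axis j 1) $ i
       = det (\<chi> k l. if l = i then axis j 1 $ k else A x $ k $ l) / det (A x)" by simp
    then show ?thesis by (simp add: matrix_vector_mult_basis column_def)
  qed
  have "smooth_on S (\<lambda>x. det (\<chi> k l. if l = i then axis j 1 $ k else A x $ k $ l) / det (A x))"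
  proof (intro smooth_on_divide smooth_on_det assms)
    show "smooth_on S (\<lambda>x. (\<chi> k l. if l = i then axis j 1 $ k else A x $ k $ l) $ k $ l)" for k l
      by (cases "l = i") (auto simp: assms(2))
  qed
  then show ?thesis by (rule smooth_on_cong[OF assms(1), THEN iffD2, rotated]) (rule eq)
qed

text \<open>Jacobi's formula. Differentiating the Leibniz expansion replaces one row at a time by its
  derivative, and a determinant with a replaced row is evaluated by Cramer's lemma.\<close>

lemma has_derivative_det:
  fixes A :: "'a::real_normed_vector \<Rightarrow> real^'n^'n"
  assumes D: "\<And>i j. ((\<lambda>x. A x $ i $ j) has_derivative D i j) (at x)" and nz: "det (A x) \<noteq> 0"
  shows "((\<lambda>x. det (A x)) has_derivative
    (\<lambda>v. det (A x) * (\<Sum>i\<in>UNIV. \<Sum>j\<in>UNIV. matrix_inv (A x) $ i $ j * D j i v))) (at x)"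
proof -
  let ?P = "{p. p permutes (UNIV :: 'n set)}"
  have 1: "((\<lambda>x. det (A x)) has_derivative
    (\<lambda>v. \<Sum>p\<in>?P. of_int (sign p) * (\<Sum>i\<in>UNIV. D i (p i) v * (\<Prod>j\<in>UNIV - {i}. A x $ j $ p j)))) (at x)"
    unfolding det_def
    by (intro has_derivative_sum has_derivative_mult_right has_derivative_prod D)
  have "(\<Sum>p\<in>?P. of_int (sign p) * (\<Sum>i\<in>UNIV. D i (p i) v * (\<Prod>j\<in>UNIV - {i}. A x $ j $ p j)))
      = det (A x) * (\<Sum>i\<in>UNIV. \<Sum>j\<in>UNIV. matrix_inv (A x) $ i $ j * D j i v)" for v
  proof -
    \<comment> \<open>The matrix \<open>A x\<close> with row \<open>i\<close> replaced by its derivative.\<close>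
    define R where "R = (\<lambda>i. \<chi> k. if k = i then (\<chi> l. D i l v) else row k (A x))"
    have detR: "det (R i) = (\<Sum>l\<in>UNIV. D i l v * matrix_inv (A x) $ l $ i) * det (A x)" for i
    proof -
      \<comment> \<open>The coefficients of the derivative of row \<open>i\<close> in the basis of the rows of \<open>A x\<close>.\<close>
      define c where "c = (\<chi> m. \<Sum>l\<in>UNIV. D i l v * matrix_inv (A x) $ l $ m)"
      have "(\<Sum>m\<in>UNIV. c $ m *s row m (A x)) = (\<chi> l. D i l v)"
      proof (subst vec_eq_iff, rule allI)
        fix k
        have "(\<Sum>m\<in>UNIV. c $ m *s row m (A x)) $ k
            = (\<Sum>m\<in>UNIV. \<Sum>l\<in>UNIV. D i l v * (matrix_inv (A x) $ l $ m * A x $ m $ k))"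
          by (simp add: c_def row_def sum_distrib_right mult.assoc)
        also have "\<dots> = (\<Sum>l\<in>UNIV. \<Sum>m\<in>UNIV. D i l v * (matrix_inv (A x) $ l $ m * A x $ m $ k))"
          by (rule sum.swap)
        also have "\<dots> = (\<Sum>l\<in>UNIV. D i l v * (matrix_inv (A x) ** A x) $ l $ k)"
          by (simp add: matrix_mult_component sum_distrib_left)
        also have "\<dots> = D i k v"
          by (simp add: matrix_inv_inverse(2)[OF nz] mat_def if_distrib cong: if_cong)
        finally show "(\<Sum>m\<in>UNIV. c $ m *s row m (A x)) $ k = (\<chi> l. D i l v) $ k" by simp
      qed
      then show ?thesis
        using cramer_lemma_transpose[of i c "A x"] by (simp only: R_def) (simp add: c_def)
    qed
    have "(\<Sum>p\<in>?P. of_int (sign p) * (\<Sum>i\<in>UNIV. D i (p i) v * (\<Prod>j\<in>UNIV - {i}. A x $ j $ p j)))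
        = (\<Sum>i\<in>UNIV. \<Sum>p\<in>?P. of_int (sign p) * (D i (p i) v * (\<Prod>j\<in>UNIV - {i}. A x $ j $ p j)))"
      by (simp add: sum_distrib_left) (rule sum.swap)
    also have "\<dots> = (\<Sum>i\<in>UNIV. det (R i))"
    proof (rule sum.cong[OF refl])
      fix i :: 'n
      have "(\<Prod>j\<in>UNIV. R i $ j $ p j) = D i (p i) v * (\<Prod>j\<in>UNIV - {i}. A x $ j $ p j)" for p
        by (subst prod.remove[of _ i]) (auto simp: R_def row_def intro!: prod.cong)
      then show "(\<Sum>p\<in>?P. of_int (sign p) * (D i (p i) v * (\<Prod>j\<in>UNIV - {i}. A x $ j $ p j))) = det (R i)"
        by (simp add: det_def)
    qed
    also have "\<dots> = (\<Sum>i\<in>UNIV. (\<Sum>l\<in>UNIV. D i l v * matrix_inv (A x) $ l $ i) * det (A x))"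
      by (simp only: detR)
    also have "\<dots> = det (A x) * (\<Sum>i\<in>UNIV. \<Sum>l\<in>UNIV. matrix_inv (A x) $ l $ i * D i l v)"
      by (simp add: sum_distrib_left sum_distrib_right mult_ac)
    also have "\<dots> = det (A x) * (\<Sum>i\<in>UNIV. \<Sum>j\<in>UNIV. matrix_inv (A x) $ i $ j * D j i v)"
      by (subst sum.swap) (rule refl)
    finally show ?thesis .
  qed
  then show ?thesis using 1 by simp
qed

text \<open>Expansion of a quadratic form at \<open>x + c e\<^sub>s\<close>, with \<open>e\<^sub>s\<close> a vector of the standard basis.\<close>

lemma quadratic_form_update:
  fixes P :: "'n::finite \<Rightarrow> 'n \<Rightarrow> real"
  assumes "\<And>i j. P i j = P j i"
  shows "(\<Sum>i\<in>UNIV. \<Sum>j\<in>UNIV. (x i + (if i = s then c else 0)) * (x j + (if j = s then c else 0)) * P i j)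
     = (\<Sum>i\<in>UNIV. \<Sum>j\<in>UNIV. x i * x j * P i j) + 2 * c * (\<Sum>j\<in>UNIV. x j * P j s) + c\<^sup>2 * P s s"
proof -
  have inner: "(\<Sum>j\<in>UNIV. (x i + (if i = s then c else 0)) * (x j + (if j = s then c else 0)) * P i j)
      = (\<Sum>j\<in>UNIV. x i * x j * P i j) + x i * c * P i s
        + (if i = s then c * ((\<Sum>j\<in>UNIV. x j * P s j) + c * P s s) else 0)" for i
    by (cases "i = s")
       (simp_all add: distrib_left distrib_right mult_delta_left mult_delta_right sum.distrib sum_distrib_left mult_ac)
  have "(\<Sum>i\<in>UNIV. x i * c * P i s) = c * (\<Sum>j\<in>UNIV. x j * P j s)"
    by (simp add: sum_distrib_left mult_ac)
  moreover have "(\<Sum>j\<in>UNIV. x j * P s j) = (\<Sum>j\<in>UNIV. x j * P j s)"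
    by (rule sum.cong[OF refl], rule arg_cong[of "P s _"], rule assms)
  ultimately show ?thesis unfolding inner
    by (simp add: sum.distrib power2_eq_square distrib_left)
qed

text \<open>Cholesky: split off one rank-one piece per index, shrinking the support by that index.\<close>

lemma positive_semidefinite_gram_aux:
  fixes P :: "'n::finite \<Rightarrow> 'n \<Rightarrow> real"
  assumes "finite S"
    and "\<And>i j. P i j = P j i"
    and "\<And>x. (\<Sum>i\<in>UNIV. \<Sum>j\<in>UNIV. x i * x j * P i j) \<ge> 0"
    and "\<And>i j. i \<notin> S \<Longrightarrow> P i j = 0"
  shows "\<exists>V. \<forall>i j. P i j = (\<Sum>a\<in>S. V a i * V a j)"
  using assms
proof (induction S arbitrary: P rule: finite_induct)
  case empty
  then show ?case by simp
next
  case (insert s S)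
  note sym = insert.prems(1) and psd = insert.prems(2) and supp = insert.prems(3)
  have diag: "P s s \<ge> 0"
    using psd[of "\<lambda>i. if i = s then 1 else 0"] by (simp add: mult_delta_left mult_delta_right)
  show ?case
  proof (cases "P s s = 0")
    case True
    have row0: "P s j = 0" for j
    proof (rule ccontr)
      assume nz: "P s j \<noteq> 0"
      \<comment> \<open>With a zero on the diagonal the form is affine in \<open>c\<close> at \<open>e\<^sub>j + c e\<^sub>s\<close>; this \<open>c\<close> makes it \<open>- 1\<close>.\<close>
      define c where "c = - (P j j + 1) / (2 * P s j)"
      have "0 \<le> P j j + 2 * c * P j s"
        using psd[of "\<lambda>i. (if i = j then 1 else 0) + (if i = s then c else 0)"]
          quadratic_form_update[OF sym, of "\<lambda>i. if i = j then 1 else 0" s c] True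
        by (simp add: mult_delta_left mult_delta_right)
      moreover have "2 * c * P j s = - (P j j + 1)" using nz sym[of j s] by (simp add: c_def)
      ultimately show False by simp
    qed
    have "P i j = 0" if "i \<notin> S" for i j
      using that supp row0 by (cases "i = s") auto
    then obtain V where V: "\<forall>i j. P i j = (\<Sum>a\<in>S. V a i * V a j)"
      using insert.IH[OF sym psd] by blast
    have "(\<Sum>a\<in>S. (V(s := \<lambda>_. 0)) a i * (V(s := \<lambda>_. 0)) a j) = (\<Sum>a\<in>S. V a i * V a j)" for i j
      using insert.hyps by (intro sum.cong) auto
    then show ?thesis
      using V insert.hyps by (intro exI[of _ "V(s := \<lambda>_. 0)"]) simp
  next
    case False
    then have pos: "P s s > 0" using diag by simp
    \<comment> \<open>The Schur complement of the entry \<open>P s s\<close>.\<close>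
    define Q where "Q = (\<lambda>i j. P i j - P i s * P j s / P s s)"
    have "Q i j = Q j i" for i j by (simp only: Q_def sym[of i j] mult.commute[of "P i s"])
    moreover have "(\<Sum>i\<in>UNIV. \<Sum>j\<in>UNIV. x i * x j * Q i j) \<ge> 0" for x
    proof -
      define y where "y = (\<Sum>j\<in>UNIV. x j * P j s)"
      have "(\<Sum>i\<in>UNIV. \<Sum>j\<in>UNIV. x i * x j * Q i j)
          = (\<Sum>i\<in>UNIV. \<Sum>j\<in>UNIV. x i * x j * P i j) - y * y / P s s"
        by (simp add: Q_def y_def right_diff_distrib sum_subtractf sum_product sum_divide_distrib mult_ac)
      also have "\<dots> = (\<Sum>i\<in>UNIV. \<Sum>j\<in>UNIV. (x i + (if i = s then - y / P s s else 0)) * (x j + (if j = s then - y / P s s else 0)) * P i j)"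
        using pos by (simp add: quadratic_form_update[OF sym] y_def[symmetric] power2_eq_square)
      also have "\<dots> \<ge> 0" by (rule psd)
      finally show ?thesis .
    qed
    moreover have "Q i j = 0" if "i \<notin> S" for i j
    proof (cases "i = s")
      case True then show ?thesis using pos sym[of s j] by (simp add: Q_def)
    next
      case False then show ?thesis using that supp by (simp add: Q_def)
    qed
    ultimately obtain V where V: "\<forall>i j. Q i j = (\<Sum>a\<in>S. V a i * V a j)"
      using insert.IH[of Q] by blast
    define V' where "V' = V(s := \<lambda>i. P i s / sqrt (P s s))"
    have e1: "(\<Sum>a\<in>S. V' a i * V' a j) = (\<Sum>a\<in>S. V a i * V a j)" for i j
      using insert.hyps by (intro sum.cong) (auto simp: V'_def)
    have e2: "V' s i * V' s j = P i s * P j s / P s s" for i j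
      using pos by (simp add: V'_def)
    have "P i j = (\<Sum>a\<in>insert s S. V' a i * V' a j)" for i j
      using V[rule_format, of i j] insert.hyps by (simp add: e1 e2 Q_def)
    then show ?thesis by blast
  qed
qed

lemma inner_matrix_vector_sum:
  fixes A :: "real^'n^'n"
  shows "x \<bullet> (A *v y) = (\<Sum>i\<in>UNIV. \<Sum>j\<in>UNIV. x $ i * y $ j * A $ i $ j)"
  by (simp add: inner_vec_def matrix_vector_mult_def sum_distrib_left mult_ac)

lemma positive_semidefinite_gram:
  fixes P :: "real^'n^'n"
  assumes "transpose P = P" "\<And>x. x \<bullet> (P *v x) \<ge> 0"
  shows "\<exists>V :: real^'n^'n. P = transpose V ** V"
proof -
  have "P $ i $ j = P $ j $ i" for i j
    by (metis assms(1) transpose_def vec_lambda_beta)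
  moreover have "(\<Sum>i\<in>UNIV. \<Sum>j\<in>UNIV. x i * x j * P $ i $ j) \<ge> 0" for x
    using assms(2)[of "\<chi> i. x i"] by (simp add: inner_matrix_vector_sum)
  ultimately obtain V :: "'n \<Rightarrow> 'n \<Rightarrow> real" where "\<forall>i j. P $ i $ j = (\<Sum>a\<in>UNIV. V a i * V a j)"
    using positive_semidefinite_gram_aux[of UNIV "\<lambda>i j. P $ i $ j"] by auto
  then have "P = transpose (\<chi> a i. V a i) ** (\<chi> a i. V a i)"
    by (simp add: vec_eq_iff matrix_mult_component transpose_def)
  then show ?thesis by blast
qed

text \<open>A Gram matrix \<open>V\<^sup>T V\<close> has determinant \<open>(det V)\<^sup>2\<close>.\<close>

lemma positive_definite_det_pos:
  fixes A :: "real^'n^'n"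
  assumes "transpose A = A" "\<And>x. x \<noteq> 0 \<Longrightarrow> x \<bullet> (A *v x) > 0"
  shows "det A > 0"
proof -
  have "x \<bullet> (A *v x) \<ge> 0" for x using assms(2)[of x] by (cases "x = 0") auto
  then obtain V :: "real^'n^'n" where V: "A = transpose V ** V" using positive_semidefinite_gram[OF assms(1)] by auto
  have "\<forall>x. A *v x = 0 \<longrightarrow> x = 0" using assms(2) by fastforce
  then have "det A \<noteq> 0"
    using matrix_left_invertible_ker[of A] invertible_left_inverse[of A] invertible_det_nz[of A] by blast
  moreover have "det A = det V * det V" by (simp only: V det_mul det_transpose)
  ultimately show ?thesis by (simp add: zero_less_mult_iff linorder_neq_iff disj_commute)
qed

lemma matrix_inv_positive_semidefinite:
  fixes A :: "real^'n^'n"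
  assumes "transpose A = A" "\<And>x. x \<noteq> 0 \<Longrightarrow> x \<bullet> (A *v x) > 0"
  shows "x \<bullet> (matrix_inv A *v x) \<ge> 0"
proof -
  have nz: "det A \<noteq> 0" using positive_definite_det_pos[OF assms] by simp
  define y where "y = matrix_inv A *v x"
  have "x = A *v y" by (simp add: y_def matrix_vector_mul_assoc matrix_inv_inverse[OF nz])
  then have "x \<bullet> (matrix_inv A *v x) = y \<bullet> (A *v y)" by (subst y_def[symmetric], subst \<open>x = A *v y\<close>) (rule inner_commute)
  also have "\<dots> \<ge> 0" using assms(2)[of y] by (cases "y = 0") auto
  finally show ?thesis .
qed

text \<open>If \<open>P = V\<^sup>T V\<close>, then the contraction is the sum of the squares of the entries of \<open>V B V\<^sup>T\<close>. For
  \<open>P = g\<^sup>-\<^sup>1\<close> it is the squared norm of the 2-tensor \<open>B\<close>.\<close>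

lemma gram_contraction_nonneg:
  fixes P B :: "real^'n^'n"
  assumes "transpose P = P" "\<And>x. x \<bullet> (P *v x) \<ge> 0"
  shows "(\<Sum>i\<in>UNIV. \<Sum>j\<in>UNIV. \<Sum>k\<in>UNIV. \<Sum>l\<in>UNIV. P $ i $ k * P $ j $ l * B $ i $ j * B $ k $ l) \<ge> 0"
proof -
  obtain V :: "real^'n^'n" where V: "P = transpose V ** V" using positive_semidefinite_gram[OF assms] by blast
  have P: "P $ i $ k = (\<Sum>a\<in>UNIV. V $ a $ i * V $ a $ k)" for i k
    by (simp add: V matrix_mult_component transpose_def)
  have "P $ i $ k * P $ j $ l * B $ i $ j * B $ k $ l = (\<Sum>a\<in>UNIV. \<Sum>b\<in>UNIV.
         (V $ a $ i * V $ b $ j * B $ i $ j) * (V $ a $ k * V $ b $ l * B $ k $ l))" for i j k l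
  proof -
    have "P $ i $ k * P $ j $ l = (\<Sum>a\<in>UNIV. \<Sum>b\<in>UNIV. (V $ a $ i * V $ a $ k) * (V $ b $ j * V $ b $ l))"
      by (simp only: P sum_product)
    then show ?thesis by (simp only: sum_distrib_right) (intro sum.cong refl, simp add: mult_ac)
  qed
  then have "(\<Sum>i\<in>UNIV. \<Sum>j\<in>UNIV. \<Sum>k\<in>UNIV. \<Sum>l\<in>UNIV. P $ i $ k * P $ j $ l * B $ i $ j * B $ k $ l)
     = (\<Sum>i\<in>UNIV. \<Sum>j\<in>UNIV. \<Sum>k\<in>UNIV. \<Sum>l\<in>UNIV. \<Sum>a\<in>UNIV. \<Sum>b\<in>UNIV.
         (V $ a $ i * V $ b $ j * B $ i $ j) * (V $ a $ k * V $ b $ l * B $ k $ l))"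
    by simp
  also have "\<dots> = (\<Sum>a\<in>UNIV. \<Sum>b\<in>UNIV. \<Sum>i\<in>UNIV. \<Sum>k\<in>UNIV. \<Sum>j\<in>UNIV. \<Sum>l\<in>UNIV.
         (V $ a $ i * V $ b $ j * B $ i $ j) * (V $ a $ k * V $ b $ l * B $ k $ l))"
    by (simp only: sum.cartesian_product)
       (rule sum.reindex_bij_witness[where j = "\<lambda>(i,j,k,l,a,b). (a,b,i,k,j,l)" and i = "\<lambda>(a,b,i,k,j,l). (i,j,k,l,a,b)"]; auto)
  also have "\<dots> = (\<Sum>a\<in>UNIV. \<Sum>b\<in>UNIV. (\<Sum>i\<in>UNIV. \<Sum>j\<in>UNIV. V $ a $ i * V $ b $ j * B $ i $ j)\<^sup>2)"
    by (simp only: power2_eq_square sum_product)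
  also have "\<dots> \<ge> 0" by (intro sum_nonneg) auto
  finally show ?thesis .
qed

section \<open>Change of variables for the nonnegative integral\<close>

text \<open>A well-ordered copy of a finite index type. The change of variables theorem is applied in coordinates
  that are indexed by this copy.\<close>

typedef (overloaded) 'n ordered_copy = "{..<CARD('n::finite)}"
  by (rule exI[of _ 0]) simp

instance ordered_copy :: (finite) finite
proof
  have "range (Rep_ordered_copy :: 'a ordered_copy \<Rightarrow> nat) \<subseteq> {..<CARD('a)}"
    using Rep_ordered_copy by auto
  then show "finite (UNIV :: 'a ordered_copy set)"
    by (meson Rep_ordered_copy_inject finite_imageD finite_lessThan finite_subset injI)
qed

instantiation ordered_copy :: (finite) wellorder
begin

definition "x \<le> y \<longleftrightarrow> Rep_ordered_copy x \<le> Rep_ordered_copy y"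
definition "x < y \<longleftrightarrow> Rep_ordered_copy x < Rep_ordered_copy y"

instance
proof
  fix P :: "'a ordered_copy \<Rightarrow> bool" and x
  assume step: "\<And>x. (\<And>y. y < x \<Longrightarrow> P y) \<Longrightarrow> P x"
  show "P x"
  proof (induction x rule: measure_induct_rule[of Rep_ordered_copy])
    case (less x)
    show ?case by (rule step) (rule less, simp add: less_ordered_copy_def)
  qed
qed (auto simp: less_eq_ordered_copy_def less_ordered_copy_def Rep_ordered_copy_inject)

end

definition index_copy :: "'n::finite ordered_copy \<Rightarrow> 'n" where
  "index_copy = (SOME h. bij h)"

lemma bij_index_copy: "bij (index_copy :: 'n::finite ordered_copy \<Rightarrow> 'n)"
proof -
  have "CARD('n ordered_copy) = CARD('n)"
    using card_image[of "Rep_ordered_copy :: 'n ordered_copy \<Rightarrow> nat" UNIV]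
    by (simp add: inj_on_def Rep_ordered_copy_inject type_definition.Rep_range[OF type_definition_ordered_copy])
  then have "\<exists>h :: 'n ordered_copy \<Rightarrow> 'n. bij h"
    using finite_same_card_bij[of "UNIV :: 'n ordered_copy set" "UNIV :: 'n set"] by auto
  then show "bij (index_copy :: 'n ordered_copy \<Rightarrow> 'n)"
    unfolding index_copy_def by (rule someI_ex)
qed

definition reindex :: "real^'n \<Rightarrow> real^('n::finite ordered_copy)" where
  "reindex x = (\<chi> i. x $ index_copy i)"

definition unreindex :: "real^('n::finite ordered_copy) \<Rightarrow> real^'n" where
  "unreindex x = (\<chi> i. x $ inv index_copy i)"

lemma reindex_unreindex [simp]: "reindex (unreindex x) = x" "unreindex (reindex y) = y"
  by (auto simp: reindex_def unreindex_def vec_eq_iff inv_f_f[OF bij_is_inj[OF bij_index_copy]]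
        surj_f_inv_f[OF bij_is_surj[OF bij_index_copy]])

lemma linear_reindex: "linear reindex" "linear unreindex"
  by (auto simp: linear_iff reindex_def unreindex_def vec_eq_iff)

text \<open>Conjugation by the bijection of the index types preserves the sign of a permutation, so that the
  Leibniz expansions agree term by term.\<close>

lemma det_reindex:
  fixes A :: "real^'n^'n"
  shows "det (\<chi> i j. A $ index_copy i $ index_copy j) = det A"
proof -
  let ?h = "index_copy :: 'n ordered_copy \<Rightarrow> 'n"
  have h: "bij ?h" by (rule bij_index_copy)
  then have hb: "bij_betw ?h UNIV UNIV" "inj ?h" "inj (inv ?h)" "bij_betw (inv ?h) UNIV UNIV"
    by (auto simp: bij_is_inj bij_imp_bij_inv)
  have mp: "map_permutation UNIV ?h p = ?h \<circ> p \<circ> inv ?h"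
       "map_permutation UNIV (inv ?h) q = inv ?h \<circ> q \<circ> ?h" for p q
    using h by (auto simp: map_permutation_def restrict_id_def fun_eq_iff bij_is_surj bij_imp_bij_inv inv_inv_eq)
  have "(\<Sum>p | p permutes UNIV. of_int (sign p) * (\<Prod>i\<in>UNIV. A $ ?h i $ ?h (p i)))
      = (\<Sum>q | q permutes UNIV. of_int (sign q) * (\<Prod>i\<in>UNIV. A $ i $ q i))"
  proof (rule sum.reindex_bij_witness[where j = "map_permutation UNIV ?h" and i = "map_permutation UNIV (inv ?h)"])
    fix p assume "p \<in> {p. p permutes (UNIV :: 'n ordered_copy set)}"
    then have p: "p permutes UNIV" by simp
    show "map_permutation UNIV (inv ?h) (map_permutation UNIV ?h p) = p"
      using h by (simp add: mp fun_eq_iff bij_is_inj)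
    show "map_permutation UNIV ?h p \<in> {p. p permutes UNIV}"
      using map_permutation_permutes[OF hb(1) p] by simp
    have "(\<Prod>i\<in>UNIV. A $ i $ map_permutation UNIV ?h p i) = (\<Prod>i\<in>UNIV. A $ ?h i $ map_permutation UNIV ?h p (?h i))"
      by (rule prod.reindex_bij_betw[OF hb(1), symmetric])
    also have "\<dots> = (\<Prod>i\<in>UNIV. A $ ?h i $ ?h (p i))" using h by (simp add: mp bij_is_inj)
    finally show "of_int (sign (map_permutation UNIV ?h p)) * (\<Prod>i\<in>UNIV. A $ i $ map_permutation UNIV ?h p i)
        = of_int (sign p) * (\<Prod>i\<in>UNIV. A $ ?h i $ ?h (p i))"
      using sign_map_permutation[OF hb(2) p] by simp
  next
    fix q assume "q \<in> {p. p permutes (UNIV :: 'n set)}"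
    then have q: "q permutes UNIV" by simp
    show "map_permutation UNIV ?h (map_permutation UNIV (inv ?h) q) = q"
      using h by (simp add: mp fun_eq_iff bij_is_surj surj_f_inv_f)
    show "map_permutation UNIV (inv ?h) q \<in> {p. p permutes UNIV}"
      using map_permutation_permutes[OF hb(4) q] by simp
  qed
  then show ?thesis by (simp add: det_def)
qed

lemma det_matrix_reindex:
  fixes L :: "real^'n \<Rightarrow> real^'n"
  shows "det (matrix (\<lambda>x. reindex (L (unreindex x)))) = det (matrix L)"
proof -
  have ax: "unreindex (axis j 1) = axis (index_copy j) 1" for j :: "'n ordered_copy"
  proof -
    have "inv index_copy i = j \<longleftrightarrow> i = index_copy j" for i
      using bij_index_copy by (metis bij_inv_eq_iff)
    then show ?thesis by (auto simp: unreindex_def axis_def vec_eq_iff)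
  qed
  then have "matrix (\<lambda>x. reindex (L (unreindex x))) = (\<chi> i j. matrix L $ index_copy i $ index_copy j)"
    by (simp add: matrix_def reindex_def ax)
  then show ?thesis by (simp add: det_reindex)
qed

lemma distr_unreindex_lborel: "distr lborel borel unreindex = lborel"
proof (rule lborel_eqI[symmetric])
  fix l u :: "real^'n"
  assume le: "\<And>b. b \<in> Basis \<Longrightarrow> l \<bullet> b \<le> u \<bullet> b"
  have "l $ i \<le> u $ i" for i using le[of "axis i 1"] by (simp add: inner_axis axis_in_Basis_iff)
  then have le': "\<And>b. b \<in> Basis \<Longrightarrow> reindex l \<bullet> b \<le> reindex u \<bullet> b"
    by (auto simp: Basis_vec_def inner_axis reindex_def)
  have [measurable]: "(unreindex :: _ \<Rightarrow> real^'n) \<in> borel_measurable borel"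
    using linear_reindex(2) by (intro borel_measurable_continuous_onI linear_continuous_on linear_conv_bounded_linear[THEN iffD1])
  have h: "bij (index_copy :: 'n ordered_copy \<Rightarrow> 'n)" by (rule bij_index_copy)
  have "unreindex -` box l u = box (reindex l) (reindex u)"
  proof (intro set_eqI)
    fix x
    have "(\<forall>i. l $ i < x $ inv index_copy i \<and> x $ inv index_copy i < u $ i)
      \<longleftrightarrow> (\<forall>j. l $ index_copy j < x $ j \<and> x $ j < u $ index_copy j)"
      using h by (metis bij_inv_eq_iff)
    then show "x \<in> unreindex -` box l u \<longleftrightarrow> x \<in> box (reindex l) (reindex u)"
      by (simp add: mem_box_cart reindex_def unreindex_def)
  qed
  then have "emeasure (distr lborel borel unreindex) (box l u) = emeasure lborel (box (reindex l) (reindex u))"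
    by (simp add: emeasure_distr)
  also have "\<dots> = (\<Prod>b\<in>Basis. (reindex u - reindex l) \<bullet> b)"
    using le' by (simp add: emeasure_lborel_box)
  also have "(\<Prod>b\<in>Basis. (reindex u - reindex l) \<bullet> b) = (\<Prod>j\<in>UNIV. (u - l) $ index_copy j)"
    by (simp add: Basis_vec_def UNION_singleton_eq_range prod.reindex inj_on_def axis_eq_axis inner_axis reindex_def)
  also have "\<dots> = (\<Prod>i\<in>UNIV. (u - l) $ i)"
    using prod.reindex_bij_betw[of index_copy UNIV UNIV "\<lambda>i. (u - l) $ i"] h by simp
  also have "\<dots> = (\<Prod>b\<in>Basis. (u - l) \<bullet> b)"
    by (simp add: Basis_vec_def UNION_singleton_eq_range prod.reindex inj_on_def axis_eq_axis inner_axis)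
  finally show "emeasure (distr lborel borel unreindex) (box l u) = (\<Prod>b\<in>Basis. (u - l) \<bullet> b)" .
qed simp

text \<open>The bridge between the nonnegative integral, in which the volume is defined, and absolute
  integrability, in which the change of variables is carried out.\<close>

lemma nn_integral_eq_ennreal_integral:
  fixes f :: "'a::euclidean_space \<Rightarrow> real"
  assumes "S \<in> sets borel" "f \<in> borel_measurable borel" "\<And>x. x \<in> S \<Longrightarrow> 0 \<le> f x"
  shows "(\<integral>\<^sup>+x\<in>S. ennreal (f x) \<partial>lborel)
    = (if f absolutely_integrable_on S then ennreal (integral S f) else \<infinity>)"
proof -
  have m: "(\<lambda>x. indicator S x *\<^sub>R f x) \<in> borel_measurable lborel" using assms by measurable
  have eq: "(\<integral>\<^sup>+x\<in>S. ennreal (f x) \<partial>lborel) = (\<integral>\<^sup>+x. ennreal (indicator S x *\<^sub>R f x) \<partial>lborel)"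
    by (intro nn_integral_cong) (auto simp: indicator_def)
  have nn: "0 \<le> indicator S x *\<^sub>R f x" for x using assms(3) by (auto simp: indicator_def)
  have iff: "f absolutely_integrable_on S \<longleftrightarrow> integrable lborel (\<lambda>x. indicator S x *\<^sub>R f x)"
    using integrable_completion[OF m] by (simp add: set_integrable_def)
  show ?thesis
  proof (cases "f absolutely_integrable_on S")
    case True
    then have "integrable lborel (\<lambda>x. indicator S x *\<^sub>R f x)" using iff by blast
    then have "(\<integral>\<^sup>+x\<in>S. ennreal (f x) \<partial>lborel) = ennreal (LINT x|lborel. indicator S x *\<^sub>R f x)"
      using nn unfolding eq by (intro nn_integral_eq_integral) auto
    also have "(LINT x|lborel. indicator S x *\<^sub>R f x) = (LINT x|lebesgue. indicator S x *\<^sub>R f x)"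
      using integral_completion[OF m] by simp
    also have "\<dots> = integral S f"
      using set_lebesgue_integral_eq_integral(2)[OF True] by (simp add: set_lebesgue_integral_def)
    finally show ?thesis using True by simp
  next
    case False
    then have "\<not> integrable lborel (\<lambda>x. indicator S x *\<^sub>R f x)" using iff by blast
    then have "(\<integral>\<^sup>+x. ennreal (norm (indicator S x *\<^sub>R f x)) \<partial>lborel) = \<infinity>"
      using m by (simp add: integrable_iff_bounded not_less top.extremum_unique)
    then show ?thesis using False nn unfolding eq by simp
  qed
qed

text \<open>The integrals are compared including the value \<open>\<infinity>\<close>, because absolute integrability of one side is
  equivalent to that of the other.\<close>

lemma nn_integral_change_of_variables_wellorder:
  fixes g :: "real^'m::{finite,wellorder} \<Rightarrow> real^'m::_" and f :: "real^'m::_ \<Rightarrow> real"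
  assumes S: "S \<in> sets borel" "g ` S \<in> sets borel"
    and der: "\<And>x. x \<in> S \<Longrightarrow> (g has_derivative g' x) (at x)"
    and inj: "inj_on g S"
    and f: "f \<in> borel_measurable borel" "\<And>x. 0 \<le> f x"
    and gf: "h \<in> borel_measurable borel" "\<And>x. x \<in> S \<Longrightarrow> h x = \<bar>det (matrix (g' x))\<bar> * f (g x)"
  shows "(\<integral>\<^sup>+y\<in>g ` S. ennreal (f y) \<partial>lborel) = (\<integral>\<^sup>+x\<in>S. ennreal (h x) \<partial>lborel)"
proof -
  \<comment> \<open>The scalar function as a vector with one coordinate, to which the change of variables is applied.\<close>
  define f1 where "f1 = (\<lambda>x. vec (f x) :: real^1)"
  have *: "(\<lambda>x. \<bar>det (matrix (g' x))\<bar> *\<^sub>R f1 (g x)) absolutely_integrable_on S \<and>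
           integral S (\<lambda>x. \<bar>det (matrix (g' x))\<bar> *\<^sub>R f1 (g x)) = b
     \<longleftrightarrow> f1 absolutely_integrable_on (g ` S) \<and> integral (g ` S) f1 = b" for b
    using S der inj by (intro has_absolute_integral_change_of_variables)
      (auto intro: has_derivative_at_withinI)
  have s: "\<bar>det (matrix (g' x))\<bar> *\<^sub>R f1 (g x) = vec (\<bar>det (matrix (g' x))\<bar> * f (g x))" for x
    by (simp add: f1_def vec_eq_iff)
  have "(\<lambda>x. \<bar>det (matrix (g' x))\<bar> * f (g x)) absolutely_integrable_on S \<and>
           integral S (\<lambda>x. \<bar>det (matrix (g' x))\<bar> * f (g x)) = b
     \<longleftrightarrow> f absolutely_integrable_on (g ` S) \<and> integral (g ` S) f = b" for b
    using *[of "vec b"] unfolding s unfolding f1_def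
    by (simp add: absolutely_integrable_on_1_iff integral_on_1_eq vec_eq_iff)
  moreover have "h absolutely_integrable_on S \<longleftrightarrow> (\<lambda>x. \<bar>det (matrix (g' x))\<bar> * f (g x)) absolutely_integrable_on S"
     "integral S h = integral S (\<lambda>x. \<bar>det (matrix (g' x))\<bar> * f (g x))"
    by (rule set_integrable_cong; simp add: gf(2)) (rule integral_cong, simp add: gf(2))
  ultimately have iff: "h absolutely_integrable_on S \<and> integral S h = b
     \<longleftrightarrow> f absolutely_integrable_on (g ` S) \<and> integral (g ` S) f = b" for b
    by simp
  have "h absolutely_integrable_on S \<longleftrightarrow> f absolutely_integrable_on (g ` S)"
     "h absolutely_integrable_on S \<Longrightarrow> integral (g ` S) f = integral S h"
    using iff[of "integral S h"] iff[of "integral (g ` S) f"] by blast+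
  moreover have "0 \<le> h x" if "x \<in> S" for x using that gf(2) f(2) by simp
  ultimately show ?thesis using S f gf(1)
    by (subst (1 2) nn_integral_eq_ennreal_integral) auto
qed

text \<open>Passing to the well-ordered copy of the index type is a permutation of coordinates: it preserves the
  Lebesgue measure and Jacobian determinants.\<close>

theorem nn_integral_change_of_variables:
  fixes g :: "real^'n \<Rightarrow> real^'n" and f h :: "real^'n \<Rightarrow> real"
  assumes S: "S \<in> sets borel" "g ` S \<in> sets borel"
    and der: "\<And>x. x \<in> S \<Longrightarrow> (g has_derivative g' x) (at x)"
    and inj: "inj_on g S"
    and f: "f \<in> borel_measurable borel" "\<And>x. 0 \<le> f x"
    and h: "h \<in> borel_measurable borel" "\<And>x. x \<in> S \<Longrightarrow> h x = \<bar>det (matrix (g' x))\<bar> * f (g x)"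
  shows "(\<integral>\<^sup>+y\<in>g ` S. ennreal (f y) \<partial>lborel) = (\<integral>\<^sup>+x\<in>S. ennreal (h x) \<partial>lborel)"
proof -
  have bl: "bounded_linear (unreindex :: _ \<Rightarrow> real^'n)" "bounded_linear (reindex :: real^'n \<Rightarrow> _)"
    using linear_reindex linear_conv_bounded_linear by blast+
  have m [measurable]: "(unreindex :: _ \<Rightarrow> real^'n) \<in> borel_measurable borel"
    using bl(1) by (intro borel_measurable_continuous_onI linear_continuous_on)
  have transfer: "(\<integral>\<^sup>+y\<in>X. ennreal (k y) \<partial>lborel) = (\<integral>\<^sup>+y\<in>unreindex -` X. ennreal (k (unreindex y)) \<partial>lborel)"
    if [measurable]: "X \<in> sets borel" "k \<in> borel_measurable borel" for X :: "(real^'n) set" and k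
    by (subst distr_unreindex_lborel[symmetric], subst nn_integral_distr)
       (auto intro!: nn_integral_cong simp: indicator_def)
  define S' where "S' = unreindex -` S"
  define G where "G = (\<lambda>x. reindex (g (unreindex x)))"
  have img: "G ` S' = unreindex -` (g ` S)"
  proof (intro set_eqI iffI)
    fix x assume "x \<in> unreindex -` (g ` S)"
    then obtain y where "y \<in> S" "unreindex x = g y" by auto
    then show "x \<in> G ` S'"
      by (intro image_eqI[of _ _ "reindex y"]) (simp_all add: G_def S'_def flip: \<open>unreindex x = g y\<close>)
  qed (auto simp: G_def S'_def)
  have "S' \<in> sets borel" "G ` S' \<in> sets borel"
    using S measurable_sets[OF m, of S] measurable_sets[OF m, of "g ` S"] unfolding img by (auto simp: S'_def)
  have e: "(\<integral>\<^sup>+y\<in>G ` S'. ennreal (f (unreindex y)) \<partial>lborel) = (\<integral>\<^sup>+x\<in>S'. ennreal (h (unreindex x)) \<partial>lborel)"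
  proof (rule nn_integral_change_of_variables_wellorder)
    show "(G has_derivative (\<lambda>v. reindex (g' (unreindex x) (unreindex v)))) (at x)" if "x \<in> S'" for x
    proof -
      have "(g has_derivative g' (unreindex x)) (at (unreindex x))" using that der by (simp add: S'_def)
      from has_derivative_compose[OF bounded_linear_imp_has_derivative[OF bl(1)] this]
      show ?thesis unfolding G_def
        by (rule bounded_linear.has_derivative[OF bl(2)])
    qed
    show "inj_on G S'"
      using inj unfolding inj_on_def G_def S'_def by (metis reindex_unreindex vimage_eq)
    show "(\<lambda>x. f (unreindex x)) \<in> borel_measurable borel" "(\<lambda>x. h (unreindex x)) \<in> borel_measurable borel"
      using f(1) h(1) by measurable
    show "S' \<in> sets borel" "G ` S' \<in> sets borel" by fact+
    show "0 \<le> f (unreindex x)" for x by (rule f(2))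
    show "h (unreindex x) = \<bar>det (matrix (\<lambda>v. reindex (g' (unreindex x) (unreindex v))))\<bar> * f (unreindex (G x))"
      if "x \<in> S'" for x
      using h(2)[of "unreindex x"] that by (simp add: det_matrix_reindex G_def S'_def)
  qed
  show ?thesis
    by (rule trans[OF transfer[OF S(2) f(1)] trans[OF e[unfolded img, unfolded S'_def] transfer[OF S(1) h(1), symmetric]]])
qed

section \<open>Calculus in a chart\<close>

text \<open>Smoothness of a scalar function on a part \<open>S\<close> of the domain of a chart. The part is kept variable so that
  the calculus applies on the overlap of two charts.\<close>

definition smooth_in :: "('m, 'n::finite) chart \<Rightarrow> 'm set \<Rightarrow> ('m \<Rightarrow> real) \<Rightarrow> bool" where
  "smooth_in c S F \<longleftrightarrow> smooth_on (snd c ` S) (F \<circ> chart_inv c)"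

definition grad_inner ::
  "('m, 'n::finite) metric \<Rightarrow> ('m, 'n) chart \<Rightarrow> ('m \<Rightarrow> real) \<Rightarrow> ('m \<Rightarrow> real) \<Rightarrow> 'm \<Rightarrow> real" where
  "grad_inner g c F E p = (\<Sum>k\<in>UNIV. gradient g c F p $ k * partial c k E p)"

text \<open>The component \<open>\<nabla>\<^sub>k X\<^sup>i\<close> of the covariant derivative of the gradient \<open>X = \<nabla>F\<close>.\<close>

definition grad_cov ::
  "('m, 'n::finite) metric \<Rightarrow> ('m, 'n) chart \<Rightarrow> ('m \<Rightarrow> real) \<Rightarrow> 'n \<Rightarrow> 'n \<Rightarrow> 'm \<Rightarrow> real" where
  "grad_cov g c F k i p = partial c k (\<lambda>q. gradient g c F q $ i) p
     + (\<Sum>m\<in>UNIV. christoffel g c i k m p * gradient g c F p $ m)"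

text \<open>The Laplacian as computed in the chart \<open>c\<close>.\<close>

definition hessian_trace ::
  "('m, 'n::finite) metric \<Rightarrow> ('m, 'n) chart \<Rightarrow> ('m \<Rightarrow> real) \<Rightarrow> 'm \<Rightarrow> real" where
  "hessian_trace g c F p = (\<Sum>i\<in>UNIV. \<Sum>j\<in>UNIV. ginv g c p $ i $ j * hessian g c F p $ i $ j)"

lemma gradient_component:
  "gradient g c F p $ i = (\<Sum>j\<in>UNIV. ginv g c p $ i $ j * partial c j F p)"
  by (simp add: gradient_def matrix_vector_mult_def)

context closed_riemannian_manifold
begin

text \<open>An open part of the domain of a chart, such as its overlap with another chart.\<close>

definition chart_on :: "('m, 'n) chart \<Rightarrow> 'm set \<Rightarrow> bool" where
  "chart_on c S \<longleftrightarrow> c \<in> A \<and> S \<subseteq> fst c \<and> open (snd c ` S)"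

lemma chart_on_chart: "c \<in> A \<Longrightarrow> chart_on c (fst c)"
  by (simp add: chart_on_def chart_range)

lemma chart_inv_left: "c \<in> A \<Longrightarrow> p \<in> fst c \<Longrightarrow> chart_inv c (snd c p) = p"
  using chart_homeo[of c] by (auto simp: homeomorphism_def)

lemma inj_on_chart: "c \<in> A \<Longrightarrow> inj_on (snd c) (fst c)"
  by (rule inj_on_inverseI[of _ "chart_inv c"]) (simp add: chart_inv_left)

lemma chart_on_inv: "chart_on c S \<Longrightarrow> p \<in> S \<Longrightarrow> chart_inv c (snd c p) = p"
  by (auto simp: chart_on_def chart_inv_left)

lemma chart_on_open: "chart_on c S \<Longrightarrow> open (snd c ` S)"
  by (simp add: chart_on_def)

lemma chart_on_openin:
  assumes "c \<in> A" "openin (top_of_set M) S" "S \<subseteq> fst c"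
  shows "chart_on c S"
proof -
  have "openin (top_of_set (fst c)) S"
    using assms openin_subset_trans[of M S "fst c"] covers by (auto simp: Union_upper)
  then have "openin (top_of_set (snd c ` fst c)) (snd c ` S)"
    using homeomorphism_imp_open_map[OF chart_homeo[OF assms(1)]] by blast
  then have "open (snd c ` S)" using chart_range[OF assms(1)] openin_open_eq by blast
  then show ?thesis using assms by (simp add: chart_on_def)
qed

lemma chart_on_Int:
  assumes "c \<in> A" "d \<in> A"
  shows "chart_on c (fst c \<inter> fst d)"
  using assms by (intro chart_on_openin openin_Int chart_domain) auto

subsection \<open>Partial derivatives in a chart\<close>

lemma smooth_in_has_derivative:
  assumes "p \<in> S" "smooth_in c S F"
  shows "(F \<circ> chart_inv c has_derivative frechet_derivative (F \<circ> chart_inv c) (at (snd c p))) (at (snd c p))"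
  using assms by (intro smooth_on_has_derivative) (auto simp: smooth_in_def)

lemma partial_cong:
  assumes "chart_on c S" "p \<in> S" "smooth_in c S F" "\<And>q. q \<in> S \<Longrightarrow> F q = E q"
  shows "partial c i E p = partial c i F p"
proof -
  have "(E \<circ> chart_inv c has_derivative frechet_derivative (F \<circ> chart_inv c) (at (snd c p))) (at (snd c p))"
    by (rule has_derivative_transform_within_open[OF smooth_in_has_derivative[OF assms(2,3)] chart_on_open[OF assms(1)]])
       (use assms in \<open>auto simp: chart_on_inv\<close>)
  then show ?thesis by (simp add: partial_def frechet_derivative_eqI)
qed

lemma smooth_in_cong:
  assumes "chart_on c S" "smooth_in c S F" "\<And>q. q \<in> S \<Longrightarrow> F q = E q"
  shows "smooth_in c S E"
  using assms(2) unfolding smooth_in_def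
  by (rule smooth_on_cong[OF chart_on_open[OF assms(1)], THEN iffD1, rotated])
     (auto simp: chart_on_inv[OF assms(1)] assms(3))

lemma smooth_in_subset: "smooth_in c S F \<Longrightarrow> T \<subseteq> S \<Longrightarrow> smooth_in c T F"
  unfolding smooth_in_def by (rule smooth_on_subset) auto

lemma smooth_in_const [simp]: "smooth_in c S (\<lambda>_. a)"
  by (simp add: smooth_in_def o_def)

lemma smooth_in_add:
  "chart_on c S \<Longrightarrow> smooth_in c S F \<Longrightarrow> smooth_in c S E \<Longrightarrow> smooth_in c S (\<lambda>p. F p + E p)"
  unfolding smooth_in_def o_def by (intro smooth_on_add chart_on_open)

lemma smooth_in_mult:
  "chart_on c S \<Longrightarrow> smooth_in c S F \<Longrightarrow> smooth_in c S E \<Longrightarrow> smooth_in c S (\<lambda>p. F p * E p)"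
  unfolding smooth_in_def o_def by (intro smooth_on_mult chart_on_open)

lemma smooth_in_minus: "chart_on c S \<Longrightarrow> smooth_in c S F \<Longrightarrow> smooth_in c S (\<lambda>p. - F p)"
  unfolding smooth_in_def o_def by (intro smooth_on_minus chart_on_open)

lemma smooth_in_diff:
  "chart_on c S \<Longrightarrow> smooth_in c S F \<Longrightarrow> smooth_in c S E \<Longrightarrow> smooth_in c S (\<lambda>p. F p - E p)"
  unfolding smooth_in_def o_def by (intro smooth_on_diff chart_on_open)

lemma smooth_in_sum:
  "chart_on c S \<Longrightarrow> (\<And>i. i \<in> I \<Longrightarrow> smooth_in c S (F i)) \<Longrightarrow> smooth_in c S (\<lambda>p. \<Sum>i\<in>I. F i p)"
  unfolding smooth_in_def o_def by (intro smooth_on_sum chart_on_open)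

lemma smooth_in_divide:
  assumes "chart_on c S" "smooth_in c S F" "smooth_in c S E" "\<And>p. p \<in> S \<Longrightarrow> E p \<noteq> 0"
  shows "smooth_in c S (\<lambda>p. F p / E p)"
  using assms unfolding smooth_in_def o_def
  by (intro smooth_on_divide chart_on_open) (auto simp: chart_on_inv)

lemma smooth_in_compose:
  fixes h :: "real \<Rightarrow> real"
  assumes "chart_on c S" "smooth_in c S F" "open T" "smooth_on T h" "\<And>p. p \<in> S \<Longrightarrow> F p \<in> T"
  shows "smooth_in c S (\<lambda>p. h (F p))"
  using assms(2) unfolding smooth_in_def o_def
  by (rule smooth_on_compose[OF chart_on_open[OF assms(1)] assms(3) _ _ assms(4), rotated])
     (auto simp: chart_on_inv[OF assms(1)] assms(5))

lemma smooth_in_partial: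
  assumes "chart_on c S" "smooth_in c S F"
  shows "smooth_in c S (partial c i F)"
proof -
  have "smooth_on (snd c ` S) (\<lambda>x. frechet_derivative (F \<circ> chart_inv c) (at x) (axis i 1))"
    using assms(2) unfolding smooth_in_def by (rule smooth_on_frechet_derivative)
  then show ?thesis unfolding smooth_in_def
    by (rule smooth_on_cong[OF chart_on_open[OF assms(1)], THEN iffD1, rotated])
       (auto simp: chart_on_inv[OF assms(1)] partial_def)
qed

lemma partial_const [simp]: "partial c i (\<lambda>_. a) p = 0"
  by (simp add: partial_def o_def)

lemma partial_add:
  assumes "p \<in> S" "smooth_in c S F" "smooth_in c S E"
  shows "partial c i (\<lambda>q. F q + E q) p = partial c i F p + partial c i E p"
  using has_derivative_add[OF smooth_in_has_derivative[OF assms(1,2)] smooth_in_has_derivative[OF assms(1,3)]]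
  unfolding partial_def o_def by (rule frechet_derivative_eqI)

lemma partial_sum:
  assumes "p \<in> S" "\<And>k. k \<in> I \<Longrightarrow> smooth_in c S (F k)"
  shows "partial c i (\<lambda>q. \<Sum>k\<in>I. F k q) p = (\<Sum>k\<in>I. partial c i (F k) p)"
  using has_derivative_sum[OF smooth_in_has_derivative[OF assms(1,2)], of I "\<lambda>k. k" ]
  unfolding partial_def o_def by (rule frechet_derivative_eqI)

lemma partial_mult:
  assumes "chart_on c S" "p \<in> S" "smooth_in c S F" "smooth_in c S E"
  shows "partial c i (\<lambda>q. F q * E q) p = F p * partial c i E p + partial c i F p * E p"
  using has_derivative_mult[OF smooth_in_has_derivative[OF assms(2,3)] smooth_in_has_derivative[OF assms(2,4)]]
  unfolding partial_def o_def
  by (subst frechet_derivative_eqI, assumption) (simp add: chart_on_inv[OF assms(1,2)])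

lemma partial_cmult:
  assumes "chart_on c S" "p \<in> S" "smooth_in c S F"
  shows "partial c i (\<lambda>q. a * F q) p = a * partial c i F p"
  using partial_mult[OF assms(1,2) smooth_in_const assms(3), of i a] by simp

lemma partial_compose:
  fixes h :: "real \<Rightarrow> real"
  assumes "chart_on c S" "p \<in> S" "smooth_in c S F" "(h has_real_derivative h') (at (F p))"
  shows "partial c i (\<lambda>q. h (F q)) p = h' * partial c i F p"
proof -
  have "(h has_derivative (*) h') (at ((F \<circ> chart_inv c) (snd c p)))"
    using assms(4) by (simp add: has_field_derivative_def chart_on_inv[OF assms(1,2)])
  from has_derivative_compose[OF smooth_in_has_derivative[OF assms(2,3)] this]
  show ?thesis unfolding partial_def o_def by (rule frechet_derivative_eqI)
qed

lemma partial_commute: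
  assumes "chart_on c S" "p \<in> S" "smooth_in c S F"
  shows "partial c i (partial c j F) p = partial c j (partial c i F) p"
proof -
  define \<phi> where "\<phi> = F \<circ> chart_inv c"
  have \<phi>: "smooth_on (snd c ` S) \<phi>" using assms(3) by (simp add: smooth_in_def \<phi>_def)
  have "partial c i (partial c j F) p = frechet_derivative (\<lambda>y. frechet_derivative \<phi> (at y) (axis j 1)) (at (snd c p)) (axis i 1)" for i j
  proof -
    have "(partial c j F \<circ> chart_inv c has_derivative
        frechet_derivative (\<lambda>y. frechet_derivative \<phi> (at y) (axis j 1)) (at (snd c p))) (at (snd c p))"
      by (rule has_derivative_transform_within_open[OF smooth_on_has_derivative[OF smooth_on_frechet_derivative[OF \<phi>]]
            chart_on_open[OF assms(1)]])
         (use assms in \<open>auto simp: chart_on_inv partial_def \<phi>_def\<close>)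
    then show ?thesis by (simp add: partial_def[of c i] frechet_derivative_eqI)
  qed
  then show ?thesis
    using frechet_derivative_commute[OF chart_on_open[OF assms(1)] \<phi>, of "snd c p"] assms(2) by auto
qed

subsection \<open>The metric in a chart\<close>

lemma metric_det_pos: "c \<in> A \<Longrightarrow> p \<in> fst c \<Longrightarrow> det (g c p) > 0"
  by (intro positive_definite_det_pos metric_sym metric_pos)

lemma ginv_inverse:
  assumes "c \<in> A" "p \<in> fst c"
  shows "g c p ** ginv g c p = mat 1" "ginv g c p ** g c p = mat 1"
  using matrix_inv_inverse[of "g c p"] metric_det_pos[OF assms] by (auto simp: ginv_def)

lemma metric_sym': "c \<in> A \<Longrightarrow> p \<in> fst c \<Longrightarrow> g c p $ i $ j = g c p $ j $ i"
  using arg_cong[OF metric_sym, of c p "\<lambda>B. B $ j $ i"] by (simp add: transpose_def)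

lemma ginv_transpose: "c \<in> A \<Longrightarrow> p \<in> fst c \<Longrightarrow> transpose (ginv g c p) = ginv g c p"
  unfolding ginv_def using metric_det_pos[of c p] by (intro matrix_inv_sym metric_sym) auto

lemma ginv_sym: "c \<in> A \<Longrightarrow> p \<in> fst c \<Longrightarrow> ginv g c p $ i $ j = ginv g c p $ j $ i"
  using arg_cong[OF ginv_transpose, of c p "\<lambda>B. B $ j $ i"] by (simp add: transpose_def)

lemma metric_ginv_contract:
  assumes "c \<in> A" "p \<in> fst c"
  shows "(\<Sum>l\<in>UNIV. g c p $ k $ l * (\<Sum>m\<in>UNIV. ginv g c p $ l $ m * t m)) = t k"
    and "(\<Sum>l\<in>UNIV. ginv g c p $ k $ l * (\<Sum>m\<in>UNIV. g c p $ l $ m * t m)) = t k"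
proof -
  have "(\<Sum>l\<in>UNIV. P $ k $ l * (\<Sum>m\<in>UNIV. Q $ l $ m * t m)) = t k" if "P ** Q = mat 1" for P Q :: "real^'n^'n"
  proof -
    have "P *v (Q *v (\<chi> m. t m)) = (\<chi> m. t m)" by (simp add: matrix_vector_mul_assoc that)
    then have "(P *v (Q *v (\<chi> m. t m))) $ k = t k" by simp
    then show ?thesis by (simp add: matrix_vector_mult_def)
  qed
  then show "(\<Sum>l\<in>UNIV. g c p $ k $ l * (\<Sum>m\<in>UNIV. ginv g c p $ l $ m * t m)) = t k"
    "(\<Sum>l\<in>UNIV. ginv g c p $ k $ l * (\<Sum>m\<in>UNIV. g c p $ l $ m * t m)) = t k"
    using ginv_inverse[OF assms] by blast+
qed

lemma smooth_in_metric:
  assumes "chart_on c S" shows "smooth_in c S (\<lambda>p. g c p $ i $ j)"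
proof -
  have "c \<in> A" "S \<subseteq> fst c" using assms by (auto simp: chart_on_def)
  have "smooth_in c (fst c) (\<lambda>p. g c p $ i $ j)"
    using metric_smooth[OF \<open>c \<in> A\<close>] by (simp add: smooth_in_def o_def)
  then show ?thesis using \<open>S \<subseteq> fst c\<close> by (rule smooth_in_subset)
qed

lemma smooth_in_ginv:
  assumes "chart_on c S" shows "smooth_in c S (\<lambda>p. ginv g c p $ i $ j)"
  unfolding smooth_in_def ginv_def o_def
proof (rule smooth_on_matrix_inv)
  show "smooth_on (snd c ` S) (\<lambda>x. g c (chart_inv c x) $ i $ j)" for i j
    using smooth_in_metric[OF assms] by (simp add: smooth_in_def o_def)
  show "det (g c (chart_inv c x)) \<noteq> 0" if "x \<in> snd c ` S" for x
  proof -
    obtain p where "p \<in> S" "x = snd c p" using \<open>x \<in> snd c ` S\<close> by auto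
    moreover have "det (g c p) > 0"
      using \<open>p \<in> S\<close> assms by (intro metric_det_pos) (auto simp: chart_on_def)
    ultimately show ?thesis by (simp add: chart_on_inv[OF assms])
  qed
qed (rule chart_on_open[OF assms])

lemma smooth_in_sqrt_det:
  assumes "chart_on c S" shows "smooth_in c S (\<lambda>p. sqrt (det (g c p)))"
proof (rule smooth_in_compose[OF assms, where T = "{0<..}" and h = sqrt])
  show "smooth_in c S (\<lambda>p. det (g c p))"
    unfolding smooth_in_def o_def using smooth_in_metric[OF assms]
    by (intro smooth_on_det chart_on_open[OF assms]) (auto simp: smooth_in_def o_def)
  show "det (g c p) \<in> {0<..}" if "p \<in> S" for p
    using that assms by (auto simp: chart_on_def intro!: metric_det_pos)
qed (auto simp: smooth_on_sqrt)

lemma smooth_in_christoffel: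
  assumes "chart_on c S" shows "smooth_in c S (christoffel g c k i j)"
  unfolding christoffel_def[abs_def]
  by (intro smooth_in_mult smooth_in_sum smooth_in_add smooth_in_diff smooth_in_const
      smooth_in_partial smooth_in_ginv smooth_in_metric assms)

lemma smooth_in_gradient:
  assumes "chart_on c S" "smooth_in c S F" shows "smooth_in c S (\<lambda>p. gradient g c F p $ i)"
  unfolding gradient_component
  by (intro smooth_in_mult smooth_in_sum smooth_in_partial smooth_in_ginv assms)

lemma smooth_in_grad_inner:
  assumes "chart_on c S" "smooth_in c S F" "smooth_in c S E" shows "smooth_in c S (grad_inner g c F E)"
  unfolding grad_inner_def[abs_def]
  by (intro smooth_in_mult smooth_in_sum smooth_in_partial smooth_in_gradient assms)

lemma smooth_in_grad_cov:
  assumes "chart_on c S" "smooth_in c S F" shows "smooth_in c S (grad_cov g c F k i)"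
  unfolding grad_cov_def[abs_def]
  by (intro smooth_in_mult smooth_in_sum smooth_in_add smooth_in_partial smooth_in_gradient smooth_in_christoffel assms)

lemma smooth_in_hessian:
  assumes "chart_on c S" "smooth_in c S F" shows "smooth_in c S (\<lambda>p. hessian g c F p $ i $ j)"
  unfolding hessian_def vec_lambda_beta
  by (intro smooth_in_mult smooth_in_sum smooth_in_diff smooth_in_partial smooth_in_christoffel assms)

lemma smooth_in_hessian_trace:
  assumes "chart_on c S" "smooth_in c S F" shows "smooth_in c S (hessian_trace g c F)"
  unfolding hessian_trace_def[abs_def]
  by (intro smooth_in_mult smooth_in_sum smooth_in_ginv smooth_in_hessian assms)

section \<open>Bochner's formula\<close>

lemma chart_onD: "chart_on c S \<Longrightarrow> p \<in> S \<Longrightarrow> c \<in> A \<and> p \<in> fst c"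
  by (auto simp: chart_on_def)

lemmas smooth_in_geometry = smooth_in_metric smooth_in_ginv smooth_in_christoffel smooth_in_gradient
  smooth_in_grad_cov smooth_in_hessian smooth_in_partial

lemma partial_metric_sym:
  assumes "chart_on c S" "p \<in> S"
  shows "partial c l (\<lambda>q. g c q $ i $ j) p = partial c l (\<lambda>q. g c q $ j $ i) p"
  using assms by (intro partial_cong[OF assms smooth_in_metric[OF assms(1)]]) (auto intro: metric_sym' dest: chart_onD)

lemma christoffel_sym:
  assumes "chart_on c S" "p \<in> S"
  shows "christoffel g c k i j p = christoffel g c k j i p"
  unfolding christoffel_def by (simp add: partial_metric_sym[OF assms, of _ i j] add_ac)

lemma christoffel_lower:
  assumes "chart_on c S" "p \<in> S"
  shows "(\<Sum>l\<in>UNIV. g c p $ k $ l * christoffel g c l i j p) = (1/2) *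
    (partial c i (\<lambda>q. g c q $ j $ k) p + partial c j (\<lambda>q. g c q $ i $ k) p - partial c k (\<lambda>q. g c q $ i $ j) p)"
proof -
  define t where "t = (\<lambda>l. partial c i (\<lambda>q. g c q $ j $ l) p + partial c j (\<lambda>q. g c q $ i $ l) p
      - partial c l (\<lambda>q. g c q $ i $ j) p)"
  have "christoffel g c l i j p = (1/2) * (\<Sum>m\<in>UNIV. ginv g c p $ l $ m * t m)" for l
    by (simp add: christoffel_def t_def)
  then have "(\<Sum>l\<in>UNIV. g c p $ k $ l * christoffel g c l i j p)
      = (1/2) * (\<Sum>l\<in>UNIV. g c p $ k $ l * (\<Sum>m\<in>UNIV. ginv g c p $ l $ m * t m))"
    by (simp add: sum_distrib_left mult_ac)
  also have "\<dots> = (1/2) * t k"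
    using metric_ginv_contract(1)[of c p k t] chart_onD[OF assms] by simp
  finally show ?thesis by (simp add: t_def)
qed

text \<open>The Levi-Civita connection preserves the metric: \<open>\<nabla>g = 0\<close>.\<close>

lemma metric_compatible:
  assumes "chart_on c S" "p \<in> S"
  shows "partial c k (\<lambda>q. g c q $ j $ m) p
    = (\<Sum>l\<in>UNIV. g c p $ m $ l * christoffel g c l k j p) + (\<Sum>l\<in>UNIV. g c p $ j $ l * christoffel g c l k m p)"
  unfolding christoffel_lower[OF assms]
  using partial_metric_sym[OF assms, of k m j] by (simp add: field_simps)

lemma partial_eq_lower_gradient:
  assumes "chart_on c S" "p \<in> S"
  shows "partial c j F p = (\<Sum>m\<in>UNIV. g c p $ j $ m * gradient g c F p $ m)"
  unfolding gradient_component using metric_ginv_contract(1)[of c p j] chart_onD[OF assms] by simp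

lemma hessian_component:
  "hessian g c F p $ i $ j = partial c i (partial c j F) p
     - (\<Sum>k\<in>UNIV. christoffel g c k i j p * partial c k F p)"
  by (simp add: hessian_def)

text \<open>Since \<open>\<nabla>g = 0\<close>, lowering the index commutes with covariant differentiation; the Hessian is the
  covariant derivative of \<open>dF\<close>.\<close>

lemma hessian_eq_lower_grad_cov:
  assumes "chart_on c S" "p \<in> S" "smooth_in c S F"
  shows "hessian g c F p $ k $ j = (\<Sum>l\<in>UNIV. g c p $ j $ l * grad_cov g c F k l p)"
proof -
  note D = assms(1,2)
  let ?G = "\<lambda>i j. g c p $ i $ j" and ?C = "\<lambda>k i j. christoffel g c k i j p" and ?X = "\<lambda>i. gradient g c F p $ i"
  let ?dX = "\<lambda>k i. partial c k (\<lambda>q. gradient g c F q $ i) p"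
  have "partial c k (partial c j F) p = partial c k (\<lambda>q. \<Sum>m\<in>UNIV. g c q $ j $ m * gradient g c F q $ m) p"
    by (rule partial_cong[OF D]) (use assms in
      \<open>auto intro!: smooth_in_sum smooth_in_mult smooth_in_geometry simp: partial_eq_lower_gradient[OF assms(1), of _ j]\<close>)
  also have "\<dots> = (\<Sum>m\<in>UNIV. ?G j m * ?dX k m + partial c k (\<lambda>q. g c q $ j $ m) p * ?X m)"
    by (subst partial_sum[OF D(2)], intro smooth_in_mult smooth_in_geometry assms,
        subst partial_mult[OF D], (intro smooth_in_geometry assms)+) simp
  also have "\<dots> = (\<Sum>m\<in>UNIV. ?G j m * ?dX k m)
      + (\<Sum>m\<in>UNIV. \<Sum>l\<in>UNIV. ?G m l * ?C l k j * ?X m) + (\<Sum>m\<in>UNIV. \<Sum>l\<in>UNIV. ?G j l * ?C l k m * ?X m)"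
    unfolding metric_compatible[OF D]
    by (simp add: sum.distrib distrib_right sum_distrib_right)
  also have "(\<Sum>m\<in>UNIV. \<Sum>l\<in>UNIV. ?G m l * ?C l k j * ?X m) = (\<Sum>l\<in>UNIV. ?C l k j * partial c l F p)"
  proof (subst sum.swap, rule sum.cong[OF refl])
    fix l
    have "?G m l = ?G l m" for m using chart_onD[OF D] by (intro metric_sym') auto
    then show "(\<Sum>m\<in>UNIV. ?G m l * ?C l k j * ?X m) = ?C l k j * partial c l F p"
      by (simp add: partial_eq_lower_gradient[OF D, of l] sum_distrib_left mult_ac)
  qed
  also have "(\<Sum>m\<in>UNIV. \<Sum>l\<in>UNIV. ?G j l * ?C l k m * ?X m) = (\<Sum>l\<in>UNIV. ?G j l * (\<Sum>m\<in>UNIV. ?C l k m * ?X m))"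
    by (subst sum.swap) (simp add: sum_distrib_left mult_ac)
  finally show ?thesis
    by (simp add: hessian_component grad_cov_def distrib_left sum.distrib)
qed

lemma grad_cov_eq_raise_hessian:
  assumes "chart_on c S" "p \<in> S" "smooth_in c S F"
  shows "grad_cov g c F k i p = (\<Sum>j\<in>UNIV. ginv g c p $ i $ j * hessian g c F p $ k $ j)"
  unfolding hessian_eq_lower_grad_cov[OF assms]
  using metric_ginv_contract(2)[of c p i "\<lambda>l. grad_cov g c F k l p"] chart_onD[OF assms(1,2)] by simp

lemma hessian_sym:
  assumes "chart_on c S" "p \<in> S" "smooth_in c S F"
  shows "hessian g c F p $ i $ j = hessian g c F p $ j $ i"
  unfolding hessian_component
  by (simp add: partial_commute[OF assms, of i j] christoffel_sym[OF assms(1,2), of _ i j])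

lemma hessian_trace_eq_divergence:
  assumes "chart_on c S" "p \<in> S" "smooth_in c S F"
  shows "hessian_trace g c F p = (\<Sum>i\<in>UNIV. grad_cov g c F i i p)"
  by (simp add: hessian_trace_def grad_cov_eq_raise_hessian[OF assms])

text \<open>The product rule for \<open>\<langle>\<nabla>F, \<nabla>E\<rangle>\<close> with respect to the covariant derivative.\<close>

lemma partial_grad_inner:
  assumes "chart_on c S" "p \<in> S" "smooth_in c S F" "smooth_in c S E"
  shows "partial c i (grad_inner g c F E) p
    = (\<Sum>k\<in>UNIV. hessian g c F p $ i $ k * gradient g c E p $ k)
    + (\<Sum>k\<in>UNIV. hessian g c E p $ i $ k * gradient g c F p $ k)"
proof -
  note D = assms(1,2)
  let ?C = "\<lambda>k i j. christoffel g c k i j p" and ?X = "\<lambda>i. gradient g c F p $ i"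
  have "partial c i (grad_inner g c F E) p
      = (\<Sum>k\<in>UNIV. ?X k * partial c i (partial c k E) p + partial c i (\<lambda>q. gradient g c F q $ k) p * partial c k E p)"
    unfolding grad_inner_def[abs_def]
    by (subst partial_sum[OF D(2)], intro smooth_in_mult smooth_in_geometry assms,
        subst partial_mult[OF D], (intro smooth_in_geometry assms)+) simp
  also have "\<dots> = (\<Sum>k\<in>UNIV. ?X k * partial c i (partial c k E) p)
      + (\<Sum>k\<in>UNIV. grad_cov g c F i k p * partial c k E p) - (\<Sum>k\<in>UNIV. \<Sum>m\<in>UNIV. ?C k i m * ?X m * partial c k E p)"
    by (simp add: grad_cov_def sum.distrib sum_subtractf[symmetric] distrib_right sum_distrib_right)
  also have "(\<Sum>k\<in>UNIV. \<Sum>m\<in>UNIV. ?C k i m * ?X m * partial c k E p)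
      = (\<Sum>m\<in>UNIV. ?X m * (\<Sum>k\<in>UNIV. ?C k i m * partial c k E p))"
    by (subst sum.swap) (simp add: sum_distrib_left mult_ac)
  also have "(\<Sum>k\<in>UNIV. grad_cov g c F i k p * partial c k E p)
      = (\<Sum>k\<in>UNIV. \<Sum>j\<in>UNIV. ginv g c p $ k $ j * hessian g c F p $ i $ j * partial c k E p)"
    by (simp add: grad_cov_eq_raise_hessian[OF assms(1,2,3)] sum_distrib_right)
  also have "\<dots> = (\<Sum>j\<in>UNIV. hessian g c F p $ i $ j * gradient g c E p $ j)"
  proof (subst sum.swap, rule sum.cong[OF refl])
    fix j
    have "ginv g c p $ k $ j = ginv g c p $ j $ k" for k using chart_onD[OF D] by (intro ginv_sym) auto
    then show "(\<Sum>k\<in>UNIV. ginv g c p $ k $ j * hessian g c F p $ i $ j * partial c k E p)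
      = hessian g c F p $ i $ j * gradient g c E p $ j"
      by (simp add: gradient_component sum_distrib_left mult_ac)
  qed
  finally show ?thesis
    by (simp add: hessian_component[of c E] left_diff_distrib right_diff_distrib sum_subtractf mult.commute)
qed

lemma gradient_grad_norm:
  assumes "chart_on c S" "p \<in> S" "smooth_in c S F"
  shows "gradient g c (grad_inner g c F F) p $ i = 2 * (\<Sum>k\<in>UNIV. gradient g c F p $ k * grad_cov g c F k i p)"
proof -
  have "gradient g c (grad_inner g c F F) p $ i
      = (\<Sum>j\<in>UNIV. \<Sum>k\<in>UNIV. 2 * (gradient g c F p $ k * (ginv g c p $ i $ j * hessian g c F p $ j $ k)))"
    by (simp add: gradient_component[of g c "grad_inner g c F F"] partial_grad_inner[OF assms assms(3)]
        sum_distrib_left mult_ac)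
  also have "\<dots> = (\<Sum>k\<in>UNIV. \<Sum>j\<in>UNIV. 2 * (gradient g c F p $ k * (ginv g c p $ i $ j * hessian g c F p $ k $ j)))"
    by (subst sum.swap) (simp add: hessian_sym[OF assms, of _ "_ :: 'n"] cong: sum.cong)
  also have "\<dots> = 2 * (\<Sum>k\<in>UNIV. gradient g c F p $ k * grad_cov g c F k i p)"
    by (simp add: grad_cov_eq_raise_hessian[OF assms] sum_distrib_left)
  finally show ?thesis .
qed

text \<open>The Ricci identity for the gradient, traced: \<open>\<nabla>\<^sub>i \<nabla>\<^sub>k X\<^sup>i - \<nabla>\<^sub>k \<nabla>\<^sub>i X\<^sup>i = R\<^sub>k\<^sub>l X\<^sup>l\<close>. The commutator is
  contracted over the index of the vector field, so that the curvature enters through the trace that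
  defines the Ricci tensor.\<close>

lemma ricci_identity_gradient:
  assumes "chart_on c S" "p \<in> S" "smooth_in c S F"
  shows "(\<Sum>i\<in>UNIV. partial c i (grad_cov g c F k i) p + (\<Sum>m\<in>UNIV. christoffel g c i i m p * grad_cov g c F k m p)
      - (\<Sum>l\<in>UNIV. christoffel g c l i k p * grad_cov g c F l i p))
    - partial c k (hessian_trace g c F) p
    = (\<Sum>l\<in>UNIV. ricci g c p $ k $ l * gradient g c F p $ l)"
proof -
  note D = assms(1,2)
  let ?C = "\<lambda>k i j. christoffel g c k i j p" and ?X = "\<lambda>i. gradient g c F p $ i"
  let ?dX = "\<lambda>k i. partial c k (\<lambda>q. gradient g c F q $ i) p"
  let ?ddX = "\<lambda>l k i. partial c l (partial c k (\<lambda>q. gradient g c F q $ i)) p"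
  let ?dC = "\<lambda>l k i j. partial c l (christoffel g c k i j) p"
  have dY: "partial c l (grad_cov g c F k i) p = ?ddX l k i + (\<Sum>m\<in>UNIV. ?C i k m * ?dX l m + ?dC l i k m * ?X m)" for l k i
    unfolding grad_cov_def[abs_def]
    by (subst partial_add[OF D(2)], (intro smooth_in_sum smooth_in_mult smooth_in_geometry assms)+,
        subst partial_sum[OF D(2)], (intro smooth_in_mult smooth_in_geometry assms)+,
        subst partial_mult[OF D], (intro smooth_in_geometry assms)+) simp
  have "partial c k (hessian_trace g c F) p = partial c k (\<lambda>q. \<Sum>i\<in>UNIV. grad_cov g c F i i q) p"
    by (rule partial_cong[OF D]) (auto intro!: smooth_in_sum smooth_in_geometry assms
        simp: hessian_trace_eq_divergence[OF assms(1) _ assms(3)])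
  also have "\<dots> = (\<Sum>i\<in>UNIV. partial c k (grad_cov g c F i i) p)"
    by (rule partial_sum[OF D(2)]) (intro smooth_in_geometry assms)
  finally have dtr: "partial c k (hessian_trace g c F) p
      = (\<Sum>i\<in>UNIV. ?ddX i k i) + (\<Sum>i\<in>UNIV. \<Sum>m\<in>UNIV. ?C i i m * ?dX k m) + (\<Sum>i\<in>UNIV. \<Sum>m\<in>UNIV. ?dC k i i m * ?X m)"
    using partial_commute[OF D smooth_in_gradient[OF assms(1,3)], of k]
    by (simp add: dY sum.distrib)
  have e1: "(\<Sum>i\<in>UNIV. partial c i (grad_cov g c F k i) p)
      = (\<Sum>i\<in>UNIV. ?ddX i k i) + (\<Sum>i\<in>UNIV. \<Sum>m\<in>UNIV. ?C i k m * ?dX i m) + (\<Sum>i\<in>UNIV. \<Sum>m\<in>UNIV. ?dC i i k m * ?X m)"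
    by (simp add: dY sum.distrib)
  have e2: "(\<Sum>i\<in>UNIV. \<Sum>m\<in>UNIV. ?C i i m * grad_cov g c F k m p)
      = (\<Sum>i\<in>UNIV. \<Sum>m\<in>UNIV. ?C i i m * ?dX k m) + (\<Sum>i\<in>UNIV. \<Sum>m\<in>UNIV. \<Sum>l\<in>UNIV. ?C i i m * ?C m k l * ?X l)"
    by (simp add: grad_cov_def distrib_left sum.distrib sum_distrib_left mult.assoc)
  have e3: "(\<Sum>i\<in>UNIV. \<Sum>l\<in>UNIV. ?C l i k * grad_cov g c F l i p)
      = (\<Sum>i\<in>UNIV. \<Sum>m\<in>UNIV. ?C i k m * ?dX i m) + (\<Sum>i\<in>UNIV. \<Sum>m\<in>UNIV. \<Sum>l\<in>UNIV. ?C i k m * ?C m i l * ?X l)"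
    by (subst sum.swap)
       (simp add: grad_cov_def distrib_left sum.distrib sum_distrib_left mult.assoc christoffel_sym[OF D, of _ _ k])
  have "(\<Sum>l\<in>UNIV. ricci g c p $ k $ l * ?X l)
      = (\<Sum>l\<in>UNIV. \<Sum>i\<in>UNIV. ?dC i i k l * ?X l) - (\<Sum>l\<in>UNIV. \<Sum>i\<in>UNIV. ?dC k i i l * ?X l)
        + ((\<Sum>l\<in>UNIV. \<Sum>i\<in>UNIV. \<Sum>m\<in>UNIV. ?C i i m * ?C m k l * ?X l)
        - (\<Sum>l\<in>UNIV. \<Sum>i\<in>UNIV. \<Sum>m\<in>UNIV. ?C i k m * ?C m i l * ?X l))"
    by (simp add: ricci_def riemann_def sum_distrib_right sum.distrib sum_subtractf distrib_right left_diff_distrib)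
  also have "(\<Sum>l\<in>UNIV. \<Sum>i\<in>UNIV. ?dC i i k l * ?X l) = (\<Sum>i\<in>UNIV. \<Sum>m\<in>UNIV. ?dC i i k m * ?X m)"
    by (rule sum.swap)
  also have "(\<Sum>l\<in>UNIV. \<Sum>i\<in>UNIV. ?dC k i i l * ?X l) = (\<Sum>i\<in>UNIV. \<Sum>m\<in>UNIV. ?dC k i i m * ?X m)"
    by (rule sum.swap)
  also have "(\<Sum>l\<in>UNIV. \<Sum>i\<in>UNIV. \<Sum>m\<in>UNIV. ?C i i m * ?C m k l * ?X l) = (\<Sum>i\<in>UNIV. \<Sum>m\<in>UNIV. \<Sum>l\<in>UNIV. ?C i i m * ?C m k l * ?X l)"
    by (subst sum.swap, rule sum.cong[OF refl], rule sum.swap)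
  also have "(\<Sum>l\<in>UNIV. \<Sum>i\<in>UNIV. \<Sum>m\<in>UNIV. ?C i k m * ?C m i l * ?X l) = (\<Sum>i\<in>UNIV. \<Sum>m\<in>UNIV. \<Sum>l\<in>UNIV. ?C i k m * ?C m i l * ?X l)"
    by (subst sum.swap, rule sum.cong[OF refl], rule sum.swap)
  finally show ?thesis
    unfolding sum.distrib sum_subtractf dtr e1 e2 e3 by simp
qed

text \<open>Bochner's formula: take the divergence of \<open>\<nabla>\<bar>\<nabla>F\<bar>\<^sup>2 = 2 \<nabla>\<^sub>\<nabla>\<^sub>F \<nabla>F\<close> and commute the derivatives.\<close>

lemma bochner:
  assumes "chart_on c S" "p \<in> S" "smooth_in c S F"
  shows "(1/2) * hessian_trace g c (grad_inner g c F F) p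
    = (\<Sum>i\<in>UNIV. \<Sum>k\<in>UNIV. grad_cov g c F i k p * grad_cov g c F k i p)
    + grad_inner g c F (hessian_trace g c F) p
    + gradient g c F p \<bullet> (ricci g c p *v gradient g c F p)"
proof -
  note D = assms(1,2)
  let ?C = "\<lambda>k i j. christoffel g c k i j p" and ?X = "\<lambda>i. gradient g c F p $ i"
  let ?Y = "\<lambda>k i. grad_cov g c F k i p" and ?dY = "\<lambda>l k i. partial c l (grad_cov g c F k i) p"
  let ?dX = "\<lambda>k i. partial c k (\<lambda>q. gradient g c F q $ i) p"
  let ?N = "grad_inner g c F F"
  have N: "smooth_in c S ?N" by (intro smooth_in_grad_inner assms)
  have "partial c i (\<lambda>q. gradient g c ?N q $ i) p
      = partial c i (\<lambda>q. 2 * (\<Sum>k\<in>UNIV. gradient g c F q $ k * grad_cov g c F k i q)) p" for i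
    by (rule partial_cong[OF D]) (auto intro!: smooth_in_mult smooth_in_sum smooth_in_geometry smooth_in_const assms
        simp: gradient_grad_norm[OF assms(1) _ assms(3)])
  also have "partial c i (\<lambda>q. 2 * (\<Sum>k\<in>UNIV. gradient g c F q $ k * grad_cov g c F k i q)) p
      = 2 * (\<Sum>k\<in>UNIV. ?X k * ?dY i k i + ?dX i k * ?Y k i)" for i
    by (subst partial_cmult[OF D], (intro smooth_in_sum smooth_in_mult smooth_in_geometry assms)+,
        subst partial_sum[OF D(2)], (intro smooth_in_mult smooth_in_geometry assms)+,
        subst partial_mult[OF D], (intro smooth_in_geometry assms)+) simp
  finally have dN: "partial c i (\<lambda>q. gradient g c ?N q $ i) p = 2 * (\<Sum>k\<in>UNIV. ?X k * ?dY i k i + ?dX i k * ?Y k i)" for i .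
  have half: "(1/2) * hessian_trace g c ?N p
      = (\<Sum>i\<in>UNIV. \<Sum>k\<in>UNIV. ?X k * ?dY i k i) + (\<Sum>i\<in>UNIV. \<Sum>k\<in>UNIV. ?dX i k * ?Y k i)
        + (\<Sum>i\<in>UNIV. \<Sum>m\<in>UNIV. \<Sum>k\<in>UNIV. ?X k * (?C i i m * ?Y k m))"
    unfolding hessian_trace_eq_divergence[OF D N] grad_cov_def[of g c ?N] dN gradient_grad_norm[OF assms]
    by (simp add: sum.distrib sum_distrib_left distrib_left mult_ac)
  have dX: "?dX i k = ?Y i k - (\<Sum>m\<in>UNIV. ?C k i m * ?X m)" for i k by (simp add: grad_cov_def)
  have "(\<Sum>i\<in>UNIV. \<Sum>k\<in>UNIV. ?dX i k * ?Y k i)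
      = (\<Sum>i\<in>UNIV. \<Sum>k\<in>UNIV. ?Y i k * ?Y k i) - (\<Sum>i\<in>UNIV. \<Sum>k\<in>UNIV. \<Sum>m\<in>UNIV. ?X m * (?C k i m * ?Y k i))"
    unfolding dX by (simp add: left_diff_distrib right_diff_distrib sum_subtractf sum_distrib_left sum_distrib_right mult_ac)
  also have "(\<Sum>i\<in>UNIV. \<Sum>k\<in>UNIV. \<Sum>m\<in>UNIV. ?X m * (?C k i m * ?Y k i))
     = (\<Sum>k\<in>UNIV. ?X k * (\<Sum>i\<in>UNIV. \<Sum>l\<in>UNIV. ?C l i k * ?Y l i))"
    by (subst sum.swap, subst (2) sum.swap, subst sum.swap, subst (2) sum.swap) (simp add: sum_distrib_left)
  finally have e1: "(\<Sum>i\<in>UNIV. \<Sum>k\<in>UNIV. ?dX i k * ?Y k i) = (\<Sum>i\<in>UNIV. \<Sum>k\<in>UNIV. ?Y i k * ?Y k i)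
     - (\<Sum>k\<in>UNIV. ?X k * (\<Sum>i\<in>UNIV. \<Sum>l\<in>UNIV. ?C l i k * ?Y l i))" .
  have e2: "(\<Sum>i\<in>UNIV. \<Sum>k\<in>UNIV. ?X k * ?dY i k i) = (\<Sum>k\<in>UNIV. ?X k * (\<Sum>i\<in>UNIV. ?dY i k i))"
    by (subst sum.swap) (simp add: sum_distrib_left)
  have e3: "(\<Sum>i\<in>UNIV. \<Sum>m\<in>UNIV. \<Sum>k\<in>UNIV. ?X k * (?C i i m * ?Y k m))
      = (\<Sum>k\<in>UNIV. ?X k * (\<Sum>i\<in>UNIV. \<Sum>m\<in>UNIV. ?C i i m * ?Y k m))"
  proof -
    have "(\<Sum>i\<in>UNIV. \<Sum>m\<in>UNIV. \<Sum>k\<in>UNIV. ?X k * (?C i i m * ?Y k m))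
        = (\<Sum>i\<in>UNIV. \<Sum>k\<in>UNIV. \<Sum>m\<in>UNIV. ?X k * (?C i i m * ?Y k m))"
      by (rule sum.cong[OF refl], rule sum.swap)
    also have "\<dots> = (\<Sum>k\<in>UNIV. \<Sum>i\<in>UNIV. \<Sum>m\<in>UNIV. ?X k * (?C i i m * ?Y k m))"
      by (rule sum.swap)
    finally show ?thesis by (simp add: sum_distrib_left)
  qed
  have "gradient g c F p \<bullet> (ricci g c p *v gradient g c F p) = (\<Sum>k\<in>UNIV. ?X k * (\<Sum>l\<in>UNIV. ricci g c p $ k $ l * ?X l))"
    by (simp add: inner_vec_def matrix_vector_mult_def)
  then show ?thesis
    unfolding half e1 e2 e3 ricci_identity_gradient[OF assms, symmetric] grad_inner_def
    by (simp add: sum.distrib sum_subtractf algebra_simps)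
qed

subsection \<open>Tensor norms\<close>

text \<open>Raising one index of a symmetric tensor \<open>B\<close> gives an endomorphism \<open>Z\<close> with \<open>\<bar>B\<bar>\<^sup>2 = tr (Z\<^sup>2)\<close>. This is
  the form in which the norm of the Hessian enters Bochner's formula.\<close>

lemma contraction_eq_trace:
  assumes "c \<in> A" "p \<in> fst c" and sym: "\<And>i j. B $ i $ j = B $ j $ i"
    and Z: "\<And>k i. Z k i = (\<Sum>j\<in>UNIV. ginv g c p $ i $ j * B $ k $ j)"
  shows "(\<Sum>i\<in>UNIV. \<Sum>j\<in>UNIV. \<Sum>k\<in>UNIV. \<Sum>l\<in>UNIV. ginv g c p $ i $ k * ginv g c p $ j $ l * B $ i $ j * B $ k $ l)
    = (\<Sum>i\<in>UNIV. \<Sum>k\<in>UNIV. Z i k * Z k i)"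
proof -
  let ?I = "ginv g c p"
  note isym = ginv_sym[OF assms(1,2)]
  have "(\<Sum>i\<in>UNIV. \<Sum>k\<in>UNIV. Z i k * Z k i)
      = (\<Sum>i\<in>UNIV. \<Sum>l\<in>UNIV. \<Sum>j\<in>UNIV. \<Sum>k\<in>UNIV. (?I $ l $ j * B $ i $ j) * (?I $ i $ k * B $ l $ k))"
    by (simp only: Z sum_product)
  also have "\<dots> = (\<Sum>i\<in>UNIV. \<Sum>l\<in>UNIV. \<Sum>j\<in>UNIV. \<Sum>k\<in>UNIV. ?I $ i $ k * ?I $ j $ l * B $ i $ j * B $ k $ l)"
  proof (intro sum.cong refl)
    fix i l j k
    show "(?I $ l $ j * B $ i $ j) * (?I $ i $ k * B $ l $ k) = ?I $ i $ k * ?I $ j $ l * B $ i $ j * B $ k $ l"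
      by (simp only: isym[of l j] sym[of l k] mult_ac)
  qed
  also have "\<dots> = (\<Sum>i\<in>UNIV. \<Sum>j\<in>UNIV. \<Sum>l\<in>UNIV. \<Sum>k\<in>UNIV. ?I $ i $ k * ?I $ j $ l * B $ i $ j * B $ k $ l)"
    by (rule sum.cong[OF refl], rule sum.swap)
  also have "\<dots> = (\<Sum>i\<in>UNIV. \<Sum>j\<in>UNIV. \<Sum>k\<in>UNIV. \<Sum>l\<in>UNIV. ?I $ i $ k * ?I $ j $ l * B $ i $ j * B $ k $ l)"
    by (rule sum.cong[OF refl], rule sum.cong[OF refl], rule sum.swap)
  finally show ?thesis ..
qed

lemma tensor2_norm_sq:
  assumes "c \<in> A" "p \<in> fst c"
  shows "(tensor2_norm g c B p)\<^sup>2 = (\<Sum>i\<in>UNIV. \<Sum>j\<in>UNIV. \<Sum>k\<in>UNIV. \<Sum>l\<in>UNIV.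
    ginv g c p $ i $ k * ginv g c p $ j $ l * B $ i $ j * B $ k $ l)"
  unfolding tensor2_norm_def
  by (intro real_sqrt_pow2 gram_contraction_nonneg ginv_transpose assms)
     (auto simp: ginv_def intro!: matrix_inv_positive_semidefinite metric_sym metric_pos assms)

lemma hessian_minus_metric_norm_sq:
  assumes "chart_on c S" "p \<in> S" "smooth_in c S F"
  shows "(tensor2_norm g c (hessian g c F p - s *\<^sub>R g c p) p)\<^sup>2
    = (\<Sum>i\<in>UNIV. \<Sum>k\<in>UNIV. grad_cov g c F i k p * grad_cov g c F k i p)
      - 2 * s * hessian_trace g c F p + s\<^sup>2 * real CARD('n)"
proof -
  have c: "c \<in> A" "p \<in> fst c" using chart_onD[OF assms(1,2)] by auto
  let ?Y = "\<lambda>k i. grad_cov g c F k i p"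
  \<comment> \<open>Raising an index turns \<open>s g\<close> into \<open>s\<close> times the identity.\<close>
  define d where "d = (\<lambda>i k :: 'n. if i = k then s else 0)"
  have "(\<Sum>j\<in>UNIV. ginv g c p $ i $ j * g c p $ k $ j) = (if i = k then 1 else 0)" for i k
  proof -
    have "(\<Sum>j\<in>UNIV. ginv g c p $ i $ j * g c p $ k $ j) = (ginv g c p ** g c p) $ i $ k"
      by (simp add: matrix_mult_component metric_sym'[OF c, of k])
    then show ?thesis by (simp add: ginv_inverse(2)[OF c] mat_def)
  qed
  then have Z: "?Y k i - d i k = (\<Sum>j\<in>UNIV. ginv g c p $ i $ j * (hessian g c F p - s *\<^sub>R g c p) $ k $ j)" for k i
    by (simp add: grad_cov_eq_raise_hessian[OF assms] d_def right_diff_distrib sum_subtractf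
        mult.left_commute[of _ s] sum_distrib_left[symmetric])
  have "(tensor2_norm g c (hessian g c F p - s *\<^sub>R g c p) p)\<^sup>2
      = (\<Sum>i\<in>UNIV. \<Sum>k\<in>UNIV. (?Y i k - d k i) * (?Y k i - d i k))"
    unfolding tensor2_norm_sq[OF c]
    by (rule contraction_eq_trace[OF c _ Z])
       (simp add: hessian_sym[OF assms, of i j for i j] metric_sym'[OF c, of i j for i j])
  also have "\<dots> = (\<Sum>i\<in>UNIV. \<Sum>k\<in>UNIV. ?Y i k * ?Y k i) - (\<Sum>i\<in>UNIV. \<Sum>k\<in>UNIV. ?Y i k * d i k)
      - (\<Sum>i\<in>UNIV. \<Sum>k\<in>UNIV. d k i * ?Y k i) + (\<Sum>i\<in>UNIV. \<Sum>k\<in>UNIV. d k i * d i k)"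
    by (simp add: left_diff_distrib right_diff_distrib sum_subtractf sum.distrib)
  also have "\<dots> = (\<Sum>i\<in>UNIV. \<Sum>k\<in>UNIV. ?Y i k * ?Y k i) - 2 * s * (\<Sum>i\<in>UNIV. ?Y i i) + s\<^sup>2 * real CARD('n)"
    by (simp add: d_def mult_delta_left mult_delta_right sum_distrib_left sum_distrib_right power2_eq_square mult_ac
        sum_negf sum_subtractf)
  finally show ?thesis by (simp add: hessian_trace_eq_divergence[OF assms])
qed

subsection \<open>Divergence form of the Laplacian\<close>

text \<open>By Jacobi's formula \<open>\<partial>\<^sub>m sqrt (det g) = (1/2) sqrt (det g) g\<^sup>i\<^sup>j \<partial>\<^sub>m g\<^sub>i\<^sub>j\<close>; in the trace of the Christoffel
  symbol the two other derivatives of the metric cancel by symmetry.\<close>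

lemma partial_sqrt_det:
  assumes "chart_on c S" "p \<in> S"
  shows "partial c m (\<lambda>q. sqrt (det (g c q))) p
    = sqrt (det (g c p)) * (\<Sum>i\<in>UNIV. christoffel g c i i m p)"
proof -
  have c: "c \<in> A" "p \<in> fst c" using chart_onD[OF assms(1,2)] by auto
  let ?I = "\<lambda>i j. ginv g c p $ i $ j" and ?dg = "\<lambda>l i j. partial c l (\<lambda>q. g c q $ i $ j) p"
  note pos = metric_det_pos[OF c]
  have e: "g c (chart_inv c (snd c p)) = g c p" by (simp add: chart_on_inv[OF assms])
  have "((\<lambda>x. det (g c (chart_inv c x))) has_derivative
     (\<lambda>v. det (g c (chart_inv c (snd c p))) * (\<Sum>i\<in>UNIV. \<Sum>j\<in>UNIV. matrix_inv (g c (chart_inv c (snd c p))) $ i $ j *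
       frechet_derivative ((\<lambda>q. g c q $ j $ i) \<circ> chart_inv c) (at (snd c p)) v))) (at (snd c p))"
    using smooth_in_has_derivative[OF assms(2) smooth_in_metric[OF assms(1)]] pos
    by (intro has_derivative_det) (auto simp: o_def e)
  then have "((\<lambda>x. sqrt (det (g c (chart_inv c x)))) has_derivative
     (\<lambda>v. (det (g c p) * (\<Sum>i\<in>UNIV. \<Sum>j\<in>UNIV. ?I i j *
       frechet_derivative ((\<lambda>q. g c q $ j $ i) \<circ> chart_inv c) (at (snd c p)) v)) * (inverse (sqrt (det (g c p))) / 2))) (at (snd c p))"
    using pos by (auto intro!: derivative_eq_intros simp: e ginv_def)
  then have "partial c m (\<lambda>q. sqrt (det (g c q))) p
      = det (g c p) * (\<Sum>i\<in>UNIV. \<Sum>j\<in>UNIV. ?I i j * ?dg m j i) * (inverse (sqrt (det (g c p))) / 2)"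
    unfolding partial_def o_def by (rule frechet_derivative_eqI)
  also have "\<dots> = sqrt (det (g c p)) * ((1/2) * (\<Sum>i\<in>UNIV. \<Sum>j\<in>UNIV. ?I i j * ?dg m j i))"
    using pos real_sqrt_mult_self[of "det (g c p)"] by (simp add: field_simps)
  also have "(1/2) * (\<Sum>i\<in>UNIV. \<Sum>j\<in>UNIV. ?I i j * ?dg m j i) = (\<Sum>i\<in>UNIV. christoffel g c i i m p)"
  proof -
    have "(\<Sum>i\<in>UNIV. \<Sum>l\<in>UNIV. ?I i l * ?dg i m l) = (\<Sum>i\<in>UNIV. \<Sum>l\<in>UNIV. ?I i l * ?dg l i m)"
      by (subst sum.swap, intro sum.cong refl) (simp add: ginv_sym[OF c, of _ "_ :: 'n"] partial_metric_sym[OF assms, of _ m])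
    moreover have "christoffel g c i i m p = (1/2) * ((\<Sum>l\<in>UNIV. ?I i l * ?dg i m l)
        + (\<Sum>l\<in>UNIV. ?I i l * ?dg m i l) - (\<Sum>l\<in>UNIV. ?I i l * ?dg l i m))" for i
      by (simp add: christoffel_def distrib_left right_diff_distrib sum.distrib sum_subtractf)
    then have "(\<Sum>i\<in>UNIV. christoffel g c i i m p) = (1/2) * ((\<Sum>i\<in>UNIV. \<Sum>l\<in>UNIV. ?I i l * ?dg i m l)
        + (\<Sum>i\<in>UNIV. \<Sum>l\<in>UNIV. ?I i l * ?dg m i l) - (\<Sum>i\<in>UNIV. \<Sum>l\<in>UNIV. ?I i l * ?dg l i m))"
      by (simp only: sum_distrib_left[symmetric]) (simp only: sum.distrib sum_subtractf)
    ultimately show ?thesis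
      by (simp add: partial_metric_sym[OF assms, of m])
  qed
  finally show ?thesis .
qed

text \<open>Multiplied by the volume density, the divergence of \<open>\<psi> \<nabla>F\<close> is a Euclidean divergence; this is what
  reduces Green's formula to integration by parts.\<close>

lemma divergence_form:
  assumes "chart_on c S" "p \<in> S" "smooth_in c S \<psi>" "smooth_in c S F"
  shows "(\<Sum>i\<in>UNIV. partial c i (\<lambda>q. sqrt (det (g c q)) * (\<psi> q * gradient g c F q $ i)) p)
    = sqrt (det (g c p)) * (\<psi> p * hessian_trace g c F p + grad_inner g c F \<psi> p)"
proof -
  note D = assms(1,2)
  let ?r = "sqrt (det (g c p))" and ?X = "\<lambda>i. gradient g c F p $ i" and ?C = "\<lambda>k i j. christoffel g c k i j p"
  have "partial c i (\<lambda>q. sqrt (det (g c q)) * (\<psi> q * gradient g c F q $ i)) p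
      = ?r * (\<psi> p * partial c i (\<lambda>q. gradient g c F q $ i) p + partial c i \<psi> p * ?X i)
        + ?r * (\<Sum>k\<in>UNIV. ?C k k i) * (\<psi> p * ?X i)" for i
    by (subst partial_mult[OF D], (intro smooth_in_sqrt_det smooth_in_mult smooth_in_geometry assms)+,
        subst partial_mult[OF D], (intro smooth_in_geometry assms)+) (simp add: partial_sqrt_det[OF D])
  then have "(\<Sum>i\<in>UNIV. partial c i (\<lambda>q. sqrt (det (g c q)) * (\<psi> q * gradient g c F q $ i)) p)
      = ?r * (\<psi> p * (\<Sum>i\<in>UNIV. partial c i (\<lambda>q. gradient g c F q $ i) p) + (\<Sum>i\<in>UNIV. partial c i \<psi> p * ?X i)
        + \<psi> p * (\<Sum>i\<in>UNIV. \<Sum>k\<in>UNIV. ?C k k i * ?X i))"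
    by (simp add: sum.distrib sum_distrib_left sum_distrib_right algebra_simps)
  also have "(\<Sum>i\<in>UNIV. \<Sum>k\<in>UNIV. ?C k k i * ?X i) = (\<Sum>i\<in>UNIV. \<Sum>m\<in>UNIV. ?C i i m * ?X m)"
    by (rule sum.swap)
  finally show ?thesis
    by (simp add: hessian_trace_eq_divergence[OF D assms(4)] grad_cov_def grad_inner_def sum.distrib algebra_simps)
qed

end

section \<open>Invariance under changes of charts\<close>

lemma bilinear_form_eqI:
  fixes B C :: "real^'n^'n"
  assumes "\<And>u v. u \<bullet> (B *v v) = u \<bullet> (C *v v)"
  shows "B = C"
proof -
  have "B $ i $ j = C $ i $ j" for i j
    using assms[of "axis i 1" "axis j 1"] by (simp add: inner_axis' matrix_vector_mult_basis column_def)
  then show ?thesis by (simp add: vec_eq_iff)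
qed

lemma inner_transpose_matrix: "x \<bullet> (transpose (J :: real^'n^'n) *v y) = (J *v x) \<bullet> y"
  by (metis dot_lmul_matrix matrix_vector_mul_assoc transpose_matrix_vector vector_transpose_matrix)

context closed_riemannian_manifold
begin

definition transition_jacobian :: "('m, 'n) chart \<Rightarrow> ('m, 'n) chart \<Rightarrow> 'm \<Rightarrow> real^'n^'n" where
  "transition_jacobian c d p = matrix (frechet_derivative (transition c d) (at (snd c p)))"

abbreviation "differential c F p \<equiv> (\<chi> i. partial c i F p)"

lemma transition_has_derivative:
  assumes "c \<in> A" "d \<in> A" "p \<in> fst c \<inter> fst d"
  shows "(transition c d has_derivative frechet_derivative (transition c d) (at (snd c p))) (at (snd c p))"
  using assms by (intro smooth_on_has_derivative[OF chart_compat[OF assms(1,2)]]) auto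

lemma smooth_in_transfer:
  assumes "chart_on c S" "chart_on d S" "smooth_in d S F"
  shows "smooth_in c S F"
proof -
  have "smooth_on (snd c ` S) (transition c d)"
    by (rule smooth_on_subset[OF chart_compat]) (use assms in \<open>auto simp: chart_on_def\<close>)
  then have "smooth_on (snd c ` S) (\<lambda>x. (F \<circ> chart_inv d) (transition c d x))"
    using assms(3) unfolding smooth_in_def
    by (rule smooth_on_compose[OF chart_on_open[OF assms(1)] chart_on_open[OF assms(2)], rotated])
       (use assms in \<open>auto simp: transition_def chart_on_inv\<close>)
  then show ?thesis unfolding smooth_in_def
    by (rule smooth_on_cong[OF chart_on_open[OF assms(1)], THEN iffD1, rotated])
       (use assms in \<open>auto simp: transition_def chart_on_inv\<close>)
qed

lemma differential_transform:
  assumes "chart_on c S" "chart_on d S" "p \<in> S" "smooth_in d S F"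
  shows "differential c F p = transpose (transition_jacobian c d p) *v differential d F p"
proof -
  define \<phi> where "\<phi> = frechet_derivative (F \<circ> chart_inv d) (at (snd d p))"
  define \<theta> where "\<theta> = frechet_derivative (transition c d) (at (snd c p))"
  have cd: "c \<in> A" "d \<in> A" "p \<in> fst c \<inter> fst d" using assms by (auto simp: chart_on_def)
  have \<phi>: "(F \<circ> chart_inv d has_derivative \<phi>) (at (transition c d (snd c p)))"
    using smooth_in_has_derivative[OF assms(3,4)] chart_on_inv[OF assms(1,3)] by (simp add: \<phi>_def transition_def)
  have "((\<lambda>x. (F \<circ> chart_inv d) (transition c d x)) has_derivative (\<lambda>v. \<phi> (\<theta> v))) (at (snd c p))"
    using has_derivative_compose[OF transition_has_derivative[OF cd] \<phi>] by (simp add: \<theta>_def)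
  then have "(F \<circ> chart_inv c has_derivative (\<lambda>v. \<phi> (\<theta> v))) (at (snd c p))"
    by (rule has_derivative_transform_within_open[OF _ chart_on_open[OF assms(1)]])
       (use assms in \<open>auto simp: transition_def chart_on_inv\<close>)
  then have "partial c i F p = \<phi> (\<theta> (axis i 1))" for i
    by (simp add: partial_def frechet_derivative_eqI)
  moreover have "\<phi> w = (\<Sum>k\<in>UNIV. w $ k * partial d k F p)" for w
  proof -
    have l: "linear \<phi>" using \<phi> has_derivative_linear by blast
    have "\<phi> w = \<phi> (\<Sum>k\<in>UNIV. w $ k *\<^sub>R axis k 1)"
      by (metis basis_expansion scalar_mult_eq_scaleR)
    also have "\<dots> = (\<Sum>k\<in>UNIV. w $ k * \<phi> (axis k 1))"
      by (simp add: linear_sum[OF l] linear_scale[OF l])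
    finally show ?thesis by (simp add: partial_def \<phi>_def)
  qed
  ultimately show ?thesis
    by (simp add: vec_eq_iff transition_jacobian_def matrix_def transpose_def matrix_vector_mult_def \<theta>_def)
qed

lemma metric_transform:
  assumes "c \<in> A" "d \<in> A" "p \<in> fst c \<inter> fst d"
  shows "g c p = transpose (transition_jacobian c d p) ** g d p ** transition_jacobian c d p"
  using metric_tensor[OF assms] by (simp add: transition_jacobian_def)

lemma transition_jacobian_det_nonzero:
  assumes "c \<in> A" "d \<in> A" "p \<in> fst c \<inter> fst d"
  shows "det (transition_jacobian c d p) \<noteq> 0"
  using metric_det_pos[of c p] assms metric_transform[OF assms] by (auto simp: det_mul)

lemma ginv_transform:
  assumes "c \<in> A" "d \<in> A" "p \<in> fst c \<inter> fst d"
  shows "ginv g d p = transition_jacobian c d p ** ginv g c p ** transpose (transition_jacobian c d p)"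
proof -
  define J where "J = transition_jacobian c d p"
  define K where "K = matrix_inv J"
  have JK: "J ** K = mat 1" "K ** J = mat 1"
    using matrix_inv_inverse[OF transition_jacobian_det_nonzero[OF assms]] by (auto simp: J_def K_def)
  have c: "c \<in> A" "p \<in> fst c" using assms by auto
  have "g d p ** J = transpose K ** (transpose J ** g d p ** J)"
    by (simp add: matrix_mul_assoc matrix_transpose_mul[symmetric] JK transpose_mat)
  also have "\<dots> = transpose K ** g c p" by (simp add: metric_transform[OF assms] J_def)
  finally have "g d p ** (J ** ginv g c p ** transpose J) = transpose K ** (g c p ** ginv g c p) ** transpose J"
    by (simp add: matrix_mul_assoc)
  also have "\<dots> = mat 1"
    by (simp add: ginv_inverse[OF c] matrix_transpose_mul[symmetric] JK transpose_mat)
  finally show ?thesis unfolding ginv_def[of g d] J_def by (rule matrix_inv_unique)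
qed

lemma gradient_transform:
  assumes "chart_on c S" "chart_on d S" "p \<in> S" "smooth_in d S F"
  shows "gradient g d F p = transition_jacobian c d p *v gradient g c F p"
proof -
  have cd: "c \<in> A" "d \<in> A" "p \<in> fst c \<inter> fst d" using assms by (auto simp: chart_on_def)
  show ?thesis
    by (simp add: gradient_def ginv_transform[OF cd] differential_transform[OF assms] matrix_vector_mul_assoc matrix_mul_assoc
        del: transpose_matrix_vector)
qed

lemma grad_inner_eq_inner: "grad_inner g c F E p = gradient g c F p \<bullet> differential c E p"
  by (simp add: grad_inner_def inner_vec_def)

lemma grad_inner_transform:
  assumes "chart_on c S" "chart_on d S" "p \<in> S" "smooth_in d S F" "smooth_in d S E"
  shows "grad_inner g c F E p = grad_inner g d F E p"
  by (simp add: grad_inner_eq_inner differential_transform[OF assms(1-3,5)] gradient_transform[OF assms(1-4)]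
      inner_transpose_matrix del: transpose_matrix_vector)

lemma grad_inner_cong:
  assumes "chart_on c S" "p \<in> S" "smooth_in c S E" "\<And>q. q \<in> S \<Longrightarrow> E q = E' q"
  shows "grad_inner g c F E p = grad_inner g c F E' p"
  by (simp add: grad_inner_def partial_cong[OF assms])

lemma grad_inner_commute:
  assumes "chart_on c S" "p \<in> S"
  shows "grad_inner g c F E p = grad_inner g c E F p"
proof -
  have "ginv g c p $ i $ j = ginv g c p $ j $ i" for i j using chart_onD[OF assms] by (intro ginv_sym) auto
  then have "(\<Sum>k\<in>UNIV. \<Sum>j\<in>UNIV. ginv g c p $ k $ j * partial c j F p * partial c k E p)
    = (\<Sum>k\<in>UNIV. \<Sum>j\<in>UNIV. ginv g c p $ j $ k * partial c j F p * partial c k E p)" by simp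
  then show ?thesis
    by (simp add: grad_inner_def gradient_component sum_distrib_right)
       (subst sum.swap, simp add: mult_ac)
qed

text \<open>The Hessian as a bilinear form on gradients is determined by the inner product of gradients, so that
  its transformation law follows from the invariance of that inner product.\<close>

lemma hessian_on_gradients:
  assumes "chart_on c S" "p \<in> S" "smooth_in c S F" "smooth_in c S a" "smooth_in c S b"
  shows "2 * (gradient g c a p \<bullet> (hessian g c F p *v gradient g c b p))
    = grad_inner g c a (grad_inner g c F b) p + grad_inner g c b (grad_inner g c F a) p
      - grad_inner g c F (grad_inner g c a b) p"
proof -
  have d: "differential c (grad_inner g c E E') p
     = hessian g c E p *v gradient g c E' p + hessian g c E' p *v gradient g c E p"
    if "smooth_in c S E" "smooth_in c S E'" for E E'
    by (simp add: vec_eq_iff partial_grad_inner[OF assms(1,2) that] matrix_vector_mult_def)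
  have s: "x \<bullet> (hessian g c E p *v y) = y \<bullet> (hessian g c E p *v x)" if "smooth_in c S E" for E x y
  proof -
    have "transpose (hessian g c E p) = hessian g c E p"
      using hessian_sym[OF assms(1,2) that] by (simp add: transpose_def vec_eq_iff)
    then have "x \<bullet> (hessian g c E p *v y) = (hessian g c E p *v x) \<bullet> y" by (metis inner_transpose_matrix)
    then show ?thesis by (simp add: inner_commute)
  qed
  show ?thesis
    unfolding grad_inner_eq_inner[of c _ "grad_inner g c _ _"] d[OF assms(3,5)] d[OF assms(3,4)] d[OF assms(4,5)]
    using s[OF assms(3), of "gradient g c a p"] s[OF assms(4), of "gradient g c F p"] s[OF assms(5), of "gradient g c F p"]
    by (simp add: inner_add_right)
qed

lemma hessian_transform:
  assumes "chart_on c S" "chart_on d S" "p \<in> S" "smooth_in d S F"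
  shows "hessian g c F p = transpose (transition_jacobian c d p) ** hessian g d F p ** transition_jacobian c d p"
proof (rule bilinear_form_eqI)
  fix u v :: "real^'n"
  have cd: "c \<in> A" "d \<in> A" "p \<in> fst c \<inter> fst d" using assms by (auto simp: chart_on_def)
  note Fc = smooth_in_transfer[OF assms(1,2,4)]
  \<comment> \<open>Coordinates of the chart \<open>c\<close> provide functions with any prescribed gradient at \<open>p\<close>.\<close>
  define lin where "lin = (\<lambda>w q. (g c p *v w) \<bullet> snd c q)"
  have lin: "(lin w \<circ> chart_inv c) x = (g c p *v w) \<bullet> x" if "x \<in> snd c ` S" for w x
    using that assms(1) by (auto simp: lin_def chart_on_inv)
  have slin: "smooth_in c S (lin w)" for w
    unfolding smooth_in_def
    by (rule smooth_on_cong[OF chart_on_open[OF assms(1)], THEN iffD2, OF lin smooth_on_linear])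
       (auto intro: chart_on_open[OF assms(1)] bounded_linear_inner_right)
  then have slin': "smooth_in d S (lin w)" for w by (rule smooth_in_transfer[OF assms(2,1)])
  have "partial c i (lin w) p = (g c p *v w) $ i" for w i
  proof -
    have "(lin w \<circ> chart_inv c has_derivative (\<lambda>x. (g c p *v w) \<bullet> x)) (at (snd c p))"
      by (rule has_derivative_transform_within_open[OF bounded_linear_imp_has_derivative[OF bounded_linear_inner_right]
            chart_on_open[OF assms(1)]]) (use assms(3) lin in auto)
    then show ?thesis by (simp add: partial_def frechet_derivative_eqI inner_axis)
  qed
  then have glin: "gradient g c (lin w) p = w" for w
    using ginv_inverse[of c p] cd by (simp add: gradient_def vec_lambda_eta matrix_vector_mul_assoc)
  have eq: "grad_inner g c E (grad_inner g c E' E'') p = grad_inner g d E (grad_inner g d E' E'') p"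
    if "smooth_in d S E" "smooth_in d S E'" "smooth_in d S E''" for E E' E''
  proof -
    have "grad_inner g c E (grad_inner g c E' E'') p = grad_inner g c E (grad_inner g d E' E'') p"
      by (rule grad_inner_cong[OF assms(1,3)])
         (intro smooth_in_grad_inner[OF assms(1)] smooth_in_transfer[OF assms(1,2)] that,
          rule grad_inner_transform[OF assms(1,2) _ that(2,3)])
    also have "\<dots> = grad_inner g d E (grad_inner g d E' E'') p"
      by (intro grad_inner_transform[OF assms(1-3)] that smooth_in_grad_inner[OF assms(2)])
    finally show ?thesis .
  qed
  have "u \<bullet> (hessian g c F p *v v) = gradient g d (lin u) p \<bullet> (hessian g d F p *v gradient g d (lin v) p)"
    using hessian_on_gradients[OF assms(1,3) Fc slin[of u] slin[of v]]
      hessian_on_gradients[OF assms(2,3,4) slin'[of u] slin'[of v]]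
      eq[OF slin'[of u] assms(4) slin'[of v]] eq[OF slin'[of v] assms(4) slin'[of u]] eq[OF assms(4) slin'[of u] slin'[of v]]
    by (simp add: glin)
  also have "\<dots> = (transition_jacobian c d p *v u) \<bullet> (hessian g d F p *v (transition_jacobian c d p *v v))"
    by (simp add: gradient_transform[OF assms(1-3) slin'] glin)
  also have "\<dots> = u \<bullet> ((transpose (transition_jacobian c d p) ** hessian g d F p ** transition_jacobian c d p) *v v)"
    by (simp add: inner_transpose_matrix matrix_vector_mul_assoc[symmetric] del: transpose_matrix_vector)
  finally show "u \<bullet> (hessian g c F p *v v)
    = u \<bullet> ((transpose (transition_jacobian c d p) ** hessian g d F p ** transition_jacobian c d p) *v v)" .
qed

lemma double_sum_eq_trace:
  fixes P B :: "real^'n^'n"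
  shows "(\<Sum>i\<in>UNIV. \<Sum>j\<in>UNIV. P $ i $ j * B $ i $ j) = trace (P ** transpose B)"
  by (simp add: trace_def matrix_mult_component transpose_def)

lemma hessian_trace_transform:
  assumes "chart_on c S" "chart_on d S" "p \<in> S" "smooth_in d S F"
  shows "hessian_trace g c F p = hessian_trace g d F p"
proof -
  have cd: "c \<in> A" "d \<in> A" "p \<in> fst c \<inter> fst d" using assms by (auto simp: chart_on_def)
  define J where "J = transition_jacobian c d p"
  define X where "X = ginv g c p ** transpose J ** transpose (hessian g d F p)"
  have "hessian_trace g c F p = trace (X ** J)"
    by (simp add: hessian_trace_def double_sum_eq_trace hessian_transform[OF assms] J_def X_def
        matrix_transpose_mul matrix_mul_assoc)
  also have "\<dots> = trace (J ** X)" by (rule trace_mul_sym)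
  also have "\<dots> = hessian_trace g d F p"
    by (simp add: hessian_trace_def double_sum_eq_trace ginv_transform[OF cd] J_def X_def matrix_mul_assoc)
  finally show ?thesis .
qed

text \<open>The squared norm is the trace of \<open>P B P\<^sup>T B\<^sup>T\<close> with \<open>P = g\<^sup>-\<^sup>1\<close>, and a trace is invariant under cyclic
  permutation of the factors, which brings the two Jacobians together.\<close>

lemma tensor2_norm_transform:
  assumes "c \<in> A" "d \<in> A" "p \<in> fst c \<inter> fst d"
  shows "tensor2_norm g c (transpose (transition_jacobian c d p) ** B ** transition_jacobian c d p) p = tensor2_norm g d B p"
proof -
  have tr: "(\<Sum>i\<in>UNIV. \<Sum>j\<in>UNIV. \<Sum>k\<in>UNIV. \<Sum>l\<in>UNIV. P $ i $ k * P $ j $ l * B $ i $ j * B $ k $ l)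
    = trace (P ** B ** transpose P ** transpose B)" for P B :: "real^'n^'n"
  proof -
    have "trace (P ** B ** transpose P ** transpose B)
        = (\<Sum>i\<in>UNIV. \<Sum>j\<in>UNIV. (\<Sum>l\<in>UNIV. (\<Sum>k\<in>UNIV. P $ i $ k * B $ k $ l) * P $ j $ l) * B $ i $ j)"
      by (simp add: trace_def matrix_mult_component transpose_def)
    also have "\<dots> = (\<Sum>i\<in>UNIV. \<Sum>j\<in>UNIV. \<Sum>l\<in>UNIV. \<Sum>k\<in>UNIV. P $ i $ k * P $ j $ l * B $ i $ j * B $ k $ l)"
      by (simp add: sum_distrib_left sum_distrib_right mult_ac)
    also have "\<dots> = (\<Sum>i\<in>UNIV. \<Sum>j\<in>UNIV. \<Sum>k\<in>UNIV. \<Sum>l\<in>UNIV. P $ i $ k * P $ j $ l * B $ i $ j * B $ k $ l)"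
      by (rule sum.cong[OF refl], rule sum.cong[OF refl], rule sum.swap)
    finally show ?thesis ..
  qed
  define J where "J = transition_jacobian c d p"
  define X where "X = ginv g c p ** transpose J ** B ** J ** transpose (ginv g c p) ** transpose J ** transpose B"
  have "trace (ginv g c p ** (transpose J ** B ** J) ** transpose (ginv g c p) ** transpose (transpose J ** B ** J)) = trace (X ** J)"
    by (simp add: X_def matrix_transpose_mul matrix_mul_assoc)
  also have "\<dots> = trace (J ** X)" by (rule trace_mul_sym)
  also have "\<dots> = trace (ginv g d p ** B ** transpose (ginv g d p) ** transpose B)"
    by (simp add: ginv_transform[OF assms] J_def X_def matrix_transpose_mul matrix_mul_assoc)
  finally show ?thesis by (simp add: tensor2_norm_def tr J_def)
qed

lemma hessian_cong:
  assumes "chart_on c S" "p \<in> S" "smooth_in c S F" "\<And>q. q \<in> S \<Longrightarrow> F q = E q"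
  shows "hessian g c E p = hessian g c F p"
proof -
  have "partial c i (partial c j E) p = partial c i (partial c j F) p" for i j
    by (rule partial_cong[OF assms(1,2) smooth_in_partial[OF assms(1,3)]])
       (use partial_cong[OF assms(1) _ assms(3,4)] in auto)
  then show ?thesis by (simp add: hessian_def partial_cong[OF assms])
qed

lemma hessian_trace_cong:
  assumes "chart_on c S" "p \<in> S" "smooth_in c S F" "\<And>q. q \<in> S \<Longrightarrow> F q = E q"
  shows "hessian_trace g c E p = hessian_trace g c F p"
  by (simp add: hessian_trace_def hessian_cong[OF assms])

subsection \<open>Smooth functions on the manifold\<close>

definition smooth_fun :: "('m \<Rightarrow> real) \<Rightarrow> bool" where
  "smooth_fun F \<longleftrightarrow> (\<forall>c\<in>A. smooth_in c (fst c) F)"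

text \<open>Evaluated, like the scalars of the main statement, in an arbitrarily chosen chart at each point.\<close>

definition inner_grad :: "('m \<Rightarrow> real) \<Rightarrow> ('m \<Rightarrow> real) \<Rightarrow> 'm \<Rightarrow> real" where
  "inner_grad F E p = grad_inner g (chart_at A p) F E p"

lemma chart_at:
  assumes "p \<in> M"
  shows "chart_at A p \<in> A" "p \<in> fst (chart_at A p)"
proof -
  have "\<exists>c. c \<in> A \<and> p \<in> fst c" using assms covers by auto
  then have "chart_at A p \<in> A \<and> p \<in> fst (chart_at A p)" unfolding chart_at_def by (rule someI_ex)
  then show "chart_at A p \<in> A" "p \<in> fst (chart_at A p)" by auto
qed

lemma in_manifold: "c \<in> A \<Longrightarrow> p \<in> fst c \<Longrightarrow> p \<in> M"
  using covers by auto

lemma smooth_funD: "smooth_fun F \<Longrightarrow> c \<in> A \<Longrightarrow> S \<subseteq> fst c \<Longrightarrow> smooth_in c S F"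
  by (auto simp: smooth_fun_def intro: smooth_in_subset)

lemma smooth_funI: "(\<And>c. c \<in> A \<Longrightarrow> smooth_in c (fst c) F) \<Longrightarrow> smooth_fun F"
  by (simp add: smooth_fun_def)

lemma overlap:
  assumes "c \<in> A" "p \<in> fst c"
  defines "d \<equiv> chart_at A p"
  shows "chart_on c (fst c \<inter> fst d)" "chart_on d (fst c \<inter> fst d)" "p \<in> fst c \<inter> fst d" "d \<in> A"
  using assms chart_at[OF in_manifold[OF assms(1,2)]] chart_on_Int[of c d] chart_on_Int[of d c]
  by (auto simp: Int_commute)

lemma inner_grad_chart:
  assumes "c \<in> A" "p \<in> fst c" "smooth_fun F" "smooth_fun E"
  shows "inner_grad F E p = grad_inner g c F E p"
  using overlap[OF assms(1,2)] smooth_funD[OF assms(3)] smooth_funD[OF assms(4)]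
  unfolding inner_grad_def by (metis grad_inner_transform Int_lower2)

lemma laplacian_chart:
  assumes "c \<in> A" "p \<in> fst c" "smooth_fun F"
  shows "laplacian A g F p = hessian_trace g c F p"
proof -
  have "laplacian A g F p = hessian_trace g (chart_at A p) F p"
    by (simp add: laplacian_def hessian_trace_def Let_def)
  then show ?thesis
    using overlap[OF assms(1,2)] smooth_funD[OF assms(3)] by (metis hessian_trace_transform Int_lower2)
qed

lemma grad_norm_sq_eq_inner_grad:
  assumes "p \<in> M"
  shows "grad_norm_sq A g F p = inner_grad F F p"
proof -
  have "differential c F p = g c p *v gradient g c F p" if "c = chart_at A p" for c
    using partial_eq_lower_gradient[OF chart_on_chart] chart_at[OF assms] that
    by (simp add: vec_eq_iff matrix_vector_mult_def)
  then show ?thesis by (simp add: grad_norm_sq_def inner_grad_def grad_inner_eq_inner Let_def)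
qed

lemma hess_minus_metric_norm_chart:
  assumes "c \<in> A" "p \<in> fst c" "smooth_fun F"
  shows "hess_minus_metric_norm A g F s p = tensor2_norm g c (hessian g c F p - s *\<^sub>R g c p) p"
proof -
  define d where "d = chart_at A p"
  note o = overlap[OF assms(1,2), folded d_def]
  define J where "J = transition_jacobian c d p"
  have "hessian g c F p - s *\<^sub>R g c p = transpose J ** hessian g d F p ** J - s *\<^sub>R (transpose J ** g d p ** J)"
    using hessian_transform[OF o(1,2,3) smooth_funD[OF assms(3) o(4)]] metric_transform[OF assms(1) o(4,3)] 
    by (simp add: J_def)
  also have "\<dots> = transpose J ** (hessian g d F p - s *\<^sub>R g d p) ** J"
    by (simp add: vec_eq_iff matrix_mult_component sum_distrib_left sum_distrib_right sum_subtractf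
        left_diff_distrib right_diff_distrib mult_ac)
  finally show ?thesis
    using tensor2_norm_transform[OF assms(1) o(4,3)]
    by (simp add: hess_minus_metric_norm_def Let_def J_def d_def[symmetric])
qed

lemma smooth_fun_cong:
  assumes "smooth_fun F" "\<And>p. p \<in> M \<Longrightarrow> F p = E p"
  shows "smooth_fun E"
proof (rule smooth_funI)
  fix c assume c: "c \<in> A"
  show "smooth_in c (fst c) E"
    by (rule smooth_in_cong[OF chart_on_chart[OF c] smooth_funD[OF assms(1) c order_refl]])
       (use assms(2) in_manifold[OF c] in auto)
qed

lemma smooth_fun_const [simp]: "smooth_fun (\<lambda>_. a)"
  by (simp add: smooth_fun_def)

lemma smooth_fun_add: "smooth_fun F \<Longrightarrow> smooth_fun E \<Longrightarrow> smooth_fun (\<lambda>p. F p + E p)"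
  and smooth_fun_mult: "smooth_fun F \<Longrightarrow> smooth_fun E \<Longrightarrow> smooth_fun (\<lambda>p. F p * E p)"
  and smooth_fun_diff: "smooth_fun F \<Longrightarrow> smooth_fun E \<Longrightarrow> smooth_fun (\<lambda>p. F p - E p)"
  and smooth_fun_minus: "smooth_fun F \<Longrightarrow> smooth_fun (\<lambda>p. - F p)"
  by (auto simp: smooth_fun_def intro: smooth_in_add smooth_in_mult smooth_in_diff smooth_in_minus chart_on_chart)

lemma smooth_fun_sum: "(\<And>i. i \<in> I \<Longrightarrow> smooth_fun (F i)) \<Longrightarrow> smooth_fun (\<lambda>p. \<Sum>i\<in>I. F i p)"
  by (auto simp: smooth_fun_def intro: smooth_in_sum chart_on_chart)

lemma smooth_fun_divide:
  assumes "smooth_fun F" "smooth_fun E" "\<And>p. p \<in> M \<Longrightarrow> E p \<noteq> 0"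
  shows "smooth_fun (\<lambda>p. F p / E p)"
  by (rule smooth_funI, rule smooth_in_divide[OF chart_on_chart])
     (use assms in \<open>auto simp: smooth_funD in_manifold\<close>)

lemma smooth_fun_ln:
  assumes "smooth_fun F" "\<And>p. p \<in> M \<Longrightarrow> F p > 0"
  shows "smooth_fun (\<lambda>p. ln (F p))"
  by (rule smooth_funI, rule smooth_in_compose[OF chart_on_chart _ _ smooth_on_ln])
     (use assms in \<open>auto simp: smooth_funD in_manifold\<close>)

lemma smooth_fun_inner_grad:
  assumes "smooth_fun F" "smooth_fun E"
  shows "smooth_fun (inner_grad F E)"
proof (rule smooth_funI)
  fix c assume c: "c \<in> A"
  show "smooth_in c (fst c) (inner_grad F E)"
    by (rule smooth_in_cong[OF chart_on_chart[OF c] smooth_in_grad_inner[OF chart_on_chart[OF c]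
          smooth_funD[OF assms(1) c order_refl] smooth_funD[OF assms(2) c order_refl]]])
       (simp add: inner_grad_chart[OF c _ assms])
qed

lemma smooth_fun_laplacian:
  assumes "smooth_fun F"
  shows "smooth_fun (laplacian A g F)"
proof (rule smooth_funI)
  fix c assume c: "c \<in> A"
  show "smooth_in c (fst c) (laplacian A g F)"
    by (rule smooth_in_cong[OF chart_on_chart[OF c] smooth_in_hessian_trace[OF chart_on_chart[OF c]
          smooth_funD[OF assms(1) c order_refl]]])
       (simp add: laplacian_chart[OF c _ assms])
qed

lemma smooth_fun_hess_minus_metric_norm_sq:
  assumes "smooth_fun F"
  shows "smooth_fun (\<lambda>p. (hess_minus_metric_norm A g F s p)\<^sup>2)"
proof (rule smooth_funI)
  fix c assume c: "c \<in> A"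
  note D = chart_on_chart[OF c] and F = smooth_funD[OF assms(1) c order_refl]
  have "smooth_in c (fst c) (\<lambda>p. (\<Sum>i\<in>UNIV. \<Sum>k\<in>UNIV. grad_cov g c F i k p * grad_cov g c F k i p)
      - 2 * s * hessian_trace g c F p + s\<^sup>2 * real CARD('n))"
    by (intro smooth_in_add smooth_in_diff smooth_in_mult smooth_in_const smooth_in_sum smooth_in_hessian_trace smooth_in_geometry D F)
  then show "smooth_in c (fst c) (\<lambda>p. (hess_minus_metric_norm A g F s p)\<^sup>2)"
    by (rule smooth_in_cong[OF D])
       (simp add: hess_minus_metric_norm_chart[OF c _ assms] hessian_minus_metric_norm_sq[OF D _ F])
qed

text \<open>Bochner's formula solved for the curvature term. The right-hand side is built from the Laplacian and
  from inner products of gradients alone.\<close>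

lemma ricci_grad_eq:
  assumes "smooth_fun F" "p \<in> M"
  shows "(hess_minus_metric_norm A g F s p)\<^sup>2 + ricci_grad A g F p
    = (1/2) * laplacian A g (inner_grad F F) p - inner_grad F (laplacian A g F) p
      - 2 * s * laplacian A g F p + s\<^sup>2 * real CARD('n)"
proof -
  define c where "c = chart_at A p"
  have c: "c \<in> A" "p \<in> fst c" using chart_at[OF assms(2)] by (auto simp: c_def)
  note D = chart_on_chart[OF c(1)] and F = smooth_funD[OF assms(1) c(1) order_refl]
  have "hessian_trace g c (inner_grad F F) p = hessian_trace g c (grad_inner g c F F) p"
    by (rule hessian_trace_cong[OF D c(2) smooth_in_grad_inner[OF D F F]])
       (simp add: inner_grad_chart[OF c(1) _ assms(1) assms(1)])
  moreover have "grad_inner g c F (laplacian A g F) p = grad_inner g c F (hessian_trace g c F) p"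
    by (rule grad_inner_cong[OF D c(2) smooth_funD[OF smooth_fun_laplacian[OF assms(1)] c(1) order_refl]])
       (simp add: laplacian_chart[OF c(1) _ assms(1)])
  moreover have "ricci_grad A g F p = gradient g c F p \<bullet> (ricci g c p *v gradient g c F p)"
    by (simp add: ricci_grad_def Let_def c_def)
  ultimately show ?thesis
    using bochner[OF D c(2) F]
    by (simp add: hess_minus_metric_norm_chart[OF c assms(1)] hessian_minus_metric_norm_sq[OF D c(2) F]
        laplacian_chart[OF c] inner_grad_chart[OF c] assms(1) smooth_fun_inner_grad smooth_fun_laplacian
        add_divide_distrib)
qed

text \<open>The choice of a chart at each point need not be measurable; it is invariance under changes of charts
  that makes the integrands smooth. For the curvature term the invariance is read off from Bochner's
  formula.\<close>

lemma smooth_fun_ricci_grad: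
  assumes "smooth_fun F"
  shows "smooth_fun (ricci_grad A g F)"
proof (rule smooth_fun_cong)
  show "smooth_fun (\<lambda>p. (1/2) * laplacian A g (inner_grad F F) p - inner_grad F (laplacian A g F) p
      - (hess_minus_metric_norm A g F 0 p)\<^sup>2)"
    by (intro smooth_fun_diff smooth_fun_mult smooth_fun_const smooth_fun_laplacian smooth_fun_inner_grad
        smooth_fun_hess_minus_metric_norm_sq assms)
qed (use ricci_grad_eq[OF assms, of _ 0] in \<open>auto simp: algebra_simps\<close>)

subsection \<open>Algebra of the gradient and the Laplacian\<close>

lemma inner_grad_commute: "p \<in> M \<Longrightarrow> inner_grad F E p = inner_grad E F p"
  unfolding inner_grad_def by (intro grad_inner_commute[OF chart_on_chart]) (auto simp: chart_at)

lemma inner_grad_cong: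
  assumes "p \<in> M" "smooth_fun E" "\<And>q. q \<in> M \<Longrightarrow> E q = E' q"
  shows "inner_grad F E p = inner_grad F E' p"
  unfolding inner_grad_def
  by (rule grad_inner_cong[OF chart_on_chart[OF chart_at(1)[OF assms(1)]] chart_at(2)[OF assms(1)]
        smooth_funD[OF assms(2) chart_at(1)[OF assms(1)] order_refl]])
     (use assms(3) in_manifold[OF chart_at(1)[OF assms(1)]] in auto)

lemma inner_grad_compose:
  fixes h :: "real \<Rightarrow> real"
  assumes "p \<in> M" "smooth_fun E" "(h has_real_derivative h') (at (E p))"
  shows "inner_grad F (\<lambda>q. h (E q)) p = h' * inner_grad F E p"
  unfolding inner_grad_def grad_inner_def
  using partial_compose[OF chart_on_chart[OF chart_at(1)[OF assms(1)]] chart_at(2)[OF assms(1)]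
      smooth_funD[OF assms(2) chart_at(1)[OF assms(1)] order_refl] assms(3)]
  by (simp add: sum_distrib_left mult_ac)

lemma inner_grad_sum:
  assumes "p \<in> M" "\<And>i. i \<in> I \<Longrightarrow> smooth_fun (E i)"
  shows "inner_grad F (\<lambda>q. \<Sum>i\<in>I. E i q) p = (\<Sum>i\<in>I. inner_grad F (E i) p)"
proof -
  have "partial (chart_at A p) k (\<lambda>q. \<Sum>i\<in>I. E i q) p = (\<Sum>i\<in>I. partial (chart_at A p) k (E i) p)" for k
    by (rule partial_sum[OF chart_at(2)[OF assms(1)]])
       (rule smooth_funD[OF assms(2) chart_at(1)[OF assms(1)] order_refl])
  then show ?thesis
    unfolding inner_grad_def grad_inner_def by (simp add: sum_distrib_left) (rule sum.swap)
qed

lemma inner_grad_const [simp]: "inner_grad F (\<lambda>_. a) p = 0"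
  by (simp add: inner_grad_def grad_inner_def)

lemma laplacian_affine:
  assumes "p \<in> M" "smooth_fun F"
  shows "laplacian A g (\<lambda>q. a * F q + b) p = a * laplacian A g F p"
proof -
  define c where "c = chart_at A p"
  have c: "c \<in> A" "p \<in> fst c" using chart_at[OF assms(1)] by (auto simp: c_def)
  note D = chart_on_chart[OF c(1)] and F = smooth_funD[OF assms(2) c(1) order_refl]
  have d: "partial c i (\<lambda>q. a * F q + b) q = a * partial c i F q" if "q \<in> fst c" for i q
    using that by (subst partial_add[OF that smooth_in_mult[OF D smooth_in_const F] smooth_in_const])
      (simp add: partial_cmult[OF D that F])
  have dd: "partial c i (partial c j (\<lambda>q. a * F q + b)) p = a * partial c i (partial c j F) p" for i j
    using partial_cong[OF D c(2) smooth_in_mult[OF D smooth_in_const smooth_in_partial[OF D F]], of a j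
        "partial c j (\<lambda>q. a * F q + b)" i] d
    by (simp add: partial_cmult[OF D c(2) smooth_in_partial[OF D F]])
  have "hessian_trace g c (\<lambda>q. a * F q + b) p = a * hessian_trace g c F p"
    unfolding hessian_trace_def hessian_component dd d[OF c(2)]
    by (simp add: sum_distrib_left right_diff_distrib mult_ac)
  then show ?thesis
    using assms(2) by (simp add: laplacian_chart[OF c] smooth_fun_add smooth_fun_mult)
qed

section \<open>The Riemannian volume\<close>

definition vol_density :: "('m, 'n) chart \<Rightarrow> real^'n \<Rightarrow> real" where
  "vol_density c x = indicator (snd c ` fst c) x *\<^sub>R sqrt (det (g c (chart_inv c x)))"

definition chart_measure :: "('m, 'n) chart \<Rightarrow> (real^'n) measure" where
  "chart_measure c = density lborel (\<lambda>x. ennreal (vol_density c x))"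

lemma closed_M: "closed M" using compact by (rule compact_imp_closed)

lemma borel_iff: "E \<in> sets (restrict_space borel M) \<longleftrightarrow> E \<in> sets borel \<and> E \<subseteq> M"
  using closed_M by (subst sets_restrict_space_iff) auto

lemma chart_domain_borel: "c \<in> A \<Longrightarrow> fst c \<in> sets borel"
  using chart_domain[of c] closed_M by (auto simp: openin_open)

lemma continuous_on_chart_inv: "c \<in> A \<Longrightarrow> continuous_on (snd c ` fst c) (chart_inv c)"
  using chart_homeo[of c] by (simp add: homeomorphism_def)

lemma continuous_on_chart: "c \<in> A \<Longrightarrow> continuous_on (fst c) (snd c)"
  using chart_homeo[of c] by (simp add: homeomorphism_def)

lemma chart_inv_measurable:
  "c \<in> A \<Longrightarrow> chart_inv c \<in> measurable (restrict_space borel (snd c ` fst c)) borel"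
  using continuous_on_chart_inv by (rule borel_measurable_continuous_on_restrict)

lemma chart_image_eq: "c \<in> A \<Longrightarrow> E \<subseteq> fst c \<Longrightarrow> snd c ` E = chart_inv c -` E \<inter> snd c ` fst c"
  using chart_inv_left[of c] by (auto simp: subset_iff)

lemma chart_image_borel:
  assumes "c \<in> A" "E \<in> sets borel" "E \<subseteq> fst c"
  shows "snd c ` E \<in> sets borel"
proof -
  have "chart_inv c -` E \<inter> space (restrict_space borel (snd c ` fst c)) \<in> sets (restrict_space borel (snd c ` fst c))"
    by (rule measurable_sets[OF chart_inv_measurable[OF assms(1)] assms(2)])
  then show ?thesis
    using chart_range[OF assms(1)] by (subst (asm) sets_restrict_space_iff) (auto simp: chart_image_eq[OF assms(1,3)] space_restrict_space)
qed

lemma vol_density_measurable [measurable]: "c \<in> A \<Longrightarrow> vol_density c \<in> borel_measurable borel"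
  unfolding vol_density_def[abs_def]
  using smooth_on_imp_continuous_on[of "snd c ` fst c"] smooth_in_sqrt_det[OF chart_on_chart, of c] chart_range[of c]
  by (intro borel_measurable_continuous_on_indicator) (auto simp: smooth_in_def o_def)

lemma vol_density_nonneg: "c \<in> A \<Longrightarrow> 0 \<le> vol_density c x"
  using metric_det_pos[of c] chart_inv_left[of c] by (auto simp: vol_density_def indicator_def less_imp_le)

lemma vol_density_chart: "c \<in> A \<Longrightarrow> p \<in> fst c \<Longrightarrow> vol_density c (snd c p) = sqrt (det (g c p))"
  by (simp add: vol_density_def chart_inv_left)

lemma emeasure_chart_measure:
  assumes "c \<in> A" "E \<in> sets borel" "E \<subseteq> fst c"
  shows "emeasure (chart_measure c) (snd c ` E) = (\<integral>\<^sup>+x\<in>snd c ` E. ennreal (vol_density c x) \<partial>lborel)"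
  unfolding chart_measure_def using assms chart_image_borel[OF assms] by (intro emeasure_density) auto

lemma sets_chart_measure [simp]: "sets (chart_measure c) = sets borel"
  by (simp add: chart_measure_def)

text \<open>Charts measure a set in the same way on their overlap: the Jacobian of the change of variables
  cancels against the one in the transformation of \<open>det g\<close>.\<close>

lemma chart_measure_change:
  assumes "c \<in> A" "d \<in> A" "E \<in> sets borel" "E \<subseteq> fst c \<inter> fst d"
  shows "emeasure (chart_measure c) (snd c ` E) = emeasure (chart_measure d) (snd d ` E)"
proof -
  have t: "transition c d (snd c p) = snd d p" if "p \<in> E" for p
    using that assms by (auto simp: transition_def chart_inv_left)
  then have img: "transition c d ` snd c ` E = snd d ` E"
    by (simp add: image_image cong: image_cong)
  have "(\<integral>\<^sup>+y\<in>transition c d ` snd c ` E. ennreal (vol_density d y) \<partial>lborel)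
      = (\<integral>\<^sup>+x\<in>snd c ` E. ennreal (vol_density c x) \<partial>lborel)"
  proof (rule nn_integral_change_of_variables)
    show "snd c ` E \<in> sets borel" "transition c d ` snd c ` E \<in> sets borel"
      unfolding img using assms by (auto intro!: chart_image_borel)
    show "(transition c d has_derivative frechet_derivative (transition c d) (at x)) (at x)" if "x \<in> snd c ` E" for x
      using that assms transition_has_derivative[OF assms(1,2)] by auto
    show "inj_on (transition c d) (snd c ` E)"
    proof (rule inj_onI)
      fix x y assume "x \<in> snd c ` E" "y \<in> snd c ` E" and eq: "transition c d x = transition c d y"
      then obtain p q where pq: "p \<in> E" "q \<in> E" "x = snd c p" "y = snd c q" by auto
      then have "snd d p = snd d q" using eq t by simp
      then show "x = y" using inj_on_chart[OF assms(2)] pq assms(4) by (auto dest!: inj_onD)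
    qed
    show "vol_density c x = \<bar>det (matrix (frechet_derivative (transition c d) (at x)))\<bar> * vol_density d (transition c d x)"
      if x: "x \<in> snd c ` E" for x
    proof -
      obtain p where p: "p \<in> E" "x = snd c p" using x by auto
      then have p': "p \<in> fst c \<inter> fst d" using assms by auto
      have "det (g c p) = (det (transition_jacobian c d p))\<^sup>2 * det (g d p)"
        unfolding metric_transform[OF assms(1,2) p'] by (simp add: det_mul power2_eq_square)
      then have "sqrt (det (g c p)) = \<bar>det (transition_jacobian c d p)\<bar> * sqrt (det (g d p))"
        by (simp add: real_sqrt_mult)
      then show ?thesis
        using p p' assms(1,2) by (simp add: t vol_density_chart transition_jacobian_def)
    qed
  qed (use assms in \<open>auto simp: vol_density_nonneg\<close>)
  then show ?thesis
    using assms by (simp add: emeasure_chart_measure img)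
qed

lemma finite_disjoint_chart_cover:
  obtains k :: nat and e :: "nat \<Rightarrow> ('m, 'n) chart" and D :: "nat \<Rightarrow> 'm set"
  where "\<And>i. i < k \<Longrightarrow> e i \<in> A" "\<And>i. i < k \<Longrightarrow> D i \<in> sets borel" "\<And>i. i < k \<Longrightarrow> D i \<subseteq> fst (e i)"
    "disjoint_family_on D {..<k}" "M = (\<Union>i<k. D i)"
proof -
  have "\<exists>D\<subseteq>fst ` A. finite D \<and> M \<subseteq> \<Union>D"
    using compact unfolding compact_eq_openin_cover
    by (elim allE[of _ "fst ` A"]) (use covers chart_domain in auto)
  then obtain A0 where A0: "A0 \<subseteq> A" "finite A0" "M \<subseteq> (\<Union>c\<in>A0. fst c)"
    by (metis finite_subset_image)
  obtain cs where cs: "set cs = A0" using A0(2) finite_list by blast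
  define B where "B = (\<lambda>i. if i < length cs then fst (cs ! i) else {})"
  have B: "B i \<in> sets borel" for i
    using chart_domain_borel[of "cs ! i"] A0(1) cs nth_mem[of i cs] by (auto simp: B_def)
  show thesis
  proof (rule that[of "length cs" "\<lambda>i. cs ! i" "disjointed B"])
    show "cs ! i \<in> A" if "i < length cs" for i using that A0(1) cs nth_mem by blast
    show "disjointed B i \<in> sets borel" for i
      using sets.range_disjointed_sets[of B borel] B by auto
    show "disjointed B i \<subseteq> fst (cs ! i)" if "i < length cs" for i
      using disjointed_subset[of B i] that by (simp add: B_def)
    show "disjoint_family_on (disjointed B) {..<length cs}"
      using disjoint_family_disjointed[of B] by (rule disjoint_family_on_mono[rotated]) simp
    have emp: "disjointed B i = {}" if "\<not> i < length cs" for i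
      using disjointed_subset[of B i] that by (simp add: B_def)
    have "(\<Union>i. B i) = (\<Union>i<length cs. fst (cs ! i))" by (auto simp: B_def split: if_splits)
    also have "\<dots> = (\<Union>c\<in>A0. fst c)"
      by (simp add: cs[symmetric] set_conv_nth) blast
    also have "\<dots> = M" using A0 covers by blast
    finally have "M = (\<Union>i. disjointed B i)" by (simp add: UN_disjointed_eq)
    also have "\<dots> = (\<Union>i<length cs. disjointed B i)" using emp by blast
    finally show "M = (\<Union>i<length cs. disjointed B i)" .
  qed
qed

definition is_volume :: "'m measure \<Rightarrow> bool" where
  "is_volume \<mu> \<longleftrightarrow> sets \<mu> = sets (restrict_space borel M) \<and>
     (\<forall>c\<in>A. \<forall>E\<in>sets (restrict_space borel M). E \<subseteq> fst c \<longrightarrow>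
        emeasure \<mu> E = emeasure (chart_measure c) (snd c ` E))"

text \<open>A finite Borel partition of \<open>M\<close> subordinate to the charts forces the value of the measure, which gives
  uniqueness; summing the chart measures over the pieces gives existence, since by the change of variables this sum
  has the required value on the domain of every other chart.\<close>

lemma volume_exists_unique: "\<exists>!\<mu>. is_volume \<mu>"
proof -
  obtain k and e :: "nat \<Rightarrow> ('m, 'n) chart" and D where
    e: "\<And>i. i < k \<Longrightarrow> e i \<in> A" and D: "\<And>i. i < k \<Longrightarrow> D i \<in> sets borel" "\<And>i. i < k \<Longrightarrow> D i \<subseteq> fst (e i)"
      "disjoint_family_on D {..<k}" "M = (\<Union>i<k. D i)"
    by (rule finite_disjoint_chart_cover) blast
  define m where "m = (\<lambda>E. \<Sum>i<k. emeasure (chart_measure (e i)) (snd (e i) ` (E \<inter> D i)))"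
  have piece: "E \<inter> D i \<in> sets borel" "E \<inter> D i \<subseteq> fst (e i)" "snd (e i) ` (E \<inter> D i) \<in> sets borel"
    if "i < k" "E \<in> sets borel" for E i
    using that D(1,2)[of i] e[of i] by (auto intro!: chart_image_borel)
  have inj: "inj_on (snd (e i)) (D i)" if "i < k" for i
    using inj_on_chart[OF e[OF that]] D(2)[OF that] by (rule inj_on_subset)
  have m_add: "countably_additive (sets (restrict_space borel M)) m"
  proof (rule countably_additiveI)
    fix F :: "nat \<Rightarrow> 'm set"
    assume F: "range F \<subseteq> sets (restrict_space borel M)" "disjoint_family F"
    have Fb: "F j \<in> sets borel" for j using F(1) borel_iff by blast
    have "(\<Sum>j. m (F j)) = (\<Sum>i<k. \<Sum>j. emeasure (chart_measure (e i)) (snd (e i) ` (F j \<inter> D i)))"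
      unfolding m_def by (rule suminf_sum) simp
    also have "\<dots> = (\<Sum>i<k. emeasure (chart_measure (e i)) (\<Union>j. snd (e i) ` (F j \<inter> D i)))"
    proof (rule sum.cong[OF refl], rule suminf_emeasure)
      fix i assume i: "i \<in> {..<k}"
      show "range (\<lambda>j. snd (e i) ` (F j \<inter> D i)) \<subseteq> sets (chart_measure (e i))"
        using piece(3) i Fb by auto
      show "disjoint_family (\<lambda>j. snd (e i) ` (F j \<inter> D i))"
        using F(2) inj[of i] i unfolding disjoint_family_on_def inj_on_def by blast
    qed
    also have "\<dots> = m (\<Union>j. F j)"
      unfolding m_def by (intro sum.cong refl arg_cong2[where f=emeasure]) auto
    finally show "(\<Sum>j. m (F j)) = m (\<Union>j. F j)" .
  qed
  define \<mu> where "\<mu> = measure_of M (sets (restrict_space borel M)) m"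
  have sp: "space (restrict_space borel M) = M" by (simp add: space_restrict_space)
  have s\<mu>: "sets \<mu> = sets (restrict_space borel M)"
    unfolding \<mu>_def using sets.sets_measure_of_eq[of "restrict_space borel M"] sp by simp
  have e\<mu>: "emeasure \<mu> E = m E" if "E \<in> sets (restrict_space borel M)" for E
  proof -
    have "sigma_algebra M (sets (restrict_space borel M))"
      using sets.sigma_algebra_axioms[of "restrict_space borel M"] sp by simp
    then show ?thesis unfolding \<mu>_def
      by (rule emeasure_measure_of_sigma[OF _ _ m_add that]) (simp add: positive_def m_def)
  qed
  have split: "emeasure \<nu> E = m E" if \<nu>: "is_volume \<nu>" and E: "E \<in> sets (restrict_space borel M)" for \<nu> E
  proof -
    have E': "E \<in> sets borel" "E \<subseteq> M" using E borel_iff by auto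
    have p: "E \<inter> D i \<in> sets (restrict_space borel M)" if "i < k" for i
      using piece(1)[OF that E'(1)] E'(2) borel_iff by blast
    have "emeasure \<nu> E = emeasure \<nu> (\<Union>i<k. E \<inter> D i)" using E'(2) D(4) by (intro arg_cong[of _ _ "emeasure \<nu>"]) auto
    also have "\<dots> = (\<Sum>i<k. emeasure \<nu> (E \<inter> D i))"
      using D(3) \<nu> p unfolding is_volume_def
      by (intro sum_emeasure[symmetric]) (auto simp: disjoint_family_on_def)
    also have "\<dots> = m E"
      unfolding m_def using \<nu> p piece(2)[OF _ E'(1)] e unfolding is_volume_def
      by (intro sum.cong refl) auto
    finally show ?thesis .
  qed
  have "is_volume \<mu>"
    unfolding is_volume_def
  proof (intro conjI s\<mu> ballI impI)
    fix c E assume c: "c \<in> A" and E: "E \<in> sets (restrict_space borel M)" "E \<subseteq> fst c"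
    have E': "E \<in> sets borel" "E \<subseteq> M" using E borel_iff by auto
    have "emeasure \<mu> E = (\<Sum>i<k. emeasure (chart_measure c) (snd c ` (E \<inter> D i)))"
      unfolding e\<mu>[OF E(1)] m_def
      by (intro sum.cong refl chart_measure_change) (use e c piece(1,2) E' E(2) in auto)
    also have "\<dots> = emeasure (chart_measure c) (\<Union>i<k. snd c ` (E \<inter> D i))"
    proof (rule sum_emeasure)
      show "(\<lambda>i. snd c ` (E \<inter> D i)) ` {..<k} \<subseteq> sets (chart_measure c)"
        using piece(1) E' E(2) c by (auto intro!: chart_image_borel)
      show "disjoint_family_on (\<lambda>i. snd c ` (E \<inter> D i)) {..<k}"
        using D(3) inj_on_subset[OF inj_on_chart[OF c] E(2)] unfolding disjoint_family_on_def inj_on_def by blast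
    qed simp
    also have "(\<Union>i<k. snd c ` (E \<inter> D i)) = snd c ` E" using E'(2) D(4) by blast
    finally show "emeasure \<mu> E = emeasure (chart_measure c) (snd c ` E)" .
  qed
  moreover have "\<nu> = \<mu>" if "is_volume \<nu>" for \<nu>
    by (rule measure_eqI) (use that \<open>is_volume \<mu>\<close> split in \<open>auto simp: is_volume_def\<close>)
  ultimately show ?thesis by blast
qed

abbreviation "vol \<equiv> riemannian_volume M A g"

lemma is_volume_vol: "is_volume vol"
proof -
  have "emeasure (chart_measure c) (snd c ` E) = (\<integral>\<^sup>+x\<in>snd c ` E. ennreal (sqrt (det (g c (chart_inv c x)))) \<partial>lborel)"
    if "c \<in> A" "E \<in> sets (restrict_space borel M)" "E \<subseteq> fst c" for c E
  proof -
    have "vol_density c x = sqrt (det (g c (chart_inv c x)))" if "x \<in> snd c ` E" for x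
      using that \<open>E \<subseteq> fst c\<close> by (auto simp: vol_density_def)
    then show ?thesis
      using that by (auto simp: emeasure_chart_measure borel_iff indicator_def intro!: nn_integral_cong)
  qed
  then have "vol = (THE \<mu>. is_volume \<mu>)"
    unfolding riemannian_volume_def is_volume_def by (intro arg_cong[of _ _ The] ext) auto
  then show ?thesis using theI'[OF volume_exists_unique] by simp
qed

lemma sets_vol: "sets vol = sets (restrict_space borel M)"
  using is_volume_vol by (simp add: is_volume_def)

lemma space_vol: "space vol = M"
  using sets_eq_imp_space_eq[OF sets_vol] by (simp add: space_restrict_space)

lemma emeasure_vol:
  assumes "c \<in> A" "E \<in> sets borel" "E \<subseteq> fst c"
  shows "emeasure vol E = emeasure (chart_measure c) (snd c ` E)"
proof -
  have "E \<subseteq> M" using assms in_manifold by blast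
  then show ?thesis using is_volume_vol assms by (auto simp: is_volume_def borel_iff)
qed

subsection \<open>Integration of continuous functions\<close>

lemma smooth_fun_imp_continuous_on:
  assumes "smooth_fun F"
  shows "continuous_on M F"
  unfolding continuous_on_eq_continuous_within
proof
  fix p assume p: "p \<in> M"
  define c where "c = chart_at A p"
  have c: "c \<in> A" "p \<in> fst c" using chart_at[OF p] by (auto simp: c_def)
  have "continuous_on (snd c ` fst c) (F \<circ> chart_inv c)"
    using smooth_funD[OF assms c(1) order_refl] unfolding smooth_in_def by (rule smooth_on_imp_continuous_on)
  then have "continuous_on (fst c) (\<lambda>q. (F \<circ> chart_inv c) (snd c q))"
    by (rule continuous_on_compose2[OF _ continuous_on_chart[OF c(1)]]) simp
  then have "continuous_on (fst c) F"
    by (rule continuous_on_eq) (simp add: chart_inv_left[OF c(1)])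
  then have "continuous (at p within fst c) F" using c(2) by (simp add: continuous_on_eq_continuous_within)
  moreover obtain U where U: "open U" "fst c = M \<inter> U" using chart_domain[OF c(1)] by (auto simp: openin_open)
  moreover have "at p within M = at p within fst c"
    by (rule at_within_nhd[of _ U]) (use U c(2) in auto)
  ultimately show "continuous (at p within M) F" by (simp add: continuous_within)
qed

lemma continuous_on_measurable_vol: "continuous_on M F \<Longrightarrow> F \<in> borel_measurable vol"
  using borel_measurable_continuous_on_restrict[of M F] sets_vol measurable_cong_sets by blast

text \<open>Each point has a neighbourhood whose image is a ball on which the density is bounded, and finitely many of
  these cover the compact manifold.\<close>

lemma finite_vol: "emeasure vol M < \<infinity>"
proof -
  have "\<exists>V. openin (top_of_set M) V \<and> p \<in> V \<and> V \<in> sets borel \<and> emeasure vol V < \<infinity>" if p: "p \<in> M" for p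
  proof -
    define c where "c = chart_at A p"
    have c: "c \<in> A" "p \<in> fst c" using chart_at[OF p] by (auto simp: c_def)
    define U where "U = snd c ` fst c"
    obtain r where r: "r > 0" "cball (snd c p) r \<subseteq> U"
      using chart_range[OF c(1)] c(2) open_contains_cball unfolding U_def by blast
    define V where "V = fst c \<inter> snd c -` ball (snd c p) r"
    have Vo: "openin (top_of_set (fst c)) V"
      unfolding V_def by (rule continuous_openin_preimage_gen[OF continuous_on_chart[OF c(1)]]) simp
    have VM: "openin (top_of_set M) V"
      using openin_trans[OF Vo chart_domain[OF c(1)]] .
    then have Vb: "V \<in> sets borel" using closed_M by (auto simp: openin_open)
    have img: "snd c ` V \<subseteq> cball (snd c p) r" by (auto simp: V_def)
    have "continuous_on U (\<lambda>x. sqrt (det (g c (chart_inv c x))))"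
      using smooth_in_sqrt_det[OF chart_on_chart[OF c(1)]] unfolding smooth_in_def o_def U_def
      by (rule smooth_on_imp_continuous_on)
    then have "compact ((\<lambda>x. sqrt (det (g c (chart_inv c x)))) ` cball (snd c p) r)"
      using r(2) by (intro compact_continuous_image) (auto intro: continuous_on_subset)
    then obtain B where "\<And>x. x \<in> cball (snd c p) r \<Longrightarrow> \<bar>sqrt (det (g c (chart_inv c x)))\<bar> \<le> B"
      unfolding compact_eq_bounded_closed bounded_iff real_norm_def by blast
    then have B: "\<And>x. x \<in> cball (snd c p) r \<Longrightarrow> sqrt (det (g c (chart_inv c x))) \<le> B"
      by (meson abs_le_D1)
    have "emeasure vol V = (\<integral>\<^sup>+x\<in>snd c ` V. ennreal (vol_density c x) \<partial>lborel)"
      using emeasure_vol[OF c(1) Vb] emeasure_chart_measure[OF c(1) Vb] by (simp add: V_def)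
    also have "\<dots> \<le> (\<integral>\<^sup>+x. ennreal B * indicator (cball (snd c p) r) x \<partial>lborel)"
      using img B by (intro nn_integral_mono) (auto simp: indicator_def vol_density_def intro!: ennreal_leI)
    also have "\<dots> = ennreal B * emeasure lborel (cball (snd c p) r)"
      by (intro nn_integral_cmult_indicator) auto
    also have "\<dots> < \<infinity>" using emeasure_bounded_finite[of "cball (snd c p) r"] by (simp add: ennreal_mult_less_top)
    finally show ?thesis using VM Vb c r by (intro exI[of _ V]) (auto simp: V_def)
  qed
  then obtain V where V: "\<And>p. p \<in> M \<Longrightarrow> openin (top_of_set M) (V p)" "\<And>p. p \<in> M \<Longrightarrow> p \<in> V p"
    "\<And>p. p \<in> M \<Longrightarrow> V p \<in> sets borel" "\<And>p. p \<in> M \<Longrightarrow> emeasure vol (V p) < \<infinity>" by metis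
  have "\<exists>D\<subseteq>V ` M. finite D \<and> M \<subseteq> \<Union>D"
    using compact unfolding compact_eq_openin_cover
    by (elim allE[of _ "V ` M"]) (use V in auto)
  then obtain K where K: "K \<subseteq> M" "finite K" "M \<subseteq> (\<Union>p\<in>K. V p)"
    by (metis finite_subset_image)
  have VM: "V p \<subseteq> M" if "p \<in> K" for p using V(1) K(1) that openin_imp_subset by blast
  have "emeasure vol M \<le> emeasure vol (\<Union>p\<in>K. V p)"
    using K VM V(3) by (intro emeasure_mono) (auto simp: sets_vol borel_iff intro!: sets.finite_UN)
  also have "\<dots> \<le> (\<Sum>p\<in>K. emeasure vol (V p))"
    using K VM V(3) by (intro emeasure_subadditive_finite) (auto simp: sets_vol borel_iff)
  also have "\<dots> < \<infinity>" using K V(4) by (auto simp: less_top[symmetric] subset_iff)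
  finally show ?thesis .
qed

lemma finite_measure_vol: "finite_measure vol"
  using finite_vol by (intro finite_measureI) (simp add: space_vol)

lemma continuous_on_M_bounded:
  assumes "continuous_on M (F :: 'm \<Rightarrow> real)"
  obtains B :: real where "\<And>p. p \<in> M \<Longrightarrow> \<bar>F p\<bar> \<le> B"
proof -
  have "bounded (F ` M)" using compact_continuous_image[OF assms compact] compact_imp_bounded by blast
  then show thesis using that unfolding bounded_iff by (auto simp: image_iff)
qed

lemma integrable_continuous_on:
  assumes "continuous_on M (F :: 'm \<Rightarrow> real)"
  shows "integrable vol F"
proof -
  obtain B where "\<And>p. p \<in> M \<Longrightarrow> \<bar>F p\<bar> \<le> B" using continuous_on_M_bounded[OF assms] by blast
  then show ?thesis
    by (intro finite_measure.integrable_const_bound[OF finite_measure_vol, of _ B] continuous_on_measurable_vol[OF assms])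
       (auto simp: space_vol)
qed

lemma integrable_smooth: "smooth_fun F \<Longrightarrow> integrable vol F"
  by (intro integrable_continuous_on smooth_fun_imp_continuous_on)

text \<open>On the domain of a chart the volume is the image of the measure with density \<open>sqrt (det g)\<close>.\<close>

lemma integral_vol_chart:
  assumes c: "c \<in> A" and F: "F \<in> borel_measurable vol" "\<And>p. p \<in> M \<Longrightarrow> p \<notin> fst c \<Longrightarrow> F p = (0::real)"
  shows "(LINT p|vol. F p) = (LINT x|lborel. vol_density c x * F (chart_inv c x))"
proof -
  define U where "U = snd c ` fst c"
  have U: "open U" "U \<in> sets borel" using chart_range[OF c] by (auto simp: U_def)
  have cM: "fst c \<subseteq> M" using in_manifold[OF c] by blast
  have csets: "fst c \<in> sets vol" "fst c \<inter> space vol \<in> sets vol" using chart_domain_borel[OF c] cM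
    by (auto simp: sets_vol space_vol borel_iff Int_absorb2)
  define P where "P = restrict_space vol (fst c)"
  define Q where "Q = restrict_space (chart_measure c) U"
  have sP: "E \<in> sets P \<longleftrightarrow> E \<in> sets borel \<and> E \<subseteq> fst c" for E
    unfolding P_def using csets cM by (subst sets_restrict_space_iff) (auto simp: sets_vol borel_iff)
  have spP: "space P = fst c" and spQ: "space Q = U"
    using cM by (auto simp: P_def Q_def space_restrict_space space_vol chart_measure_def)
  have Qs: "sets Q = sets (restrict_space borel U)"
    unfolding Q_def by (rule sets_restrict_space_cong) simp
  have meas: "chart_inv c \<in> measurable Q P"
  proof (rule measurableI)
    show "chart_inv c x \<in> space P" if "x \<in> space Q" for x
      using that by (auto simp: spP spQ U_def chart_inv_left[OF c])
    show "chart_inv c -` E \<inter> space Q \<in> sets Q" if "E \<in> sets P" for E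
      using measurable_sets[OF chart_inv_measurable[OF c], of E] that sP Qs
      by (simp add: spQ space_restrict_space U_def)
  qed
  have PQ: "P = distr Q P (chart_inv c)"
  proof (rule measure_eqI)
    fix E assume E: "E \<in> sets P"
    then have E': "E \<in> sets borel" "E \<subseteq> fst c" using sP by auto
    have "emeasure P E = emeasure vol E"
      unfolding P_def using csets E' cM by (intro emeasure_restrict_space) auto
    also have "\<dots> = emeasure (chart_measure c) (chart_inv c -` E \<inter> U)"
      by (simp add: emeasure_vol[OF c E'] chart_image_eq[OF c E'(2)] U_def)
    also have "\<dots> = emeasure Q (chart_inv c -` E \<inter> space Q)"
      unfolding spQ unfolding Q_def using U by (intro emeasure_restrict_space[symmetric]) auto
    also have "\<dots> = emeasure (distr Q P (chart_inv c)) E"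
      using meas E by (simp add: emeasure_distr)
    finally show "emeasure P E = emeasure (distr Q P (chart_inv c)) E" .
  qed simp
  have FP: "F \<in> borel_measurable P" unfolding P_def by (rule measurable_restrict_space1[OF F(1)])
  have FQ: "(\<lambda>x. F (chart_inv c x)) \<in> borel_measurable Q" using measurable_compose[OF meas FP] .
  then have FI: "(\<lambda>x. indicator U x *\<^sub>R F (chart_inv c x)) \<in> borel_measurable borel"
    using U by (subst borel_measurable_restrict_space_iff[symmetric]) (simp_all cong: measurable_cong_sets add: Qs)
  have "(LINT p|vol. F p) = (LINT p|vol. indicator (fst c) p *\<^sub>R F p)"
    using F(2) by (intro Bochner_Integration.integral_cong) (auto simp: space_vol indicator_def)
  also have "\<dots> = (LINT p|P. F p)"
    unfolding P_def using csets cM by (intro integral_restrict_space[symmetric]) auto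
  also have "\<dots> = (LINT x|Q. F (chart_inv c x))"
    by (subst PQ) (rule integral_distr[OF meas FP])
  also have "\<dots> = (LINT x|chart_measure c. indicator U x *\<^sub>R F (chart_inv c x))"
    unfolding Q_def using U by (intro integral_restrict_space) auto
  also have "\<dots> = (LINT x|lborel. vol_density c x *\<^sub>R (indicator U x *\<^sub>R F (chart_inv c x)))"
    unfolding chart_measure_def using FI vol_density_measurable[OF c] vol_density_nonneg[OF c]
    by (intro integral_density) auto
  also have "\<dots> = (LINT x|lborel. vol_density c x * F (chart_inv c x))"
    by (intro Bochner_Integration.integral_cong) (auto simp: vol_density_def U_def indicator_def)
  finally show ?thesis .
qed

end

section \<open>Green's formula\<close>

text \<open>The integral of a directional derivative is the limit of the integrals of the difference
  quotients, which vanish by translation invariance.\<close>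

lemma integral_frechet_derivative_compact_support:
  fixes f :: "'a::euclidean_space \<Rightarrow> real"
  assumes f: "smooth_on UNIV f" and K: "compact K" "\<And>x. x \<notin> K \<Longrightarrow> f x = 0"
  shows "integrable lborel (\<lambda>x. frechet_derivative f (at x) e)"
    and "(LINT x|lborel. frechet_derivative f (at x) e) = 0"
proof -
  define f' where "f' = (\<lambda>x. frechet_derivative f (at x) e)"
  have cont: "continuous_on UNIV f" "continuous_on UNIV f'"
    unfolding f'_def by (intro smooth_on_imp_continuous_on smooth_on_frechet_derivative f)+
  have int: "integrable lborel h" if "continuous_on UNIV h" "\<And>x. x \<notin> K \<Longrightarrow> h x = 0" for h :: "'a \<Rightarrow> real"
  proof -
    have "integrable lborel (\<lambda>x. indicator K x *\<^sub>R h x)"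
      using borel_integrable_compact[OF K(1)] continuous_on_subset[OF that(1)] by blast
    moreover have "(\<lambda>x. indicator K x *\<^sub>R h x) = h" using that(2) by (intro ext) (auto simp: indicator_def)
    ultimately show ?thesis by simp
  qed
  have f'0: "f' x = 0" if "x \<notin> K" for x
  proof -
    have "(f has_derivative (\<lambda>_. 0)) (at x)"
      by (rule has_derivative_transform_within_open[OF has_derivative_const, where s = "- K"])
         (use K that compact_imp_closed in \<open>auto simp: open_Compl\<close>)
    then show ?thesis by (simp add: f'_def frechet_derivative_eqI)
  qed
  show intf': "integrable lborel (\<lambda>x. frechet_derivative f (at x) e)"
    using int[OF cont(2) f'0] by (simp add: f'_def)
  have meas: "f \<in> borel_measurable borel" "f' \<in> borel_measurable borel"
    using cont by (auto intro: borel_measurable_continuous_onI)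
  have "bounded (f' ` K)"
    using compact_continuous_image[OF continuous_on_subset[OF cont(2)] K(1)] compact_imp_bounded by blast
  then obtain B0 where B0: "\<And>x. x \<in> K \<Longrightarrow> \<bar>f' x\<bar> \<le> B0" unfolding bounded_iff by auto
  define B where "B = \<bar>B0\<bar>"
  have B: "\<bar>f' x\<bar> \<le> B" for x using B0[of x] f'0[of x] by (cases "x \<in> K") (auto simp: B_def)
  obtain R where R: "\<And>x. x \<in> K \<Longrightarrow> norm x \<le> R" using compact_imp_bounded[OF K(1)] unfolding bounded_iff by auto
  define s where "s = (\<lambda>k. 1 / real (Suc k))"
  have s: "0 < s k" "s k \<le> 1" for k by (auto simp: s_def)
  have s0: "s \<longlonglongrightarrow> 0" unfolding s_def by (rule LIMSEQ_inverse_real_of_nat[unfolded inverse_eq_divide])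
  define q where "q = (\<lambda>k x. (f (x + s k *\<^sub>R e) - f x) / s k)"
  have line: "((\<lambda>r. f (x + r *\<^sub>R e)) has_real_derivative f' (x + r *\<^sub>R e)) (at r)" for x r
    unfolding f'_def by (rule smooth_on_has_real_derivative_line[OF f]) simp
  have lim: "(\<lambda>k. q k x) \<longlonglongrightarrow> f' x" for x
  proof -
    have "((\<lambda>h. (f (x + h *\<^sub>R e) - f x) / h) \<longlongrightarrow> f' x) (at 0)"
      using line[of x 0] unfolding DERIV_def by simp
    moreover have "filterlim s (at 0) sequentially"
      using s0 s(1) by (auto simp: filterlim_at intro!: always_eventually less_imp_neq[THEN not_sym])
    ultimately show ?thesis unfolding q_def by (rule filterlim_compose)
  qed
  have bound: "\<bar>q k x\<bar> \<le> indicator (cball 0 (R + norm e)) x * B" for k x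
  proof (cases "x \<in> cball 0 (R + norm e)")
    case True
    obtain z where "f (x + s k *\<^sub>R e) - f (x + 0 *\<^sub>R e) = (s k - 0) * f' (x + z *\<^sub>R e)"
      using MVT2[OF s(1)[of k] line[of x]] by blast
    then have "q k x = f' (x + z *\<^sub>R e)" using s(1)[of k] by (simp add: q_def)
    then show ?thesis using True B by simp
  next
    case False
    then have "norm x > R + norm e" by simp
    moreover have "norm x \<le> norm (x + s k *\<^sub>R e) + norm (s k *\<^sub>R e)"
      using norm_triangle_ineq4[of "x + s k *\<^sub>R e" "s k *\<^sub>R e"] by simp
    moreover have "norm (s k *\<^sub>R e) \<le> norm e" using s[of k] by (simp add: mult_left_le_one_le)
    ultimately have "x \<notin> K" "x + s k *\<^sub>R e \<notin> K" using R[of x] R[of "x + s k *\<^sub>R e"] norm_ge_zero[of e] by auto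
    then show ?thesis using K(2) False by (simp add: q_def)
  qed
  have "(\<lambda>k. LINT x|lborel. q k x) \<longlonglongrightarrow> (LINT x|lborel. f' x)"
  proof (rule integral_dominated_convergence[where w = "\<lambda>x. indicator (cball 0 (R + norm e)) x * B"])
    show "integrable lborel (\<lambda>x. indicator (cball 0 (R + norm e)) x * B :: real)"
      using borel_integrable_compact[OF compact_cball continuous_on_const, of 0 "R + norm e" B] by simp
  qed (use meas lim bound in \<open>auto simp: q_def\<close>)
  moreover have "(LINT x|lborel. q k x) = 0" for k
  proof -
    have i1: "integrable lborel f" by (rule int[OF cont(1) K(2)])
    have "integrable (distr lborel borel ((+) (s k *\<^sub>R e))) f" using i1 by (simp add: lborel_distr_plus)
    then have i2: "integrable lborel (\<lambda>x. f (x + s k *\<^sub>R e))"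
      using meas by (subst (asm) integrable_distr_eq) (auto simp: add.commute)
    have "(LINT x|lborel. f x) = (LINT x|distr lborel borel ((+) (s k *\<^sub>R e)). f x)" by (simp add: lborel_distr_plus)
    also have "\<dots> = (LINT x|lborel. f (x + s k *\<^sub>R e))"
      using meas by (subst integral_distr) (auto simp: add.commute)
    finally show ?thesis unfolding q_def using i1 i2 by simp
  qed
  ultimately show "(LINT x|lborel. frechet_derivative f (at x) e) = 0"
    by (simp add: LIMSEQ_const_iff f'_def)
qed

context closed_riemannian_manifold
begin

lemma chart_on_Diff_compact:
  assumes "d \<in> A" "compact K"
  shows "chart_on d (fst d - K)"
proof (rule chart_on_openin[OF assms(1)])
  have "fst d - K = fst d \<inter> (M - K)" using in_manifold[OF assms(1)] by auto
  moreover have "openin (top_of_set M) (M - K)"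
    using compact_imp_closed[OF assms(2)] by (auto simp: openin_open intro!: exI[of _ "- K"])
  ultimately show "openin (top_of_set M) (fst d - K)" using chart_domain[OF assms(1)] by auto
qed auto

lemma inner_grad_eq_0:
  assumes "compact K" "\<And>q. q \<in> M \<Longrightarrow> q \<notin> K \<Longrightarrow> F q = 0" "p \<in> M" "p \<notin> K"
  shows "inner_grad b F p = 0"
proof -
  define d where "d = chart_at A p"
  have d: "d \<in> A" "p \<in> fst d" using chart_at[OF assms(3)] by (auto simp: d_def)
  have "grad_inner g d b (\<lambda>_. 0) p = grad_inner g d b F p"
    by (rule grad_inner_cong[OF chart_on_Diff_compact[OF d(1) assms(1)]])
       (use d assms in_manifold[OF d(1)] in auto)
  then show ?thesis by (simp add: inner_grad_def d_def[symmetric]) (simp add: grad_inner_def)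
qed

text \<open>The divergence theorem for \<open>\<psi> \<nabla>b\<close> supported in one chart: times the density, the divergence is a Euclidean
  one, and the field extends by zero to a smooth field of compact support.\<close>

lemma green_chart:
  assumes c: "c \<in> A" and \<psi>: "smooth_fun \<psi>" and b: "smooth_fun b"
    and K: "compact K" "K \<subseteq> fst c" "\<And>p. p \<in> M \<Longrightarrow> p \<notin> K \<Longrightarrow> \<psi> p = 0"
  shows "(LINT p|vol. \<psi> p * laplacian A g b p + inner_grad b \<psi> p) = 0"
proof -
  define U where "U = snd c ` fst c"
  define K' where "K' = snd c ` K"
  have U: "open U" using chart_range[OF c] by (simp add: U_def)
  have K': "compact K'" "K' \<subseteq> U" "closed K'"
    using K(1,2) compact_continuous_image[OF continuous_on_subset[OF continuous_on_chart[OF c] K(2)]]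
    by (auto simp: K'_def U_def intro: compact_imp_closed)
  note D = chart_on_chart[OF c]
  note \<psi>c = smooth_funD[OF \<psi> c order_refl] and bc = smooth_funD[OF b c order_refl]
  let ?F = "\<lambda>p. \<psi> p * laplacian A g b p + inner_grad b \<psi> p"
  define w where "w = (\<lambda>i q. sqrt (det (g c q)) * (\<psi> q * gradient g c b q $ i))"
  have sw: "smooth_in c (fst c) (w i)" for i
    unfolding w_def by (intro smooth_in_mult smooth_in_sqrt_det smooth_in_gradient D \<psi>c bc)
  \<comment> \<open>The vector field \<open>sqrt (det g) \<psi> \<nabla>b\<close> on the whole Euclidean space; it vanishes off the compact set \<open>K'\<close>.\<close>
  define V where "V = (\<lambda>i x. if x \<in> U then w i (chart_inv c x) else 0)"
  have V0: "V i x = 0" if "x \<notin> K'" for i x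
  proof (cases "x \<in> U")
    case True
    then obtain p where p: "p \<in> fst c" "x = snd c p" by (auto simp: U_def)
    then have "\<psi> p = 0" using K(3) that in_manifold[OF c] by (auto simp: K'_def)
    then show ?thesis using p by (simp add: V_def w_def chart_inv_left[OF c])
  qed (simp add: V_def)
  have V: "smooth_on UNIV (V i)" for i
  proof (rule smooth_on_local)
    fix x
    show "\<exists>T. open T \<and> x \<in> T \<and> smooth_on T (V i)"
    proof (cases "x \<in> U")
      case True
      have "smooth_on U (V i)"
        using sw[of i] unfolding smooth_in_def U_def[symmetric]
        by (rule smooth_on_cong[OF U, THEN iffD1, rotated]) (auto simp: V_def)
      then show ?thesis using U True by blast
    next
      case False
      have "open (- K')" using K' by (simp add: open_Compl)
      moreover from this have "smooth_on (- K') (V i)"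
        by (rule smooth_on_cong[THEN iffD2, OF _ _ smooth_on_const]) (use V0 in auto)
      ultimately show ?thesis using False K' by blast
    qed
  qed
  have eq: "vol_density c x * ?F (chart_inv c x) = (\<Sum>i\<in>UNIV. frechet_derivative (V i) (at x) (axis i 1))" for x
  proof (cases "x \<in> U")
    case True
    then obtain p where p: "p \<in> fst c" "x = snd c p" by (auto simp: U_def)
    have "frechet_derivative (V i) (at x) (axis i 1) = partial c i (w i) p" for i
    proof -
      have "(V i has_derivative frechet_derivative (w i \<circ> chart_inv c) (at x)) (at x)"
        using smooth_in_has_derivative[OF p(1) sw[of i]] unfolding p(2)[symmetric]
        by (rule has_derivative_transform_within_open[OF _ U True]) (simp add: V_def)
      then show ?thesis by (simp add: frechet_derivative_eqI partial_def p(2))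
    qed
    then show ?thesis
      using divergence_form[OF D p(1) \<psi>c bc]
      by (simp add: p chart_inv_left[OF c] vol_density_chart[OF c] w_def laplacian_chart[OF c p(1) b]
          inner_grad_chart[OF c p(1) b \<psi>])
  next
    case False
    have "frechet_derivative (V i) (at x) (axis i 1) = 0" for i
    proof -
      have "(V i has_derivative (\<lambda>_. 0)) (at x)"
        by (rule has_derivative_transform_within_open[OF has_derivative_const, where s = "- K'"])
           (use K' False V0 in \<open>auto simp: open_Compl\<close>)
      then show ?thesis by (simp add: frechet_derivative_eqI)
    qed
    then show ?thesis using False by (simp add: vol_density_def U_def)
  qed
  have sF: "smooth_fun ?F" by (intro smooth_fun_add smooth_fun_mult smooth_fun_laplacian smooth_fun_inner_grad \<psi> b)
  have F0: "?F p = 0" if "p \<in> M" "p \<notin> fst c" for p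
  proof -
    have "p \<notin> K" using that K(2) by auto
    then show ?thesis using inner_grad_eq_0[of K \<psi> p b] K(1,3) that(1) by simp
  qed
  have "(LINT p|vol. ?F p) = (LINT x|lborel. vol_density c x * ?F (chart_inv c x))"
    by (rule integral_vol_chart[OF c continuous_on_measurable_vol[OF smooth_fun_imp_continuous_on[OF sF]]])
       (rule F0)
  also have "\<dots> = (\<Sum>i\<in>UNIV. LINT x|lborel. frechet_derivative (V i) (at x) (axis i 1))"
    unfolding eq by (rule Bochner_Integration.integral_sum)
      (rule integral_frechet_derivative_compact_support(1)[OF V K'(1) V0])
  also have "\<dots> = 0"
    by (simp add: integral_frechet_derivative_compact_support(2)[OF V K'(1) V0])
  finally show ?thesis .
qed

subsection \<open>Partition of unity\<close>

lemma smooth_in_localI: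
  assumes "\<And>q. q \<in> S \<Longrightarrow> \<exists>T. q \<in> T \<and> chart_on c T \<and> smooth_in c T F"
  shows "smooth_in c S F"
  unfolding smooth_in_def
proof (rule smooth_on_local)
  fix x assume "x \<in> snd c ` S"
  then obtain q where q: "q \<in> S" "x = snd c q" by auto
  then show "\<exists>T. open T \<and> x \<in> T \<and> smooth_on T (F \<circ> chart_inv c)"
    using assms[OF q(1)] chart_on_open unfolding smooth_in_def by blast
qed

text \<open>The flat exponential of \<open>r\<^sup>2 - \<bar>x - x\<^sub>0\<bar>\<^sup>2\<close> in a chart, extended by zero; the extension is smooth because it
  vanishes off a compact subset of the domain of the chart.\<close>

lemma bump_function:
  assumes p: "p \<in> M"
  obtains c K b where "c \<in> A" "compact K" "K \<subseteq> fst c" "smooth_fun b" "\<And>q. 0 \<le> b q" "0 < b p"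
    "\<And>q. q \<notin> K \<Longrightarrow> b q = 0"
proof -
  define c where "c = chart_at A p"
  have c: "c \<in> A" "p \<in> fst c" using chart_at[OF p] by (auto simp: c_def)
  define U where "U = snd c ` fst c"
  obtain r where r: "r > 0" "cball (snd c p) r \<subseteq> U"
    using chart_range[OF c(1)] c(2) open_contains_cball unfolding U_def by blast
  define K where "K = chart_inv c ` cball (snd c p) r"
  have K: "compact K" "K \<subseteq> fst c"
    using r(2) continuous_on_chart_inv[OF c(1)] chart_inv_left[OF c(1)]
    by (auto simp: K_def U_def intro!: compact_continuous_image intro: continuous_on_subset)
  define h where "h = (\<lambda>x. flat_exp 0 (r\<^sup>2 - (\<Sum>i\<in>UNIV. (x $ i - snd c p $ i) * (x $ i - snd c p $ i))))"
  have dist_sq: "(\<Sum>i\<in>UNIV. (x $ i - snd c p $ i) * (x $ i - snd c p $ i)) = (dist (snd c p) x)\<^sup>2" for x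
    by (simp add: dist_norm norm_minus_commute[of "snd c p"] power2_norm_eq_inner inner_vec_def)
  have h: "smooth_on UNIV h"
    unfolding h_def
  proof (rule smooth_on_compose[OF open_UNIV open_UNIV _ _ smooth_on_flat_exp])
    have "smooth_on UNIV (\<lambda>x::real^'n. x $ i)" for i
      by (intro smooth_on_linear bounded_linear_vec_nth) simp
    then show "smooth_on UNIV (\<lambda>x::real^'n. r\<^sup>2 - (\<Sum>i\<in>UNIV. (x $ i - snd c p $ i) * (x $ i - snd c p $ i)))"
      by (intro smooth_on_diff smooth_on_sum smooth_on_mult smooth_on_const) auto
  qed auto
  define b where "b = (\<lambda>q. if q \<in> fst c then h (snd c q) else 0)"
  have b0: "b q = 0" if "q \<notin> K" for q
  proof (cases "q \<in> fst c")
    case True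
    have "snd c q \<notin> cball (snd c p) r"
    proof
      assume "snd c q \<in> cball (snd c p) r"
      then have "chart_inv c (snd c q) \<in> K" unfolding K_def by (rule imageI)
      then show False using that by (simp add: chart_inv_left[OF c(1) True])
    qed
    then have "r < dist (snd c p) (snd c q)" by simp
    then have "r\<^sup>2 \<le> (dist (snd c p) (snd c q))\<^sup>2" using r(1) by (intro power_mono) auto
    then show ?thesis using True by (simp add: b_def h_def dist_sq flat_exp_def)
  qed (simp add: b_def)
  have bc: "smooth_in c (fst c) b"
    unfolding smooth_in_def
    by (rule smooth_on_cong[OF chart_range[OF c(1)], THEN iffD2, OF _ smooth_on_subset[OF h]])
       (auto simp: b_def chart_inv_left[OF c(1)])
  have "smooth_fun b"
  proof (rule smooth_funI, rule smooth_in_localI)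
    fix d q assume d: "d \<in> A" and q: "q \<in> fst d"
    show "\<exists>T. q \<in> T \<and> chart_on d T \<and> smooth_in d T b"
    proof (cases "q \<in> fst c")
      case True
      have T: "chart_on c (fst c \<inter> fst d)" "chart_on d (fst c \<inter> fst d)"
        using chart_on_Int[OF c(1) d] chart_on_Int[OF d c(1)] by (simp_all add: Int_commute)
      have "smooth_in d (fst c \<inter> fst d) b"
        by (rule smooth_in_transfer[OF T(2,1) smooth_in_subset[OF bc]]) simp
      then show ?thesis using T True q by blast
    next
      case False
      have "smooth_in d (fst d - K) b"
        by (rule smooth_in_cong[OF chart_on_Diff_compact[OF d K(1)] smooth_in_const[of _ _ 0]]) (simp add: b0)
      then show ?thesis using chart_on_Diff_compact[OF d K(1)] False K(2) q by blast
    qed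
  qed
  moreover have "0 \<le> b q" for q by (simp add: b_def h_def flat_exp_def)
  moreover have "0 < b p" using c r by (simp add: b_def h_def flat_exp_def)
  ultimately show thesis using that c(1) K b0 by blast
qed

text \<open>Finitely many bump functions have a positive sum on the compact manifold, by which they are divided.\<close>

lemma partition_of_unity:
  obtains P :: "'m set" and \<eta> c K where "finite P" "\<And>p. p \<in> P \<Longrightarrow> c p \<in> A" "\<And>p. p \<in> P \<Longrightarrow> compact (K p)"
    "\<And>p. p \<in> P \<Longrightarrow> K p \<subseteq> fst (c p)" "\<And>p. p \<in> P \<Longrightarrow> smooth_fun (\<eta> p)"
    "\<And>p q. p \<in> P \<Longrightarrow> q \<notin> K p \<Longrightarrow> \<eta> p q = 0" "\<And>q. q \<in> M \<Longrightarrow> (\<Sum>p\<in>P. \<eta> p q) = 1"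
proof -
  have "\<exists>t. fst t \<in> A \<and> compact (fst (snd t)) \<and> fst (snd t) \<subseteq> fst (fst t) \<and> smooth_fun (snd (snd t))
      \<and> (\<forall>q. 0 \<le> snd (snd t) q) \<and> 0 < snd (snd t) p \<and> (\<forall>q. q \<notin> fst (snd t) \<longrightarrow> snd (snd t) q = 0)"
    if "p \<in> M" for p
    by (rule bump_function[OF that]) (rule exI[of _ "(c, K, b)" for c K b], auto)
  then obtain t where t: "\<And>p. p \<in> M \<Longrightarrow> fst (t p) \<in> A \<and> compact (fst (snd (t p)))
      \<and> fst (snd (t p)) \<subseteq> fst (fst (t p)) \<and> smooth_fun (snd (snd (t p)))
      \<and> (\<forall>q. 0 \<le> snd (snd (t p)) q) \<and> 0 < snd (snd (t p)) p \<and> (\<forall>q. q \<notin> fst (snd (t p)) \<longrightarrow> snd (snd (t p)) q = 0)"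
    by metis
  define c K b where "c = (\<lambda>p. fst (t p))" and "K = (\<lambda>p. fst (snd (t p)))" and "b = (\<lambda>p. snd (snd (t p)))"
  have *: "\<And>p. p \<in> M \<Longrightarrow> c p \<in> A" "\<And>p. p \<in> M \<Longrightarrow> compact (K p)" "\<And>p. p \<in> M \<Longrightarrow> K p \<subseteq> fst (c p)"
    "\<And>p. p \<in> M \<Longrightarrow> smooth_fun (b p)" "\<And>p q. p \<in> M \<Longrightarrow> 0 \<le> b p q" "\<And>p. p \<in> M \<Longrightarrow> 0 < b p p"
    "\<And>p q. p \<in> M \<Longrightarrow> q \<notin> K p \<Longrightarrow> b p q = 0"
    using t unfolding c_def K_def b_def by blast+
  define W where "W = (\<lambda>p. M \<inter> b p -` {0<..})"
  have "openin (top_of_set M) (W p)" if "p \<in> M" for p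
    unfolding W_def
    by (rule continuous_openin_preimage_gen[OF smooth_fun_imp_continuous_on[OF *(4)[OF that]]]) simp
  then have "\<exists>D\<subseteq>W ` M. finite D \<and> M \<subseteq> \<Union>D"
    using compact *(6) unfolding compact_eq_openin_cover
    by (elim allE[of _ "W ` M"]) (auto simp: W_def)
  then obtain P where P: "P \<subseteq> M" "finite P" "M \<subseteq> (\<Union>p\<in>P. W p)"
    by (metis finite_subset_image)
  define B where "B = (\<lambda>q. \<Sum>p\<in>P. b p q)"
  have B: "B q > 0" if q: "q \<in> M" for q
  proof -
    obtain p where "p \<in> P" "b p q > 0" using q P(3) by (auto simp: W_def)
    then show ?thesis unfolding B_def using P(1) *(5)[of _ q] by (intro sum_pos2[OF P(2)]) auto
  qed
  have sB: "smooth_fun B" unfolding B_def using *(4) P(1) by (intro smooth_fun_sum) auto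
  show thesis
  proof (rule that[of P c K "\<lambda>p q. b p q / B q"])
    show "smooth_fun (\<lambda>q. b p q / B q)" if "p \<in> P" for p
      using that P(1) *(4) B by (intro smooth_fun_divide sB) (auto simp: less_imp_neq[THEN not_sym])
    show "(\<Sum>p\<in>P. b p q / B q) = 1" if "q \<in> M" for q
      using B[OF that] by (simp add: sum_divide_distrib[symmetric] B_def)
    show "K p \<subseteq> fst (c p)" if "p \<in> P" for p using that P(1) *(3) by blast
  qed (use P * in auto)
qed

text \<open>Each \<open>\<eta>\<^sub>p \<psi>\<close> of a partition of unity is supported in one chart, and both integrands are linear in \<open>\<psi>\<close>.\<close>

theorem green:
  assumes \<psi>: "smooth_fun \<psi>" and b: "smooth_fun b"
  shows "(LINT p|vol. \<psi> p * laplacian A g b p) = - (LINT p|vol. inner_grad b \<psi> p)"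
proof -
  obtain P :: "'m set" and \<eta> c K where pu: "finite P" "\<And>p. p \<in> P \<Longrightarrow> c p \<in> A" "\<And>p. p \<in> P \<Longrightarrow> compact (K p)"
    "\<And>p. p \<in> P \<Longrightarrow> K p \<subseteq> fst (c p)" "\<And>p. p \<in> P \<Longrightarrow> smooth_fun (\<eta> p)"
    "\<And>p q. p \<in> P \<Longrightarrow> q \<notin> K p \<Longrightarrow> \<eta> p q = 0" "\<And>q. q \<in> M \<Longrightarrow> (\<Sum>p\<in>P. \<eta> p q) = 1"
    by (rule partition_of_unity) blast
  let ?\<psi> = "\<lambda>p q. \<eta> p q * \<psi> q"
  let ?F = "\<lambda>\<psi> q. \<psi> q * laplacian A g b q + inner_grad b \<psi> q"
  have s: "smooth_fun (?\<psi> p)" if "p \<in> P" for p using pu(5)[OF that] \<psi> by (rule smooth_fun_mult)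
  have sF: "smooth_fun (?F \<phi>)" if "smooth_fun \<phi>" for \<phi>
    by (intro smooth_fun_add smooth_fun_mult smooth_fun_laplacian smooth_fun_inner_grad that b)
  have split: "?F \<psi> q = (\<Sum>p\<in>P. ?F (?\<psi> p) q)" if q: "q \<in> M" for q
  proof -
    have e: "\<psi> q' = (\<Sum>p\<in>P. ?\<psi> p q')" if "q' \<in> M" for q'
      by (simp add: sum_distrib_right[symmetric] pu(7)[OF that])
    have "inner_grad b \<psi> q = (\<Sum>p\<in>P. inner_grad b (?\<psi> p) q)"
      using inner_grad_cong[OF q \<psi> e] inner_grad_sum[OF q s] by simp
    moreover have "\<psi> q * laplacian A g b q = (\<Sum>p\<in>P. ?\<psi> p q * laplacian A g b q)"
      by (subst e[OF q]) (simp add: sum_distrib_right)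
    ultimately show ?thesis by (simp add: sum.distrib)
  qed
  have "(LINT q|vol. ?F \<psi> q) = (LINT q|vol. (\<Sum>p\<in>P. ?F (?\<psi> p) q))"
    using split by (intro Bochner_Integration.integral_cong) (auto simp: space_vol)
  also have "\<dots> = (\<Sum>p\<in>P. LINT q|vol. ?F (?\<psi> p) q)"
    by (rule Bochner_Integration.integral_sum) (rule integrable_smooth[OF sF[OF s]])
  also have "\<dots> = 0"
  proof (intro sum.neutral ballI)
    fix p assume p: "p \<in> P"
    show "(LINT q|vol. ?F (?\<psi> p) q) = 0"
      by (rule green_chart[OF pu(2)[OF p] s[OF p] b pu(3)[OF p] pu(4)[OF p]]) (simp add: pu(6)[OF p])
  qed
  finally show ?thesis
    by (subst (asm) Bochner_Integration.integral_add)
       (auto intro!: integrable_smooth smooth_fun_mult smooth_fun_laplacian smooth_fun_inner_grad \<psi> b)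
qed

corollary integral_laplacian: "smooth_fun b \<Longrightarrow> (LINT p|vol. laplacian A g b p) = 0"
  using green[of "\<lambda>_. 1" b] by simp

corollary green_symmetric:
  assumes "smooth_fun a" "smooth_fun b"
  shows "(LINT p|vol. a p * laplacian A g b p) = (LINT p|vol. b p * laplacian A g a p)"
  unfolding green[OF assms] green[OF assms(2,1)]
  by (intro arg_cong[of _ _ uminus] Bochner_Integration.integral_cong) (auto simp: space_vol inner_grad_commute)

end

section \<open>Functions of time and space\<close>

definition time_deriv :: "(real \<Rightarrow> 'm \<Rightarrow> real) \<Rightarrow> real \<Rightarrow> 'm \<Rightarrow> real" where
  "time_deriv h t p = deriv (\<lambda>s. h s p) t"

context closed_riemannian_manifold
begin

definition in_chart :: "('m, 'n) chart \<Rightarrow> (real \<Rightarrow> 'm \<Rightarrow> real) \<Rightarrow> (real^'n) \<times> real \<Rightarrow> real" where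
  "in_chart c h z = h (snd z) (chart_inv c (fst z))"

lemma smooth_spacetime_iff:
  "smooth_spacetime A J h \<longleftrightarrow> (\<forall>c\<in>A. smooth_on (snd c ` fst c \<times> J) (in_chart c h))"
proof -
  have "in_chart c h = (\<lambda>(x, t). h t (chart_inv c x))" for c by (auto simp: in_chart_def fun_eq_iff)
  then show ?thesis by (simp add: smooth_spacetime_def)
qed

lemma smooth_spacetimeD:
  "smooth_spacetime A J h \<Longrightarrow> c \<in> A \<Longrightarrow> smooth_on (snd c ` fst c \<times> J) (in_chart c h)"
  by (simp add: smooth_spacetime_iff)

lemma open_chart_times: "c \<in> A \<Longrightarrow> open J \<Longrightarrow> open (snd c ` fst c \<times> J)"
  by (intro open_Times chart_range)

lemma in_chart_at: "c \<in> A \<Longrightarrow> p \<in> fst c \<Longrightarrow> in_chart c h (snd c p, t) = h t p"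
  by (simp add: in_chart_def chart_inv_left)

lemma smooth_spacetime_mult:
  assumes "open J" "smooth_spacetime A J h" "smooth_spacetime A J k"
  shows "smooth_spacetime A J (\<lambda>t p. h t p * k t p)"
  using assms smooth_on_mult[OF open_chart_times[OF _ assms(1)]]
  unfolding smooth_spacetime_iff in_chart_def[abs_def] by simp

lemma smooth_spacetime_divide:
  assumes "open J" "smooth_spacetime A J h" "smooth_spacetime A J k" "\<And>t p. t \<in> J \<Longrightarrow> p \<in> M \<Longrightarrow> k t p \<noteq> 0"
  shows "smooth_spacetime A J (\<lambda>t p. h t p / k t p)"
  unfolding smooth_spacetime_iff
proof
  fix c assume c: "c \<in> A"
  have "smooth_on (snd c ` fst c \<times> J) (\<lambda>z. in_chart c h z / in_chart c k z)"
    by (rule smooth_on_divide[OF open_chart_times[OF c assms(1)] smooth_spacetimeD[OF assms(2) c] smooth_spacetimeD[OF assms(3) c]])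
       (use assms(4) in_manifold[OF c] in \<open>auto simp: in_chart_at[OF c]\<close>)
  then show "smooth_on (snd c ` fst c \<times> J) (in_chart c (\<lambda>t p. h t p / k t p))"
    by (simp add: in_chart_def[abs_def])
qed

lemma smooth_spacetime_ln:
  assumes "open J" "smooth_spacetime A J h" "\<And>t p. t \<in> J \<Longrightarrow> p \<in> M \<Longrightarrow> h t p > 0"
  shows "smooth_spacetime A J (\<lambda>t p. ln (h t p))"
  unfolding smooth_spacetime_iff
proof
  fix c assume c: "c \<in> A"
  have "smooth_on (snd c ` fst c \<times> J) (\<lambda>z. ln (in_chart c h z))"
    by (rule smooth_on_compose[OF open_chart_times[OF c assms(1)] open_greaterThan[of 0] _ smooth_spacetimeD[OF assms(2) c] smooth_on_ln])
       (use assms(3) in_manifold[OF c] in \<open>auto simp: in_chart_at[OF c]\<close>)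
  then show "smooth_on (snd c ` fst c \<times> J) (in_chart c (\<lambda>t p. ln (h t p)))"
    by (simp add: in_chart_def[abs_def])
qed

lemma smooth_spacetime_imp_smooth_fun:
  assumes "open J" "smooth_spacetime A J h" "t \<in> J"
  shows "smooth_fun (h t)"
proof (rule smooth_funI)
  fix c assume c: "c \<in> A"
  have bl: "bounded_linear (\<lambda>x::real^'n. (x, 0::real))"
    by (intro bounded_linear_Pair bounded_linear_ident bounded_linear_zero)
  have "smooth_on (snd c ` fst c) (\<lambda>x. (x, 0) + (0, t))"
    by (intro smooth_on_add smooth_on_linear[OF _ bl] smooth_on_const chart_range c)
  then have "smooth_on (snd c ` fst c) (\<lambda>x. (x, t))" by simp
  then have "smooth_on (snd c ` fst c) (\<lambda>x. in_chart c h (x, t))"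
    by (rule smooth_on_compose[OF chart_range[OF c] open_chart_times[OF c assms(1)] _ _ smooth_spacetimeD[OF assms(2) c], rotated])
       (use assms(3) in auto)
  then show "smooth_in c (fst c) (h t)" by (simp add: smooth_in_def o_def in_chart_def)
qed

lemma has_time_derivative:
  assumes "smooth_spacetime A J h" "c \<in> A" "p \<in> fst c" "t \<in> J"
  shows "((\<lambda>s. h s p) has_real_derivative frechet_derivative (in_chart c h) (at (snd c p, t)) (0, 1)) (at t)"
  using smooth_on_has_real_derivative_line[OF smooth_spacetimeD[OF assms(1,2)], of "(snd c p, 0)" t "(0, 1)"] assms
  by (simp add: in_chart_at)

lemma time_deriv_chart:
  assumes "smooth_spacetime A J h" "c \<in> A" "p \<in> fst c" "t \<in> J"
  shows "time_deriv h t p = frechet_derivative (in_chart c h) (at (snd c p, t)) (0, 1)"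
  unfolding time_deriv_def by (rule DERIV_imp_deriv[OF has_time_derivative[OF assms]])

lemma has_time_deriv:
  assumes "smooth_spacetime A J h" "p \<in> M" "t \<in> J"
  shows "((\<lambda>s. h s p) has_real_derivative time_deriv h t p) (at t)"
  using has_time_derivative[OF assms(1) chart_at[OF assms(2)] assms(3)]
    time_deriv_chart[OF assms(1) chart_at[OF assms(2)] assms(3)] by simp

lemma in_chart_time_deriv:
  assumes "smooth_spacetime A J h" "c \<in> A" "z \<in> snd c ` fst c \<times> J"
  shows "in_chart c (time_deriv h) z = frechet_derivative (in_chart c h) (at z) (0, 1)"
  using assms time_deriv_chart[OF assms(1,2)] by (auto simp: in_chart_at)

lemma smooth_spacetime_time_deriv:
  assumes "open J" "smooth_spacetime A J h"
  shows "smooth_spacetime A J (time_deriv h)"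
  unfolding smooth_spacetime_iff
proof
  fix c assume c: "c \<in> A"
  show "smooth_on (snd c ` fst c \<times> J) (in_chart c (time_deriv h))"
    by (rule smooth_on_cong[OF open_chart_times[OF c assms(1)], THEN iffD2, OF in_chart_time_deriv[OF assms(2) c]
          smooth_on_frechet_derivative[OF smooth_spacetimeD[OF assms(2) c]]])
qed

lemma partial_spacetime:
  assumes "smooth_spacetime A J h" "c \<in> A" "p \<in> fst c" "t \<in> J"
  shows "partial c i (h t) p = frechet_derivative (in_chart c h) (at (snd c p, t)) (axis i 1, 0)"
proof -
  have "((\<lambda>x. (x, t)) has_derivative (\<lambda>v. (v, 0))) (at (snd c p))"
    by (intro has_derivative_Pair has_derivative_ident has_derivative_const)
  from has_derivative_compose[OF this smooth_on_has_derivative[OF smooth_spacetimeD[OF assms(1,2)]]]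
  have "((\<lambda>x. in_chart c h (x, t)) has_derivative
      (\<lambda>v. frechet_derivative (in_chart c h) (at (snd c p, t)) (v, 0))) (at (snd c p))"
    using assms(3,4) by auto
  then show ?thesis
    by (simp add: partial_def o_def in_chart_def frechet_derivative_eqI)
qed

text \<open>By Schwarz's theorem on the product of the chart with the time interval.\<close>

lemma has_time_derivative_partial:
  assumes "open J" "smooth_spacetime A J h" "c \<in> A" "p \<in> fst c" "t \<in> J"
  shows "((\<lambda>s. partial c i (h s) p) has_real_derivative partial c i (time_deriv h t) p) (at t)"
proof -
  define S where "S = snd c ` fst c \<times> J"
  define H where "H = in_chart c h"
  have S: "open S" "(snd c p, t) \<in> S" unfolding S_def using open_chart_times[OF assms(3,1)] assms by auto
  have H: "smooth_on S H" using smooth_spacetimeD[OF assms(2,3)] by (simp add: S_def H_def)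
  have "((\<lambda>s. frechet_derivative H (at ((snd c p, 0) + s *\<^sub>R (0, 1))) (axis i 1, 0)) has_real_derivative
     frechet_derivative (\<lambda>z. frechet_derivative H (at z) (axis i 1, 0)) (at ((snd c p, 0) + t *\<^sub>R (0, 1))) (0, 1)) (at t)"
    by (rule smooth_on_has_real_derivative_line[OF smooth_on_frechet_derivative[OF H]]) (use S in simp)
  then have d: "((\<lambda>s. frechet_derivative H (at (snd c p, s)) (axis i 1, 0)) has_real_derivative
     frechet_derivative (\<lambda>z. frechet_derivative H (at z) (axis i 1, 0)) (at (snd c p, t)) (0, 1)) (at t)"
    by simp
  have "(in_chart c (time_deriv h) has_derivative
      frechet_derivative (\<lambda>z. frechet_derivative H (at z) (0, 1)) (at (snd c p, t))) (at (snd c p, t))"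
    by (rule has_derivative_transform_within_open[OF smooth_on_has_derivative[OF smooth_on_frechet_derivative[OF H] S(2)] S])
       (use in_chart_time_deriv[OF assms(2,3)] in \<open>simp add: S_def H_def\<close>)
  then have "partial c i (time_deriv h t) p
      = frechet_derivative (\<lambda>z. frechet_derivative H (at z) (0, 1)) (at (snd c p, t)) (axis i 1, 0)"
    by (simp add: partial_spacetime[OF smooth_spacetime_time_deriv[OF assms(1,2)] assms(3-5)] frechet_derivative_eqI)
  also have "\<dots> = frechet_derivative (\<lambda>z. frechet_derivative H (at z) (axis i 1, 0)) (at (snd c p, t)) (0, 1)"
    by (rule frechet_derivative_commute[OF S(1) H S(2)])
  finally have "((\<lambda>s. frechet_derivative H (at (snd c p, s)) (axis i 1, 0)) has_real_derivative partial c i (time_deriv h t) p) (at t)"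
    using d by simp
  then show ?thesis
    by (rule has_field_derivative_transform_within_open[OF _ assms(1,5)])
       (simp add: partial_spacetime[OF assms(2-4)] H_def)
qed

lemma smooth_spacetime_inner_grad:
  assumes "open J" "smooth_spacetime A J h" "smooth_spacetime A J k"
  shows "smooth_spacetime A J (\<lambda>t. inner_grad (h t) (k t))"
  unfolding smooth_spacetime_iff
proof
  fix c assume c: "c \<in> A"
  let ?S = "snd c ` fst c \<times> J"
  note S = open_chart_times[OF c assms(1)]
  have gi: "smooth_on ?S (\<lambda>z. ginv g c (chart_inv c (fst z)) $ i $ j)" for i j
  proof (rule smooth_on_compose[OF S chart_range[OF c], where g = fst])
    show "smooth_on (snd c ` fst c) (\<lambda>x. ginv g c (chart_inv c x) $ i $ j)"
      using smooth_in_ginv[OF chart_on_chart[OF c]] by (simp add: smooth_in_def o_def)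
  qed (auto intro!: smooth_on_linear[OF S] bounded_linear_fst)
  have "smooth_on ?S (\<lambda>z. \<Sum>i\<in>UNIV. (\<Sum>j\<in>UNIV. ginv g c (chart_inv c (fst z)) $ i $ j *
      frechet_derivative (in_chart c h) (at z) (axis j 1, 0)) * frechet_derivative (in_chart c k) (at z) (axis i 1, 0))"
    by (intro smooth_on_sum smooth_on_mult gi S smooth_on_frechet_derivative smooth_spacetimeD[OF _ c] assms)
  then show "smooth_on ?S (in_chart c (\<lambda>t. inner_grad (h t) (k t)))"
  proof (rule smooth_on_cong[OF S, THEN iffD1, rotated])
    fix z assume "z \<in> ?S"
    then obtain p t where z: "z = (snd c p, t)" "p \<in> fst c" "t \<in> J" by auto
    have "inner_grad (h t) (k t) p = grad_inner g c (h t) (k t) p"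
      using assms z c by (intro inner_grad_chart smooth_spacetime_imp_smooth_fun[of J]) auto
    then show "(\<Sum>i\<in>UNIV. (\<Sum>j\<in>UNIV. ginv g c (chart_inv c (fst z)) $ i $ j *
      frechet_derivative (in_chart c h) (at z) (axis j 1, 0)) * frechet_derivative (in_chart c k) (at z) (axis i 1, 0))
      = in_chart c (\<lambda>t. inner_grad (h t) (k t)) z"
      by (simp add: z in_chart_at[OF c] grad_inner_def gradient_component chart_inv_left[OF c]
          partial_spacetime[OF assms(2) c] partial_spacetime[OF assms(3) c])
  qed
qed

text \<open>The metric is fixed, so only the differential of the function depends on time.\<close>

lemma has_time_derivative_inner_grad:
  assumes "open J" "smooth_spacetime A J h" "p \<in> M" "t \<in> J"
  shows "((\<lambda>s. inner_grad (h s) (h s) p) has_real_derivative 2 * inner_grad (h t) (time_deriv h t) p) (at t)"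
proof -
  define c where "c = chart_at A p"
  have c: "c \<in> A" "p \<in> fst c" using chart_at[OF assms(3)] by (auto simp: c_def)
  have "((\<lambda>s. \<Sum>i\<in>UNIV. (\<Sum>j\<in>UNIV. ginv g c p $ i $ j * partial c j (h s) p) * partial c i (h s) p)
    has_real_derivative (\<Sum>i\<in>UNIV. (\<Sum>j\<in>UNIV. ginv g c p $ i $ j * partial c j (time_deriv h t) p) * partial c i (h t) p
      + partial c i (time_deriv h t) p * (\<Sum>j\<in>UNIV. ginv g c p $ i $ j * partial c j (h t) p))) (at t)"
    by (intro DERIV_sum DERIV_mult DERIV_cmult has_time_derivative_partial[OF assms(1,2) c assms(4)])
  also have "(\<lambda>s. \<Sum>i\<in>UNIV. (\<Sum>j\<in>UNIV. ginv g c p $ i $ j * partial c j (h s) p) * partial c i (h s) p)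
     = (\<lambda>s. inner_grad (h s) (h s) p)"
    by (simp add: inner_grad_def c_def[symmetric] grad_inner_def gradient_component)
  also have "(\<Sum>i\<in>UNIV. (\<Sum>j\<in>UNIV. ginv g c p $ i $ j * partial c j (time_deriv h t) p) * partial c i (h t) p
      + partial c i (time_deriv h t) p * (\<Sum>j\<in>UNIV. ginv g c p $ i $ j * partial c j (h t) p))
     = inner_grad (time_deriv h t) (h t) p + inner_grad (h t) (time_deriv h t) p"
    by (simp add: inner_grad_def c_def[symmetric] grad_inner_def gradient_component sum.distrib mult.commute)
  finally show ?thesis by (simp add: inner_grad_commute[OF assms(3), of "time_deriv h t"])
qed

lemma smooth_spacetime_continuous_on:
  assumes "smooth_spacetime A J h"
  shows "continuous_on (M \<times> J) (\<lambda>z. h (snd z) (fst z))"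
  unfolding continuous_on_eq_continuous_within
proof
  fix z assume "z \<in> M \<times> J"
  then obtain p t where z: "z = (p, t)" "p \<in> M" "t \<in> J" by auto
  define c where "c = chart_at A p"
  have c: "c \<in> A" "p \<in> fst c" using chart_at[OF z(2)] by (auto simp: c_def)
  have "continuous_on (fst c \<times> J) (\<lambda>z. in_chart c h (snd c (fst z), snd z))"
    by (rule continuous_on_compose2[OF smooth_on_imp_continuous_on[OF smooth_spacetimeD[OF assms c(1)]]])
       (auto intro!: continuous_intros continuous_on_compose2[OF continuous_on_chart[OF c(1)]])
  then have "continuous_on (fst c \<times> J) (\<lambda>z. h (snd z) (fst z))"
    by (rule continuous_on_eq) (auto simp: in_chart_at[OF c(1)])
  then have "continuous (at z within fst c \<times> J) (\<lambda>z. h (snd z) (fst z))"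
    using c(2) z by (simp add: continuous_on_eq_continuous_within)
  moreover obtain V where V: "open V" "fst c = M \<inter> V" using chart_domain[OF c(1)] by (auto simp: openin_open)
  moreover have "at z within M \<times> J = at z within fst c \<times> J"
    by (rule at_within_nhd[of _ "V \<times> UNIV"]) (use V c(2) z in \<open>auto intro!: open_Times\<close>)
  ultimately show "continuous (at z within M \<times> J) (\<lambda>z. h (snd z) (fst z))" by (simp add: continuous_within)
qed

text \<open>Differentiation under the integral, by dominated convergence: on the compact set
  \<open>M \<times> [t - \<delta>, t + \<delta>]\<close> the difference quotients are bounded by the maximum of the time derivative.\<close>

lemma has_real_derivative_integral_spacetime:
  assumes J: "open J" and h: "smooth_spacetime A J h" and t: "t \<in> J"
  shows "((\<lambda>s. LINT p|vol. h s p) has_real_derivative (LINT p|vol. time_deriv h t p)) (at t)"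
proof -
  obtain \<delta> where \<delta>: "\<delta> > 0" "cball t \<delta> \<subseteq> J" using J t open_contains_cball by blast
  have "continuous_on (M \<times> cball t \<delta>) (\<lambda>z. time_deriv h (snd z) (fst z))"
    by (rule continuous_on_subset[OF smooth_spacetime_continuous_on[OF smooth_spacetime_time_deriv[OF J h]]])
       (use \<delta>(2) in auto)
  then have "bounded ((\<lambda>z. time_deriv h (snd z) (fst z)) ` (M \<times> cball t \<delta>))"
    by (intro compact_imp_bounded compact_continuous_image compact_Times compact) auto
  then obtain B where "\<forall>x\<in>(\<lambda>z. time_deriv h (snd z) (fst z)) ` (M \<times> cball t \<delta>). \<bar>x\<bar> \<le> B"
    unfolding bounded_iff real_norm_def by blast
  then have B: "\<bar>time_deriv h s p\<bar> \<le> B" if "p \<in> M" "s \<in> cball t \<delta>" for s p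
    using that by (auto dest!: bspec[of _ _ "time_deriv h s p"] intro!: image_eqI[of _ _ "(p, s)"])
  have sm: "smooth_fun (h s)" if "s \<in> cball t \<delta>" for s
    using smooth_spacetime_imp_smooth_fun[OF J h] that \<delta>(2) by auto
  define q where "q = (\<lambda>e p. (h (t + e) p - h t p) / e)"
  have q: "\<bar>q e p\<bar> \<le> B" if p: "p \<in> M" and e: "e \<noteq> 0" "\<bar>e\<bar> < \<delta>" for e p
  proof -
    have d: "((\<lambda>s. h s p) has_real_derivative time_deriv h s p) (at s)" if "s \<in> cball t \<delta>" for s
      using has_time_deriv[OF h p] that \<delta>(2) by auto
    have "\<exists>z\<in>cball t \<delta>. q e p = time_deriv h z p"
    proof (cases "e > 0")
      case True
      obtain z where "t < z" "z < t + e" "h (t + e) p - h t p = (t + e - t) * time_deriv h z p"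
        using MVT2[of t "t + e" "\<lambda>s. h s p" "\<lambda>s. time_deriv h s p"] d True e(2) by (auto simp: dist_real_def)
      then show ?thesis using True e(2) by (intro bexI[of _ z]) (auto simp: q_def dist_real_def)
    next
      case False
      then have "e < 0" using e(1) by simp
      obtain z where "t + e < z" "z < t" "h t p - h (t + e) p = (t - (t + e)) * time_deriv h z p"
        using MVT2[of "t + e" t "\<lambda>s. h s p" "\<lambda>s. time_deriv h s p"] d \<open>e < 0\<close> e(2) by (auto simp: dist_real_def)
      then show ?thesis using \<open>e < 0\<close> e(2) by (intro bexI[of _ z]) (auto simp: q_def dist_real_def field_simps)
    qed
    then show ?thesis using B[OF p] by auto
  qed
  have "((\<lambda>e. LINT p|vol. q e p) \<longlongrightarrow> (LINT p|vol. time_deriv h t p)) (at 0)"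
    unfolding tendsto_at_iff_sequentially
  proof (intro allI impI)
    fix X :: "nat \<Rightarrow> real" assume X: "\<forall>i. X i \<in> UNIV - {0}" "X \<longlonglongrightarrow> 0"
    then obtain N where N: "\<And>i. i \<ge> N \<Longrightarrow> \<bar>X i\<bar> < \<delta>"
      using \<delta>(1) unfolding LIMSEQ_iff by fastforce
    have "(\<lambda>i. LINT p|vol. q (X (i + N)) p) \<longlonglongrightarrow> (LINT p|vol. time_deriv h t p)"
    proof (rule integral_dominated_convergence[where w = "\<lambda>_. B"])
      show "integrable vol (\<lambda>_. B)" by (rule finite_measure.integrable_const[OF finite_measure_vol])
      show "(\<lambda>p. time_deriv h t p) \<in> borel_measurable vol"
        by (intro continuous_on_measurable_vol smooth_fun_imp_continuous_on
            smooth_spacetime_imp_smooth_fun[OF J smooth_spacetime_time_deriv[OF J h] t])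
      show "(\<lambda>p. q (X (i + N)) p) \<in> borel_measurable vol" for i
      proof -
        have "smooth_fun (\<lambda>p. (h (t + X (i + N)) p - h t p) / X (i + N))"
          using N[of "i + N"] X(1) \<delta>(1)
          by (intro smooth_fun_divide smooth_fun_diff sm smooth_fun_const) (auto simp: dist_real_def)
        then show ?thesis unfolding q_def by (intro continuous_on_measurable_vol smooth_fun_imp_continuous_on)
      qed
      have "(\<lambda>i. q (X (i + N)) p) \<longlonglongrightarrow> time_deriv h t p" if p: "p \<in> M" for p
      proof -
        have "((\<lambda>e. q e p) \<longlongrightarrow> time_deriv h t p) (at 0)"
          using has_time_deriv[OF h p t] unfolding DERIV_def q_def .
        then have "(\<lambda>i. q (X i) p) \<longlonglongrightarrow> time_deriv h t p"
          using X unfolding tendsto_at_iff_sequentially by (auto simp: o_def)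
        then show ?thesis by (rule LIMSEQ_ignore_initial_segment)
      qed
      then show "AE p in vol. (\<lambda>i. q (X (i + N)) p) \<longlonglongrightarrow> time_deriv h t p"
        by (intro AE_I2) (simp add: space_vol)
      show "AE p in vol. norm (q (X (i + N)) p) \<le> B" for i
        using q[of _ "X (i + N)"] N[of "i + N"] X(1) by (intro AE_I2) (auto simp: space_vol)
    qed
    then show "((\<lambda>e. LINT p|vol. q e p) \<circ> X) \<longlonglongrightarrow> (LINT p|vol. time_deriv h t p)"
      unfolding o_def by (rule LIMSEQ_offset)
  qed
  moreover have "\<forall>\<^sub>F e in at 0. (LINT p|vol. q e p) = ((LINT p|vol. h (t + e) p) - (LINT p|vol. h t p)) / e"
  proof -
    have "(LINT p|vol. q e p) = ((LINT p|vol. h (t + e) p) - (LINT p|vol. h t p)) / e" if "\<bar>e\<bar> < \<delta>" for e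
      unfolding q_def using that \<delta>(1) integrable_smooth[OF sm] by (simp add: dist_real_def)
    then show ?thesis using \<delta>(1) by (auto simp: eventually_at intro!: exI[of _ \<delta>])
  qed
  ultimately show ?thesis unfolding DERIV_def by (rule Lim_transform_eventually)
qed

end

section \<open>The entropy of a positive solution of the heat equation\<close>

lemma (in closed_riemannian_manifold) laplacian_cong:
  assumes "p \<in> M" "smooth_fun F" "\<And>q. q \<in> M \<Longrightarrow> F q = E q"
  shows "laplacian A g E p = laplacian A g F p"
proof -
  define c where "c = chart_at A p"
  have c: "c \<in> A" "p \<in> fst c" using chart_at[OF assms(1)] by (auto simp: c_def)
  have "hessian_trace g c E p = hessian_trace g c F p"
    by (rule hessian_trace_cong[OF chart_on_chart[OF c(1)] c(2) smooth_funD[OF assms(2) c(1) order_refl]])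
       (use assms(3) in_manifold[OF c(1)] in auto)
  then show ?thesis
    using laplacian_chart[OF c assms(2)] laplacian_chart[OF c smooth_fun_cong[OF assms(2,3)]] by simp
qed

locale positive_heat_solution = closed_riemannian_manifold M A g
  for M :: "'m::t2_space set" and A :: "('m, 'n::finite) chart set" and g :: "('m, 'n) metric" +
  fixes J :: "real set" and u :: "real \<Rightarrow> 'm \<Rightarrow> real"
  assumes open_J: "open J"
    and u_smooth: "smooth_spacetime A J u"
    and u_pos: "\<And>t p. t \<in> J \<Longrightarrow> p \<in> M \<Longrightarrow> u t p > 0"
    and heat: "\<And>t p. t \<in> J \<Longrightarrow> p \<in> M \<Longrightarrow> time_deriv u t p = laplacian A g (u t) p"
    and mass: "\<And>t. t \<in> J \<Longrightarrow> (LINT p|riemannian_volume M A g. u t p) = 1"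
begin

definition fisher_information :: "real \<Rightarrow> real" where
  "fisher_information t = (LINT p|vol. inner_grad (u t) (u t) p / u t p)"

definition shannon_entropy :: "real \<Rightarrow> real" where
  "shannon_entropy t = (LINT p|vol. - (u t p * ln (u t p)))"

abbreviation log_u :: "real \<Rightarrow> 'm \<Rightarrow> real" where
  "log_u t \<equiv> (\<lambda>p. ln (u t p))"

lemma smooth_u: "t \<in> J \<Longrightarrow> smooth_fun (u t)"
  by (rule smooth_spacetime_imp_smooth_fun[OF open_J u_smooth])

lemma smooth_log_u: "t \<in> J \<Longrightarrow> smooth_fun (log_u t)"
  by (intro smooth_fun_ln smooth_u u_pos)

lemma inner_grad_log_u:
  assumes "t \<in> J" "p \<in> M"
  shows "inner_grad F (log_u t) p = inner_grad F (u t) p / u t p"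
  using inner_grad_compose[OF assms(2) smooth_u[OF assms(1)] DERIV_ln[OF u_pos[OF assms]]]
  by (simp add: divide_inverse mult.commute)

lemma inner_grad_log_u':
  assumes "t \<in> J" "p \<in> M"
  shows "inner_grad (log_u t) F p = inner_grad (u t) F p / u t p"
  using inner_grad_log_u[OF assms] inner_grad_commute[OF assms(2)] by metis

lemma fisher_information_eq: "t \<in> J \<Longrightarrow> fisher_information t = (LINT p|vol. inner_grad (u t) (log_u t) p)"
  unfolding fisher_information_def by (intro Bochner_Integration.integral_cong) (auto simp: space_vol inner_grad_log_u)

lemma has_real_derivative_u:
  assumes "t \<in> J" "p \<in> M"
  shows "((\<lambda>s. u s p) has_real_derivative laplacian A g (u t) p) (at t)"
  using has_time_deriv[OF u_smooth assms(2,1)] heat[OF assms] by simp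

text \<open>The entropy grows at the rate of the Fisher information: differentiate \<open>- u ln u\<close>, insert the heat
  equation and integrate by parts.\<close>

lemma has_real_derivative_shannon_entropy:
  assumes t: "t \<in> J"
  shows "(shannon_entropy has_real_derivative fisher_information t) (at t)"
proof -
  let ?h = "\<lambda>t p. u t p * ln (u t p)" and ?L = "laplacian A g (u t)"
  have h: "smooth_spacetime A J ?h"
    by (intro smooth_spacetime_mult smooth_spacetime_ln open_J u_smooth u_pos)
  have L: "smooth_fun ?L" by (intro smooth_fun_laplacian smooth_u t)
  have "time_deriv ?h t p = log_u t p * ?L p + ?L p" if p: "p \<in> M" for p
  proof -
    have "((\<lambda>s. ?h s p) has_real_derivative log_u t p * ?L p + ?L p) (at t)"
      using u_pos[OF t p] by (auto intro!: derivative_eq_intros has_real_derivative_u[OF t p] simp: field_simps)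
    then show ?thesis unfolding time_deriv_def by (rule DERIV_imp_deriv)
  qed
  then have "(LINT p|vol. time_deriv ?h t p) = (LINT p|vol. log_u t p * ?L p + ?L p)"
    by (intro Bochner_Integration.integral_cong) (auto simp: space_vol)
  also have "\<dots> = (LINT p|vol. log_u t p * ?L p) + (LINT p|vol. ?L p)"
    by (intro Bochner_Integration.integral_add integrable_smooth smooth_fun_mult smooth_log_u L t)
  also have "\<dots> = - fisher_information t"
    by (simp add: green[OF smooth_log_u[OF t] smooth_u[OF t]] integral_laplacian[OF smooth_u[OF t]] fisher_information_eq[OF t])
  finally have "((\<lambda>s. LINT p|vol. ?h s p) has_real_derivative - fisher_information t) (at t)"
    using has_real_derivative_integral_spacetime[OF open_J h t] by simp
  from DERIV_minus[OF this] show ?thesis by (simp add: shannon_entropy_def[abs_def])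
qed

text \<open>Differentiating \<open>\<bar>\<nabla>u\<bar>\<^sup>2 / u\<close> in time gives \<open>2 \<langle>\<nabla>w, \<nabla>\<Delta>u\<rangle> - \<bar>\<nabla>w\<bar>\<^sup>2 \<Delta>u\<close> with \<open>w = ln u\<close>; both terms are then
  integrated by parts.\<close>

lemma has_real_derivative_fisher_information:
  assumes t: "t \<in> J"
  shows "(fisher_information has_real_derivative
    - 2 * (LINT p|vol. laplacian A g (u t) p * laplacian A g (log_u t) p)
    - (LINT p|vol. u t p * laplacian A g (inner_grad (log_u t) (log_u t)) p)) (at t)"
proof -
  let ?h = "\<lambda>t p. inner_grad (u t) (u t) p / u t p"
  let ?L = "laplacian A g (u t)" and ?w = "log_u t" and ?N = "inner_grad (log_u t) (log_u t)"
  have h: "smooth_spacetime A J ?h"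
    by (intro smooth_spacetime_divide smooth_spacetime_inner_grad open_J u_smooth) (use u_pos in force)
  note u = smooth_u[OF t] and w = smooth_log_u[OF t]
  have L: "smooth_fun ?L" by (intro smooth_fun_laplacian u)
  have N: "smooth_fun ?N" by (intro smooth_fun_inner_grad w)
  have td: "inner_grad (u t) (time_deriv u t) p = inner_grad (u t) ?L p" if "p \<in> M" for p
    using inner_grad_cong[OF that L, of "time_deriv u t" "u t"] heat[OF t] by simp
  have "time_deriv ?h t p = 2 * inner_grad ?w ?L p - ?N p * ?L p" if p: "p \<in> M" for p
  proof -
    have pos: "u t p > 0" by (rule u_pos[OF t p])
    have "((\<lambda>s. ?h s p) has_real_derivative
        (2 * inner_grad (u t) (time_deriv u t) p * u t p - inner_grad (u t) (u t) p * ?L p) / (u t p * u t p)) (at t)"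
      using pos by (intro DERIV_divide has_time_derivative_inner_grad[OF open_J u_smooth p t] has_real_derivative_u[OF t p]) simp
    also have "(2 * inner_grad (u t) (time_deriv u t) p * u t p - inner_grad (u t) (u t) p * ?L p) / (u t p * u t p)
        = 2 * inner_grad ?w ?L p - ?N p * ?L p"
      using pos by (simp add: inner_grad_log_u[OF t p] inner_grad_log_u'[OF t p] td[OF p] field_simps)
    finally show ?thesis unfolding time_deriv_def by (rule DERIV_imp_deriv)
  qed
  then have "(LINT p|vol. time_deriv ?h t p) = (LINT p|vol. 2 * inner_grad ?w ?L p - ?N p * ?L p)"
    by (intro Bochner_Integration.integral_cong) (auto simp: space_vol)
  also have "\<dots> = (LINT p|vol. 2 * inner_grad ?w ?L p) - (LINT p|vol. ?N p * ?L p)"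
    by (intro Bochner_Integration.integral_diff integrable_smooth smooth_fun_mult smooth_fun_const smooth_fun_inner_grad w L)
  also have "(LINT p|vol. ?N p * ?L p) = (LINT p|vol. u t p * laplacian A g ?N p)"
    by (rule green_symmetric[OF N u])
  also have "(LINT p|vol. 2 * inner_grad ?w ?L p) = - 2 * (LINT p|vol. ?L p * laplacian A g ?w p)"
    by (simp add: green[OF L w])
  finally show ?thesis
    using has_real_derivative_integral_spacetime[OF open_J h t] by (simp add: fisher_information_def[abs_def])
qed

text \<open>Bochner's formula integrated against \<open>u\<close>. The parameter \<open>s\<close> is kept free: one choice of it gives the
  entropy formula, another one the decay of the Fisher information.\<close>

lemma integral_bochner:
  fixes b s :: real
  assumes t: "t \<in> J"
  defines "F \<equiv> (\<lambda>p. - ln (u t p) - b)"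
  shows "(LINT p|vol. u t p * (hess_minus_metric_norm A g F s p)\<^sup>2) + (LINT p|vol. u t p * ricci_grad A g F p)
    = (1/2) * (LINT p|vol. u t p * laplacian A g (inner_grad (log_u t) (log_u t)) p)
      + (LINT p|vol. laplacian A g (u t) p * laplacian A g (log_u t) p) - 2 * s * fisher_information t + s\<^sup>2 * real CARD('n)"
proof -
  let ?w = "log_u t" and ?Lw = "laplacian A g (log_u t)" and ?N = "inner_grad (log_u t) (log_u t)"
  note u = smooth_u[OF t] and w = smooth_log_u[OF t]
  have Lw: "smooth_fun ?Lw" by (intro smooth_fun_laplacian w)
  have N: "smooth_fun ?N" by (intro smooth_fun_inner_grad w)
  have F_eq: "F = (\<lambda>p. (- 1) * ?w p + (- b))" by (simp add: F_def)
  have F: "smooth_fun F" unfolding F_eq by (intro smooth_fun_add smooth_fun_mult smooth_fun_const w)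
  have gF: "inner_grad E F p = - inner_grad E ?w p" "inner_grad F E p = - inner_grad ?w E p" if p: "p \<in> M" for E p
  proof -
    have "((\<lambda>x. - x - b) has_real_derivative - 1) (at y)" for y by (auto intro!: derivative_eq_intros)
    from inner_grad_compose[OF p w this]
    show *: "inner_grad E F p = - inner_grad E ?w p" for E by (simp add: F_def)
    show "inner_grad F E p = - inner_grad ?w E p"
      using *[of E] inner_grad_commute[OF p] by metis
  qed
  have LF: "laplacian A g F p = - ?Lw p" if "p \<in> M" for p
    unfolding F_eq using laplacian_affine[OF that w, of "- 1" "- b"] by simp
  have "u t p * (hess_minus_metric_norm A g F s p)\<^sup>2 + u t p * ricci_grad A g F p
      = (1/2) * (u t p * laplacian A g ?N p) - inner_grad (u t) ?Lw p + 2 * s * (u t p * ?Lw p) + s\<^sup>2 * real CARD('n) * u t p"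
    if p: "p \<in> M" for p
  proof -
    have e1: "laplacian A g (inner_grad F F) p = laplacian A g ?N p"
      by (rule laplacian_cong[OF p N]) (simp add: gF)
    have "inner_grad F (laplacian A g F) p = inner_grad F (\<lambda>q. - ?Lw q) p"
      by (rule inner_grad_cong[OF p smooth_fun_laplacian[OF F] LF])
    also have "\<dots> = - inner_grad F ?Lw p"
      using inner_grad_compose[OF p Lw DERIV_minus[OF DERIV_ident], of F] by simp
    also have "\<dots> = inner_grad (u t) ?Lw p / u t p" by (simp add: gF[OF p] inner_grad_log_u'[OF t p])
    finally have e2: "inner_grad F (laplacian A g F) p = inner_grad (u t) ?Lw p / u t p" .
    show ?thesis
      using ricci_grad_eq[OF F p, of s] u_pos[OF t p] unfolding e1 e2 LF[OF p] distrib_left[symmetric]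
      by (simp add: field_simps)
  qed
  then have "(LINT p|vol. u t p * (hess_minus_metric_norm A g F s p)\<^sup>2 + u t p * ricci_grad A g F p)
      = (LINT p|vol. (1/2) * (u t p * laplacian A g ?N p) - inner_grad (u t) ?Lw p + 2 * s * (u t p * ?Lw p) + s\<^sup>2 * real CARD('n) * u t p)"
    by (intro Bochner_Integration.integral_cong) (auto simp: space_vol)
  also have "\<dots> = (LINT p|vol. (1/2) * (u t p * laplacian A g ?N p)) - (LINT p|vol. inner_grad (u t) ?Lw p)
      + (LINT p|vol. 2 * s * (u t p * ?Lw p)) + (LINT p|vol. s\<^sup>2 * real CARD('n) * u t p)"
    by (subst Bochner_Integration.integral_add Bochner_Integration.integral_diff;
        (intro integrable_smooth smooth_fun_add smooth_fun_diff smooth_fun_mult smooth_fun_const smooth_fun_inner_grad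
          smooth_fun_laplacian N u w)?)+ (rule refl)
  also have "(LINT p|vol. inner_grad (u t) ?Lw p) = - (LINT p|vol. ?Lw p * laplacian A g (u t) p)"
    by (simp add: green[OF Lw u])
  also have "(LINT p|vol. 2 * s * (u t p * ?Lw p)) = - 2 * s * fisher_information t"
  proof -
    have "(LINT p|vol. inner_grad ?w (u t) p) = fisher_information t"
      unfolding fisher_information_eq[OF t] by (intro Bochner_Integration.integral_cong) (auto simp: space_vol inner_grad_commute)
    then show ?thesis by (simp add: green[OF u w])
  qed
  also have "(LINT p|vol. s\<^sup>2 * real CARD('n) * u t p) = s\<^sup>2 * real CARD('n)"
    using mass[OF t] by simp
  also have "(LINT p|vol. u t p * (hess_minus_metric_norm A g F s p)\<^sup>2 + u t p * ricci_grad A g F p)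
      = (LINT p|vol. u t p * (hess_minus_metric_norm A g F s p)\<^sup>2) + (LINT p|vol. u t p * ricci_grad A g F p)"
    by (intro Bochner_Integration.integral_add integrable_smooth smooth_fun_mult u smooth_fun_ricci_grad
        smooth_fun_hess_minus_metric_norm_sq F)
  finally show ?thesis by (simp add: mult.commute)
qed

text \<open>The integrated Bochner formula eliminates both integrals of the previous lemma.\<close>

lemma has_real_derivative_fisher_information':
  fixes b s :: real
  assumes "t \<in> J"
  defines "F \<equiv> (\<lambda>p. - ln (u t p) - b)"
  shows "(fisher_information has_real_derivative
    - 2 * ((LINT p|vol. u t p * (hess_minus_metric_norm A g F s p)\<^sup>2) + (LINT p|vol. u t p * ricci_grad A g F p)
      + 2 * s * fisher_information t - s\<^sup>2 * real CARD('n))) (at t)"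
  using has_real_derivative_fisher_information[OF assms(1)] unfolding F_def integral_bochner[OF assms(1)]
  by (simp add: algebra_simps)

lemma ricci_grad_nonneg: "nonneg_ricci A g \<Longrightarrow> p \<in> M \<Longrightarrow> 0 \<le> ricci_grad A g F p"
  using chart_at[of p] by (auto simp: nonneg_ricci_def ricci_grad_def Let_def)

lemma integral_nonneg_vol: "(\<And>p. p \<in> M \<Longrightarrow> 0 \<le> h p) \<Longrightarrow> 0 \<le> (LINT p|vol. h p)" for h :: "'m \<Rightarrow> real"
  by (intro integral_nonneg_AE AE_I2) (simp add: space_vol)

text \<open>The choice \<open>s = fisher_information t / n\<close> turns the derivative formula into the differential inequality
  \<open>fisher_information' \<le> - (2 / n) fisher_information\<^sup>2\<close>.\<close>

lemma fisher_information_decay: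
  assumes ric: "nonneg_ricci A g" and t: "t \<in> J"
  obtains D where "(fisher_information has_real_derivative D) (at t)" "D \<le> - (2 / real CARD('n)) * (fisher_information t)\<^sup>2"
proof -
  \<comment> \<open>This is the minimum of \<open>s\<^sup>2 n - 2 s fisher_information t\<close>.\<close>
  define s where "s = fisher_information t / real CARD('n)"
  let ?F = "\<lambda>p. - ln (u t p) - 0"
  let ?S = "(LINT p|vol. u t p * (hess_minus_metric_norm A g ?F s p)\<^sup>2) + (LINT p|vol. u t p * ricci_grad A g ?F p)"
  have "0 \<le> ?S"
    using u_pos[OF t] ricci_grad_nonneg[OF ric] by (intro add_nonneg_nonneg integral_nonneg_vol) (simp_all add: less_imp_le)
  then have "- 2 * (?S + 2 * s * fisher_information t - s\<^sup>2 * real CARD('n)) \<le> - 2 * (2 * s * fisher_information t - s\<^sup>2 * real CARD('n))" by simp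
  also have "\<dots> = - (2 / real CARD('n)) * (fisher_information t)\<^sup>2"
    by (simp add: s_def power2_eq_square field_simps)
  finally show thesis using that has_real_derivative_fisher_information'[OF t, of 0 s] by blast
qed

end

text \<open>A Riccati inequality bounds the solution at time \<open>t\<close> by \<open>1 / (k t)\<close> independently of the initial value,
  since \<open>1 / y\<close> grows at least at rate \<open>k\<close>.\<close>

lemma riccati_bound:
  fixes y :: "real \<Rightarrow> real"
  assumes "0 < k" "0 < t"
    and D: "\<And>s. 0 < s \<Longrightarrow> s \<le> t \<Longrightarrow> \<exists>D. (y has_real_derivative D) (at s) \<and> D \<le> - k * (y s)\<^sup>2"
  shows "y t \<le> 1 / (k * t)"
proof (cases "y t > 0")
  case False
  have "0 \<le> 1 / (k * t)" using assms(1,2) by simp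
  then show ?thesis using False by linarith
next
  case True
  have pos: "y s > 0" if s: "0 < s" "s \<le> t" for s
  proof -
    have "y t \<le> y s"
    proof (rule DERIV_nonpos_imp_nonincreasing[OF s(2)])
      fix x assume "s \<le> x" "x \<le> t"
      then obtain D where "(y has_real_derivative D) (at x)" "D \<le> - k * (y x)\<^sup>2" using D[of x] s by auto
      moreover have "- k * (y x)\<^sup>2 \<le> 0" using assms(1) by simp
      ultimately show "\<exists>D. (y has_real_derivative D) (at x) \<and> D \<le> 0" by (meson order_trans)
    qed
    then show ?thesis using True by simp
  qed
  have bound: "k * (t - s) \<le> 1 / y t" if s: "0 < s" "s \<le> t" for s
  proof -
    have "1 / y s - k * s \<le> 1 / y t - k * t"
    proof (rule DERIV_nonneg_imp_nondecreasing[OF s(2)])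
      fix x assume x: "s \<le> x" "x \<le> t"
      then obtain D where d: "(y has_real_derivative D) (at x)" "D \<le> - k * (y x)\<^sup>2" using D[of x] s by auto
      have px: "y x > 0" using pos[of x] x s by simp
      have "((\<lambda>x. 1 / y x - k * x) has_real_derivative - D / (y x)\<^sup>2 - k) (at x)"
        using px by (auto intro!: derivative_eq_intros d(1) simp: power2_eq_square)
      moreover have "0 \<le> - D / (y x)\<^sup>2 - k" using d(2) px by (simp add: field_simps)
      ultimately show "\<exists>D. ((\<lambda>x. 1 / y x - k * x) has_real_derivative D) (at x) \<and> 0 \<le> D" by blast
    qed
    moreover have "0 < 1 / y s" using pos[OF s] by simp
    ultimately show ?thesis unfolding right_diff_distrib by linarith
  qed
  have "k * t \<le> 1 / y t"
  proof (rule field_le_epsilon)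
    fix e :: real assume e: "0 < e"
    \<comment> \<open>A starting time so early that it costs at most \<open>e\<close>.\<close>
    define s where "s = min t (e / k)"
    have s: "0 < s" "s \<le> t" "k * s \<le> e" using e assms(1,2) by (auto simp: s_def min_def field_simps)
    show "k * t \<le> 1 / y t + e" using bound[OF s(1,2)] s(3) by (simp add: algebra_simps)
  qed
  then show ?thesis using True assms(1,2) by (simp add: field_simps)
qed

context positive_heat_solution
begin

text \<open>The integrated form of the Li-Yau gradient estimate.\<close>

lemma fisher_information_bound:
  assumes "nonneg_ricci A g" "0 < t" "{0<..t} \<subseteq> J"
  shows "fisher_information t \<le> real CARD('n) / (2 * t)"
proof -
  have "fisher_information t \<le> 1 / ((2 / real CARD('n)) * t)"
  proof (rule riccati_bound)
    fix s assume "0 < s" "s \<le> t"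
    then have "s \<in> J" using assms(3) by auto
    then show "\<exists>D. (fisher_information has_real_derivative D) (at s) \<and> D \<le> - (2 / real CARD('n)) * (fisher_information s)\<^sup>2"
      using fisher_information_decay[OF assms(1)] by blast
  qed (use assms(2) in auto)
  then show ?thesis by simp
qed

text \<open>The weight \<open>exp (- f) / (4 \<pi> \<tau>)\<^sup>n\<^sup>/\<^sup>2\<close> is \<open>u\<close>, so that the entropy is a combination of the Fisher information
  and the Shannon entropy.\<close>

lemma W_entropy_eq:
  assumes t: "t \<in> J" and \<tau>: "\<tau> > 0"
  shows "W_entropy M A g (\<lambda>p. - ln (u t p) - real CARD('n) / 2 * ln (4 * pi * \<tau>)) \<tau> a
    = a\<^sup>2 * \<tau> / (2 * pi) * fisher_information t + shannon_entropy t
      + (- (real CARD('n) / 2 * ln (4 * pi * \<tau>)) - real CARD('n)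
         + (if a = 0 then 0 else real CARD('n) / 2 * ln (2 * pi / a\<^sup>2)))"
proof -
  define n where "n = real CARD('n)"
  define C where "C = (if a = 0 then 0 else n / 2 * ln (2 * pi / a\<^sup>2))"
  define k where "k = - (n / 2 * ln (4 * pi * \<tau>)) - n + C"
  let ?F = "\<lambda>p. - ln (u t p) - n / 2 * ln (4 * pi * \<tau>)"
  note u = smooth_u[OF t] and w = smooth_log_u[OF t]
  have "(a\<^sup>2 * \<tau> / (2 * pi) * grad_norm_sq A g ?F p + ?F p - n + C) * (exp (- ?F p) / (4 * pi * \<tau>) powr (n / 2))
      = a\<^sup>2 * \<tau> / (2 * pi) * (inner_grad (u t) (u t) p / u t p) + - (u t p * ln (u t p)) + k * u t p"
    if p: "p \<in> M" for p
  proof -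
    have pos: "u t p > 0" by (rule u_pos[OF t p])
    have density: "exp (- ?F p) / (4 * pi * \<tau>) powr (n / 2) = u t p"
      using \<tau> pos by (simp add: powr_def exp_add)
    have "((\<lambda>x. - x - n / 2 * ln (4 * pi * \<tau>)) has_real_derivative - 1) (at y)" for y
      by (auto intro!: derivative_eq_intros)
    from inner_grad_compose[OF p w this]
    have c: "inner_grad E ?F p = - inner_grad E (log_u t) p" for E by simp
    have "inner_grad ?F ?F p = inner_grad (log_u t) (log_u t) p"
      using c[of ?F] c[of "log_u t"] inner_grad_commute[OF p, of ?F "log_u t"] by simp
    also have "\<dots> = inner_grad (u t) (u t) p / (u t p)\<^sup>2"
      by (simp add: inner_grad_log_u[OF t p] inner_grad_log_u'[OF t p] power2_eq_square)
    finally have "grad_norm_sq A g ?F p = inner_grad (u t) (u t) p / (u t p)\<^sup>2"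
      by (simp add: grad_norm_sq_eq_inner_grad[OF p])
    then show ?thesis
      unfolding density using pos by (simp add: k_def power2_eq_square algebra_simps)
  qed
  then have "W_entropy M A g ?F \<tau> a
      = (LINT p|vol. a\<^sup>2 * \<tau> / (2 * pi) * (inner_grad (u t) (u t) p / u t p) + - (u t p * ln (u t p)) + k * u t p)"
    unfolding W_entropy_def Let_def n_def[symmetric] C_def[symmetric]
    by (intro Bochner_Integration.integral_cong) (auto simp: space_vol)
  also have "\<dots> = (LINT p|vol. a\<^sup>2 * \<tau> / (2 * pi) * (inner_grad (u t) (u t) p / u t p))
      + (LINT p|vol. - (u t p * ln (u t p))) + (LINT p|vol. k * u t p)"
  proof -
    have "smooth_fun (\<lambda>p. inner_grad (u t) (u t) p / u t p)"
      by (intro smooth_fun_divide smooth_fun_inner_grad u) (use u_pos[OF t] in force)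
    then have "integrable vol (\<lambda>p. a\<^sup>2 * \<tau> / (2 * pi) * (inner_grad (u t) (u t) p / u t p))"
      "integrable vol (\<lambda>p. - (u t p * ln (u t p)))" "integrable vol (\<lambda>p. k * u t p)"
      by (intro integrable_smooth smooth_fun_mult smooth_fun_const smooth_fun_minus u w, assumption?)+
    then show ?thesis by simp
  qed
  also have "(LINT p|vol. a\<^sup>2 * \<tau> / (2 * pi) * (inner_grad (u t) (u t) p / u t p)) = a\<^sup>2 * \<tau> / (2 * pi) * fisher_information t"
    unfolding fisher_information_def by (rule integral_mult_right_zero)
  also have "(LINT p|vol. - (u t p * ln (u t p))) = shannon_entropy t" by (rule shannon_entropy_def[symmetric])
  also have "(LINT p|vol. k * u t p) = k" using mass[OF t] by simp
  finally show ?thesis by (simp add: k_def C_def n_def)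
qed

text \<open>The Laplacian of \<open>u\<close> integrates to zero and \<open>u\<close> has mass one.\<close>

lemma integral_li_yau:
  assumes t: "t \<in> J"
  shows "(LINT p|vol. u t p * (grad_norm_sq A g (u t) p / (u t p)\<^sup>2 - laplacian A g (u t) p / u t p - b)) = fisher_information t - b"
proof -
  note u = smooth_u[OF t]
  have "u t p * (grad_norm_sq A g (u t) p / (u t p)\<^sup>2 - laplacian A g (u t) p / u t p - b)
      = inner_grad (u t) (u t) p / u t p - laplacian A g (u t) p - b * u t p" if "p \<in> M" for p
    using u_pos[OF t that] by (simp add: grad_norm_sq_eq_inner_grad[OF that] field_simps power2_eq_square)
  then have "(LINT p|vol. u t p * (grad_norm_sq A g (u t) p / (u t p)\<^sup>2 - laplacian A g (u t) p / u t p - b))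
      = (LINT p|vol. inner_grad (u t) (u t) p / u t p - laplacian A g (u t) p - b * u t p)"
    by (intro Bochner_Integration.integral_cong) (auto simp: space_vol)
  also have "\<dots> = (LINT p|vol. inner_grad (u t) (u t) p / u t p) - (LINT p|vol. laplacian A g (u t) p) - (LINT p|vol. b * u t p)"
  proof -
    have "smooth_fun (\<lambda>p. inner_grad (u t) (u t) p / u t p)"
      by (intro smooth_fun_divide smooth_fun_inner_grad u) (use u_pos[OF t] in force)
    then have "integrable vol (\<lambda>p. inner_grad (u t) (u t) p / u t p)"
      "integrable vol (laplacian A g (u t))" "integrable vol (\<lambda>p. b * u t p)"
      by (intro integrable_smooth smooth_fun_mult smooth_fun_const smooth_fun_laplacian u, assumption?)+
    then show ?thesis by simp
  qed
  finally show ?thesis using mass[OF t] by (simp add: integral_laplacian[OF u] fisher_information_def)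
qed

end

theorem theorem5p1:
  fixes M :: "'m::t2_space set"
    and A :: "('m, 'n::finite) chart set"
    and g :: "('m, 'n) metric"
    and T :: ereal
    and u f :: "real \<Rightarrow> 'm \<Rightarrow> real"
    and \<tau> :: "real \<Rightarrow> real"
    and a :: real
  defines "n \<equiv> real CARD('n)"
    and "I \<equiv> {t::real. 0 < t \<and> ereal t < T}"
    and "dx \<equiv> riemannian_volume M A g"
  assumes manifold: "closed_riemannian_manifold M A g"
    and T_pos: "0 < T"
    and u_smooth: "smooth_spacetime A I u"
    and u_pos: "\<And>t p. t \<in> I \<Longrightarrow> p \<in> M \<Longrightarrow> u t p > 0"
    and heat: "\<And>t p. t \<in> I \<Longrightarrow> p \<in> M \<Longrightarrow> laplacian A g (u t) p - deriv (\<lambda>s. u s p) t = 0"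
    and u_mass: "\<And>t. t \<in> I \<Longrightarrow> (LINT p|dx. u t p) = 1"
    and \<tau>_pos: "\<And>t. t \<in> I \<Longrightarrow> \<tau> t > 0"
    and \<tau>_deriv: "\<And>t. t \<in> I \<Longrightarrow> (\<tau> has_real_derivative 1) (at t)"
    and f_def: "f = (\<lambda>t p. - ln (u t p) - n / 2 * ln (4 * pi * \<tau> t))"
  shows "(\<forall>t\<in>I. ((\<lambda>s. W_entropy M A g (f s) (\<tau> s) a) has_real_derivative
            (- (a\<^sup>2 * \<tau> t / pi) *
                (LINT p|dx. u t p * (hess_minus_metric_norm A g (f t) (1 / (2 * \<tau> t)) p)\<^sup>2)
             - a\<^sup>2 * \<tau> t / pi * (LINT p|dx. u t p * ricci_grad A g (f t) p)
             + (1 - a\<^sup>2 / (2 * pi)) *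
                (LINT p|dx. u t p * (grad_norm_sq A g (u t) p / (u t p)\<^sup>2
                   - laplacian A g (u t) p / u t p - n / (2 * \<tau> t))))) (at t))
       \<and> (0 \<le> a\<^sup>2 \<and> a\<^sup>2 \<le> 2 * pi \<and> (\<forall>t\<in>I. \<tau> t = t) \<and> nonneg_ricci A g \<longrightarrow>
            antimono_on I (\<lambda>t. W_entropy M A g (f t) t a)
          \<and> (\<forall>t\<in>I. deriv (\<lambda>s. W_entropy M A g (f s) s a) t \<le> 0))"
proof -
  have "I = {0<..} \<inter> ereal -` {..<T}" by (auto simp: I_def)
  then have I: "open I"
    by (simp add: open_Int open_vimage[OF open_lessThan continuous_on_ereal[OF continuous_on_id]])
  interpret closed_riemannian_manifold M A g by (rule manifold)
  interpret positive_heat_solution M A g I u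
    by unfold_locales (use I u_smooth u_pos heat u_mass in \<open>auto simp: time_deriv_def dx_def\<close>)
  have n: "n > 0" by (simp add: n_def)
  define S where "S = (\<lambda>t. (LINT p|dx. u t p * (hess_minus_metric_norm A g (f t) (1 / (2 * \<tau> t)) p)\<^sup>2)
     + (LINT p|dx. u t p * ricci_grad A g (f t) p))"
  define W' where "W' = (\<lambda>t. - (a\<^sup>2 * \<tau> t / pi) * S t + (1 - a\<^sup>2 / (2 * pi)) * (fisher_information t - n / (2 * \<tau> t)))"
  define C where "C = (if a = 0 then 0 else n / 2 * ln (2 * pi / a\<^sup>2))"
  have W: "W_entropy M A g (f t) (\<tau> t) a
      = a\<^sup>2 * \<tau> t / (2 * pi) * fisher_information t + shannon_entropy t + (- (n / 2 * ln (4 * pi * \<tau> t)) - n + C)" if "t \<in> I" for t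
    using W_entropy_eq[OF that \<tau>_pos[OF that]] by (simp add: f_def n_def C_def)
  have dW: "((\<lambda>s. W_entropy M A g (f s) (\<tau> s) a) has_real_derivative W' t) (at t)" if t: "t \<in> I" for t
  proof -
    note pos = \<tau>_pos[OF t]
    have dF: "(fisher_information has_real_derivative - 2 * (S t + fisher_information t / \<tau> t - n / (4 * (\<tau> t)\<^sup>2))) (at t)"
      using has_real_derivative_fisher_information'[OF t, of "n / 2 * ln (4 * pi * \<tau> t)" "1 / (2 * \<tau> t)"]
      by (simp add: S_def dx_def f_def n_def power_divide power_mult_distrib)
    have dln: "((\<lambda>s. ln (4 * pi * \<tau> s)) has_real_derivative 1 / \<tau> t) (at t)"
      using pos by (auto intro!: derivative_eq_intros \<tau>_deriv[OF t] simp: field_simps)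
    have d\<tau>: "((\<lambda>s. a\<^sup>2 * \<tau> s / (2 * pi)) has_real_derivative a\<^sup>2 / (2 * pi)) (at t)"
      by (auto intro!: derivative_eq_intros \<tau>_deriv[OF t])
    have "((\<lambda>s. a\<^sup>2 * \<tau> s / (2 * pi) * fisher_information s + shannon_entropy s + (- (n / 2 * ln (4 * pi * \<tau> s)) - n + C)) has_real_derivative
        (a\<^sup>2 / (2 * pi) * fisher_information t + (- 2 * (S t + fisher_information t / \<tau> t - n / (4 * (\<tau> t)\<^sup>2))) * (a\<^sup>2 * \<tau> t / (2 * pi)) + fisher_information t
          + (- (n / 2 * (1 / \<tau> t)) - 0 + 0))) (at t)"
      by (intro DERIV_add DERIV_diff DERIV_minus DERIV_mult DERIV_cmult DERIV_const d\<tau> dF dln has_real_derivative_shannon_entropy t)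
    also have "a\<^sup>2 / (2 * pi) * fisher_information t + (- 2 * (S t + fisher_information t / \<tau> t - n / (4 * (\<tau> t)\<^sup>2))) * (a\<^sup>2 * \<tau> t / (2 * pi)) + fisher_information t
          + (- (n / 2 * (1 / \<tau> t)) - 0 + 0) = W' t"
      using pos by (simp add: W'_def field_simps power2_eq_square)
    finally show ?thesis
      by (rule has_field_derivative_transform_within_open[OF _ I t]) (simp add: W)
  qed
  have W'_eq: "W' t = - (a\<^sup>2 * \<tau> t / pi) *
                (LINT p|dx. u t p * (hess_minus_metric_norm A g (f t) (1 / (2 * \<tau> t)) p)\<^sup>2)
             - a\<^sup>2 * \<tau> t / pi * (LINT p|dx. u t p * ricci_grad A g (f t) p)
             + (1 - a\<^sup>2 / (2 * pi)) *
                (LINT p|dx. u t p * (grad_norm_sq A g (u t) p / (u t p)\<^sup>2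
                   - laplacian A g (u t) p / u t p - n / (2 * \<tau> t)))" if "t \<in> I" for t
    unfolding W'_def S_def dx_def integral_li_yau[OF that] by (simp add: distrib_left)
  have mono: "antimono_on I (\<lambda>t. W_entropy M A g (f t) t a) \<and> (\<forall>t\<in>I. deriv (\<lambda>s. W_entropy M A g (f s) s a) t \<le> 0)"
    if a: "a\<^sup>2 \<le> 2 * pi" and \<tau>: "\<forall>t\<in>I. \<tau> t = t" and ric: "nonneg_ricci A g"
  proof -
    have neg: "W' t \<le> 0" if t: "t \<in> I" for t
    proof -
      have t0: "0 < t" "{0<..t} \<subseteq> I" using t by (auto simp: I_def intro: le_less_trans[of "ereal _" "ereal t"])
      have "0 \<le> S t"
        unfolding S_def dx_def using u_pos[OF t] ricci_grad_nonneg[OF ric]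
        by (intro add_nonneg_nonneg integral_nonneg_vol) (simp_all add: less_imp_le)
      then have "- (a\<^sup>2 * \<tau> t / pi) * S t \<le> 0" using \<tau>_pos[OF t] by simp
      moreover have "fisher_information t - n / (2 * \<tau> t) \<le> 0" using fisher_information_bound[OF ric t0] \<tau> t by (simp add: n_def)
      moreover have "0 \<le> 1 - a\<^sup>2 / (2 * pi)" using a by simp
      ultimately have "(1 - a\<^sup>2 / (2 * pi)) * (fisher_information t - n / (2 * \<tau> t)) \<le> 0" by (intro mult_nonneg_nonpos)
      with \<open>- (a\<^sup>2 * \<tau> t / pi) * S t \<le> 0\<close> show ?thesis unfolding W'_def by (rule add_nonpos_nonpos)
    qed
    have d: "((\<lambda>s. W_entropy M A g (f s) s a) has_real_derivative W' t) (at t)" if t: "t \<in> I" for t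
      by (rule has_field_derivative_transform_within_open[OF dW[OF t] I t]) (simp add: \<tau>)
    show ?thesis
    proof (intro conjI ballI monotone_onI)
      fix s t assume s: "s \<in> I" and t: "t \<in> I" and le: "s \<le> t"
      show "W_entropy M A g (f t) t a \<le> W_entropy M A g (f s) s a"
      proof (rule DERIV_nonpos_imp_nonincreasing[OF le])
        fix x assume "s \<le> x" "x \<le> t"
        then have "x \<in> I" using s t by (auto simp: I_def intro: le_less_trans[of "ereal _" "ereal t"])
        then show "\<exists>y. ((\<lambda>s. W_entropy M A g (f s) s a) has_real_derivative y) (at x) \<and> y \<le> 0"
          using d neg by blast
      qed
    next
      fix t assume "t \<in> I"
      then show "deriv (\<lambda>s. W_entropy M A g (f s) s a) t \<le> 0" using DERIV_imp_deriv[OF d] neg by simp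
    qed
  qed
  show ?thesis using dW mono W'_eq by simp
qed

end
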